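(* Let $X\in\mathrm{Alex}(k)$ and let $F\subseteq X$ be a closed subset. Then $F$ is extremal in $X$ if and only if, for any $p\in F$ and any $\eta,\zeta\in\Sigma_pX$, there is $\xi\in\Sigma_pF$ with $|\eta\xi|\leqslant\frac{\pi}{2}$ such that $$\cos|\eta\zeta|\geqslant\cos|\eta\xi|\cos|\zeta\xi|,$$ where, if $\Sigma_pF=\emptyset$, this condition is understood to mean that $\cos|\eta\zeta|\geqslant 0$.
   Context: $\mathrm{Alex}(k)$ is the set of complete, finite-dimensional Alexandrov spaces with curvature $\geqslant k$ ($k\in\mathbb R$). For points $p,q\in X$, $|pq|$ is the distance and $[pq]$ a minimal geodesic between them. $\Sigma_pX$ is the space of directions of $X$ at $p$, and $|\cdot\,\cdot|$ also denotes its distance. For $q\ne p$, $\uparrow_p^q$ is the direction at $p$ of a given $[pq]$, and $\Uparrow_p^q\subseteq\Sigma_pX$ is the closed set of directions at $p$ of all minimal geodesics from $p$ to $q$. For subsets $A,B\subseteq\Sigma_pX$, $|AB|$ is the distance between them (infimum of distances). For $F\subseteq X$ and $p\in F$, $\Sigma_pF$ is the set of $\xi\in\Sigma_pX$ for which there are points $p_i\in F\setminus\{p\}$ with $p_i\to p$ and directions $\uparrow_p^{p_i}\to\xi$. Extremal: a closed subset $F\subseteq X$ is extremal in $X$ if whenever $q\in X\setminus F$ and the distance function $\mathrm{dist}_q|_F$ attains its minimum at $p\in F$, then $|\Uparrow_p^q\Uparrow_p^r|\leqslant\frac{\pi}{2}$ for all $r\in X\setminus\{p\}$ (because $q$ is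 arbitrary, this is equivalent to $|\uparrow_p^q\Uparrow_p^r|\leqslant\frac{\pi}{2}$ for every $[pq]$). *)

theory Defs
  imports "HOL-Analysis.Analysis"
begin

section \<open>Length spaces and Hausdorff dimension\<close>

definition curve_length :: "(real \<Rightarrow> 'a::metric_space) \<Rightarrow> ennreal" where
  "curve_length g =
     (SUP ts \<in> {ts. sorted ts \<and> set ts \<subseteq> {0..1}}.
        \<Sum>i < length ts - 1. ennreal (dist (g (ts ! i)) (g (ts ! Suc i))))"

definition length_space :: "'a::metric_space itself \<Rightarrow> bool" where
  "length_space _ \<longleftrightarrow>
     (\<forall>x y :: 'a. ennreal (dist x y) =
        (INF g \<in> {g. path g \<and> pathstart g = x \<and> pathfinish g = y}. curve_length g))"

text \<open>
  The library's \<^const>\<open>diameter\<close> is meaningful only for bounded sets, hence the boundedness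
  condition. Since \<open>0 powr 0 = 0\<close>, the value at \<open>s = 0\<close> is not counting measure; the dimension
  below only uses \<open>s > 0\<close>, which does not change the infimum.
\<close>

definition hausdorff_measure :: "real \<Rightarrow> 'a::metric_space set \<Rightarrow> ennreal" where
  "hausdorff_measure s A =
     (SUP \<delta> \<in> {0<..}.
        INF U \<in> {U :: nat \<Rightarrow> 'a set. A \<subseteq> (\<Union>n. U n) \<and> (\<forall>n. bounded (U n) \<and> diameter (U n) \<le> \<delta>)}.
          \<Sum>n. ennreal (diameter (U n) powr s))"

definition hausdorff_dim :: "'a::metric_space set \<Rightarrow> ereal" where
  "hausdorff_dim A = Inf {ereal s |s. 0 < s \<and> hausdorff_measure s A = 0}"

section \<open>Curvature bounded below\<close>

text \<open>
  The angle between the sides of lengths \<open>x\<close>, \<open>y\<close> in a triangle with third side \<open>z\<close> in the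
  simply connected surface of constant curvature \<open>k\<close> (law of cosines). It is meaningful for
  positive \<open>x\<close>, \<open>y\<close> and, if \<open>k > 0\<close>, for \<open>x + y + z < 2 * pi / sqrt k\<close>.
\<close>

definition model_angle :: "real \<Rightarrow> real \<Rightarrow> real \<Rightarrow> real \<Rightarrow> real" where
  "model_angle k x y z =
    (if k = 0 then arccos ((x\<^sup>2 + y\<^sup>2 - z\<^sup>2) / (2 * x * y))
     else if k > 0 then
       (let c = sqrt k in
         arccos ((cos (c * z) - cos (c * x) * cos (c * y)) / (sin (c * x) * sin (c * y))))
     else
       (let c = sqrt (- k) in
         arccos ((cosh (c * x) * cosh (c * y) - cosh (c * z)) / (sinh (c * x) * sinh (c * y)))))"

definition comparison_angle :: "real \<Rightarrow> 'a::metric_space \<Rightarrow> 'a \<Rightarrow> 'a \<Rightarrow> real" where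
  "comparison_angle k a b c = model_angle k (dist a b) (dist a c) (dist b c)"

text \<open>
  The four-point condition of Burago, Gromov and Perelman. It is inherited by smaller balls, so
  for \<open>k > 0\<close> the radius may be taken so small that all comparison triangles exist.
\<close>

definition curvature_ge :: "real \<Rightarrow> 'a::metric_space itself \<Rightarrow> bool" where
  "curvature_ge k _ \<longleftrightarrow>
     (\<forall>x :: 'a. \<exists>r > 0. \<forall>a \<in> ball x r. \<forall>b \<in> ball x r. \<forall>c \<in> ball x r. \<forall>d \<in> ball x r.
        a \<notin> {b, c, d} \<longrightarrow>
        comparison_angle k a b c + comparison_angle k a c d + comparison_angle k a d b \<le> 2 * pi)"

text \<open>
  The last conjunct is the usual convention excluding long circles, long segments, rays and
  lines when \<open>k > 0\<close>; in higher dimension the diameter bound is automatic.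
\<close>

definition Alex :: "real \<Rightarrow> 'a::metric_space itself \<Rightarrow> bool" where
  "Alex k X \<longleftrightarrow>
     complete (UNIV :: 'a set) \<and> length_space X \<and> curvature_ge k X \<and>
     hausdorff_dim (UNIV :: 'a set) < \<infinity> \<and>
     (k > 0 \<and> hausdorff_dim (UNIV :: 'a set) \<le> 1 \<longrightarrow> (\<forall>x y :: 'a. dist x y \<le> pi / sqrt k))"

section \<open>Completion of a pseudometric\<close>

definition cauchy_seqs :: "'b set \<Rightarrow> ('b \<Rightarrow> 'b \<Rightarrow> real) \<Rightarrow> (nat \<Rightarrow> 'b) set" where
  "cauchy_seqs S d =
     {u. range u \<subseteq> S \<and> (\<forall>e > 0. \<exists>N. \<forall>m \<ge> N. \<forall>n \<ge> N. d (u m) (u n) < e)}"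

definition cauchy_rel :: "'b set \<Rightarrow> ('b \<Rightarrow> 'b \<Rightarrow> real) \<Rightarrow> ((nat \<Rightarrow> 'b) \<times> (nat \<Rightarrow> 'b)) set" where
  "cauchy_rel S d =
     {(u, v). u \<in> cauchy_seqs S d \<and> v \<in> cauchy_seqs S d \<and> (\<lambda>n. d (u n) (v n)) \<longlonglongrightarrow> 0}"

definition cauchy_completion :: "'b set \<Rightarrow> ('b \<Rightarrow> 'b \<Rightarrow> real) \<Rightarrow> (nat \<Rightarrow> 'b) set set" where
  "cauchy_completion S d = cauchy_seqs S d // cauchy_rel S d"

definition cauchy_completion_dist ::
    "('b \<Rightarrow> 'b \<Rightarrow> real) \<Rightarrow> (nat \<Rightarrow> 'b) set \<Rightarrow> (nat \<Rightarrow> 'b) set \<Rightarrow> real" where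
  "cauchy_completion_dist d A B = (THE l. \<forall>u \<in> A. \<forall>v \<in> B. (\<lambda>n. d (u n) (v n)) \<longlonglongrightarrow> l)"

definition cauchy_completion_embed :: "'b set \<Rightarrow> ('b \<Rightarrow> 'b \<Rightarrow> real) \<Rightarrow> 'b \<Rightarrow> (nat \<Rightarrow> 'b) set" where
  "cauchy_completion_embed S d x = cauchy_rel S d `` {\<lambda>_. x}"

section \<open>Spaces of directions\<close>

text \<open>
  Unit speed parametrization on \<open>[0, |pq|]\<close>; the values of \<open>\<gamma>\<close> elsewhere are irrelevant.
\<close>

definition min_geodesic :: "(real \<Rightarrow> 'a::metric_space) \<Rightarrow> 'a \<Rightarrow> 'a \<Rightarrow> bool" where
  "min_geodesic \<gamma> p q \<longleftrightarrow>
     \<gamma> 0 = p \<and> \<gamma> (dist p q) = q \<and>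
     (\<forall>s \<in> {0..dist p q}. \<forall>t \<in> {0..dist p q}. dist (\<gamma> s) (\<gamma> t) = \<bar>s - t\<bar>)"

definition geodesics_from :: "'a::metric_space \<Rightarrow> (real \<Rightarrow> 'a) set" where
  "geodesics_from p = {\<gamma>. \<exists>q. q \<noteq> p \<and> min_geodesic \<gamma> p q}"

definition geodesic_angle :: "(real \<Rightarrow> 'a::metric_space) \<Rightarrow> (real \<Rightarrow> 'a) \<Rightarrow> real" where
  "geodesic_angle \<gamma> \<sigma> = Lim (at_right 0 \<times>\<^sub>F at_right 0) (\<lambda>(s, t). comparison_angle 0 (\<gamma> 0) (\<gamma> s) (\<sigma> t))"

text \<open>
  Geodesics enclosing angle \<open>0\<close> are identified and the resulting metric space is completed;
  both steps are performed at once by completing the pseudometric \<^const>\<open>geodesic_angle\<close>.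
\<close>

type_synonym 'a direction = "(nat \<Rightarrow> real \<Rightarrow> 'a) set"

definition directions :: "'a::metric_space \<Rightarrow> 'a direction set" where
  "directions p = cauchy_completion (geodesics_from p) geodesic_angle"

definition dir_dist :: "'a::metric_space direction \<Rightarrow> 'a direction \<Rightarrow> real" where
  "dir_dist = cauchy_completion_dist geodesic_angle"

definition dir_setdist :: "'a::metric_space direction set \<Rightarrow> 'a direction set \<Rightarrow> real" where
  "dir_setdist A B = Inf {dir_dist \<xi> \<eta> |\<xi> \<eta>. \<xi> \<in> A \<and> \<eta> \<in> B}"

definition dirs_to :: "'a::metric_space \<Rightarrow> 'a \<Rightarrow> 'a direction set" where
  "dirs_to p q = {cauchy_completion_embed (geodesics_from p) geodesic_angle \<gamma> |\<gamma>. min_geodesic \<gamma> p q}"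

definition directions_of :: "'a::metric_space \<Rightarrow> 'a set \<Rightarrow> 'a direction set" where
  "directions_of p F =
     {\<xi> \<in> directions p. \<exists>x \<theta>. (\<forall>i :: nat. x i \<in> F - {p} \<and> \<theta> i \<in> dirs_to p (x i)) \<and>
        x \<longlonglongrightarrow> p \<and> (\<lambda>i. dir_dist (\<theta> i) \<xi>) \<longlonglongrightarrow> 0}"

section \<open>Extremal subsets\<close>

definition extremal :: "'a::metric_space set \<Rightarrow> bool" where
  "extremal F \<longleftrightarrow> closed F \<and>
     (\<forall>q. q \<notin> F \<longrightarrow> (\<forall>p \<in> F. (\<forall>x \<in> F. dist q p \<le> dist q x) \<longrightarrow>
        (\<forall>r. r \<noteq> p \<longrightarrow> dir_setdist (dirs_to p q) (dirs_to p r) \<le> pi / 2)))"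

end

theory Submission
  imports Defs
begin

text \<open>
  For the direction from right to left, take \<open>\<eta>\<close> pointing to \<open>q\<close> and \<open>\<zeta>\<close> pointing to \<open>r\<close>. If
  \<open>p\<close> minimizes the distance to \<open>q\<close> on \<open>F\<close>, no \<open>\<xi> \<in> \<Sigma>\<^sub>pF\<close> makes an acute angle with \<open>\<eta>\<close>, so
  \<open>cos |\<eta>\<xi>| = 0\<close> and the condition says \<open>cos |\<eta>\<zeta>| \<ge> 0\<close>.

  Conversely, let \<open>\<eta>\<close>, \<open>\<zeta>\<close> be the directions of geodesics \<open>\<gamma>\<close>, \<open>\<sigma>\<close>; the general case follows by
  compactness. Choose scales \<open>l \<rightarrow> 0\<close> along which \<open>dist (\<gamma> l) F / l\<close> tends to its lower limit \<open>\<phi>\<close>, and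
  nearest points \<open>x\<close> of \<open>F\<close> to \<open>\<gamma> l\<close>, with \<open>dist p x / l \<rightarrow> a\<close> and directions tending to \<open>\<xi>\<close>.
  In the limit everything takes place in the Euclidean cone over the space of directions:
  extremality at \<open>x\<close> bounds the angle at \<open>a\<xi>\<close> between \<open>\<eta>\<close> and \<open>\<zeta>\<close> by \<open>\<pi>/2\<close>, whence
  \<open>cos |\<eta>\<zeta>| \<ge> a cos |\<eta>\<xi>| + a cos |\<zeta>\<xi>| - a\<^sup>2\<close>, and minimality of \<open>\<phi>\<close> among all scales forces
  \<open>a = cos |\<eta>\<xi>|\<close>. No information on the conical structure of \<open>F\<close> at \<open>p\<close> is needed.

  Compactness comes from the Hausdorff dimension: curvature bounded below lets a separated set be
  contracted towards any nearby point, so balls with too many separated points would contain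
  Cantor sets of arbitrarily large dimension.
\<close>

section \<open>Comparison angles\<close>

text \<open>A bound \<open>k\<close> of any sign is weakened to one local hyperbolic condition, so
  its sign matters only once. What shapes the preparations is the absence of geodesics: a length
  space offers only almost shortest curves. Packing numbers are therefore bounded with approximate
  between-points; properness and geodesics come out of these bounds, and only then do angles and
  directions make sense.

  In the cone, the ratio of the distance between \<open>M\<eta>\<close> and \<open>a\<xi>\<close> to
  \<open>M\<close> is least at \<open>M = 1\<close>, and differentiating in \<open>M\<close> gives
  \<open>a = cos |\<eta>\<xi>|\<close>. The legs of the hinge at \<open>a\<xi>\<close> have squares
  \<open>1 + a^2 - 2a cos |\<eta>\<xi>|\<close> and \<open>1 + a^2 - 2a cos |\<zeta>\<xi>|\<close>;
  with this \<open>a\<close> the terms in \<open>a^2\<close> cancel and exactly the product of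
  cosines remains.

  If \<open>a = 0\<close>, no \<open>\<xi>\<close> is singled out. Then \<open>\<phi> = 1\<close>,
  and \<open>\<eta>\<close> is within \<open>pi / 2\<close> of every direction and exactly at
  \<open>pi / 2\<close> from those of \<open>F\<close>, so any of them serves. If
  \<open>\<eta>\<close> is itself a direction of \<open>F\<close>, it serves as
  \<open>\<xi>\<close>.\<close>

definition ecos :: "real \<Rightarrow> real \<Rightarrow> real \<Rightarrow> real" where
  "ecos x y z = (x\<^sup>2 + y\<^sup>2 - z\<^sup>2) / (2 * x * y)"

definition hcos :: "real \<Rightarrow> real \<Rightarrow> real \<Rightarrow> real" where
  "hcos x y z = (cosh x * cosh y - cosh z) / (sinh x * sinh y)"

definition scos :: "real \<Rightarrow> real \<Rightarrow> real \<Rightarrow> real" where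
  "scos x y z = (cos z - cos x * cos y) / (sin x * sin y)"

text \<open>This is \<open>1 - cos A = 2 sin^2 (A / 2)\<close> in terms of the sides. The numbers
  \<open>u = (z + x - y) / 2\<close> and \<open>v = (z - x + y) / 2\<close> have sum
  \<open>z\<close> and difference \<open>x - y\<close>, so all three geometries share the form
  \<open>2 f(u) f(v) / (f(x) f(y))\<close> with \<open>f\<close> the identity, \<open>sinh\<close>
  or \<open>sin\<close>. Comparing geometries reduces to comparing quotients of
  \<open>f\<close>.\<close>

lemma one_minus_ecos:
  assumes "x > 0" "y > 0"
  shows "1 - ecos x y z = 2 * (((z + x - y) / 2) * ((z - x + y) / 2)) / (x * y)"
  using assms by (simp add: ecos_def field_simps power2_eq_square)

lemma one_minus_hcos:
  assumes "x > 0" "y > 0"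
  shows "1 - hcos x y z = 2 * (sinh ((z + x - y) / 2) * sinh ((z - x + y) / 2)) / (sinh x * sinh y)"
proof -
  let ?u = "(z + x - y) / 2" and ?v = "(z - x + y) / 2"
  have uv: "?u + ?v = z" "?u - ?v = x - y"
    by (simp_all add: field_simps)
  have "cosh z - cosh (x - y) = 2 * (sinh ?u * sinh ?v)"
    using cosh_add[of ?u ?v] cosh_diff[of ?u ?v] unfolding uv by simp
  moreover have "sinh x * sinh y > 0"
    using assms by simp
  moreover have "1 - hcos x y z = (cosh z - cosh (x - y)) / (sinh x * sinh y)"
    using assms by (auto simp: hcos_def cosh_diff diff_divide_distrib)
  ultimately show ?thesis by simp
qed

lemma one_minus_scos:
  assumes "0 < x" "x < pi" "0 < y" "y < pi"
  shows "1 - scos x y z = 2 * (sin ((z + x - y) / 2) * sin ((z - x + y) / 2)) / (sin x * sin y)"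
proof -
  let ?u = "(z + x - y) / 2" and ?v = "(z - x + y) / 2"
  have uv: "?u + ?v = z" "?u - ?v = x - y"
    by (simp_all add: field_simps)
  have "cos (x - y) - cos z = 2 * (sin ?u * sin ?v)"
    using cos_add[of ?u ?v] cos_diff[of ?u ?v] unfolding uv by simp
  moreover have "sin x * sin y > 0"
    using assms by (simp add: sin_gt_zero)
  moreover have "1 - scos x y z = (cos (x - y) - cos z) / (sin x * sin y)"
    using calculation(2) by (auto simp: zero_less_mult_iff scos_def cos_diff diff_divide_distrib add_divide_distrib)
  ultimately show ?thesis by simp
qed

text \<open>In other words \<open>sinh t / t\<close> increases; the product form admits
  \<open>u = 0\<close>. Both arguments are scaled by a common \<open>t\<close>, and the derivative
  in \<open>t\<close> has a sign because \<open>cosh\<close> increases.\<close>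

lemma sinh_quotient_mono:
  fixes u x :: real
  assumes "0 \<le> u" "u \<le> x"
  shows "x * sinh u \<le> u * sinh x"
proof (cases "u = 0 \<or> u = x")
  case False
  have D: "DERIV (\<lambda>t. x * sinh (u * t) - u * sinh (x * t)) t :> u * x * (cosh (u * t) - cosh (x * t))" for t
    by (auto intro!: derivative_eq_intros simp: algebra_simps)
  have "(\<lambda>t. x * sinh (u * t) - u * sinh (x * t)) 1 \<le> (\<lambda>t. x * sinh (u * t) - u * sinh (x * t)) 0"
  proof (rule DERIV_nonpos_imp_nonincreasing[OF zero_le_one])
    fix t :: real assume t: "0 \<le> t" "t \<le> 1"
    have "cosh (u * t) \<le> cosh (x * t)"
      using assms t by (subst cosh_real_nonneg_le_iff) (auto intro: mult_right_mono)
    then show "\<exists>y. DERIV (\<lambda>t. x * sinh (u * t) - u * sinh (x * t)) t :> y \<and> y \<le> 0"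
      using assms by (intro exI[of _ "u * x * (cosh (u * t) - cosh (x * t))"] conjI D) (simp add: mult_nonneg_nonpos)
  qed
  then show ?thesis by simp
qed auto

lemma sin_quotient_mono:
  fixes u x :: real
  assumes "0 \<le> u" "u \<le> x" "x \<le> pi"
  shows "u * sin x \<le> x * sin u"
proof (cases "u = 0 \<or> u = x")
  case False
  have D: "DERIV (\<lambda>t. u * sin (x * t) - x * sin (u * t)) t :> u * x * (cos (x * t) - cos (u * t))" for t
    by (auto intro!: derivative_eq_intros simp: algebra_simps)
  have "(\<lambda>t. u * sin (x * t) - x * sin (u * t)) 1 \<le> (\<lambda>t. u * sin (x * t) - x * sin (u * t)) 0"
  proof (rule DERIV_nonpos_imp_nonincreasing[OF zero_le_one])
    fix t :: real assume t: "0 \<le> t" "t \<le> 1"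
    have "x * t \<le> pi" using assms t
      by (metis mult_left_le mult_nonneg_nonneg order.trans)
    then have "cos (x * t) \<le> cos (u * t)"
      using assms t by (subst cos_mono_le_eq) (auto intro: mult_right_mono order.trans[of _ "x*t"])
    then show "\<exists>y. DERIV (\<lambda>t. u * sin (x * t) - x * sin (u * t)) t :> y \<and> y \<le> 0"
      using assms by (intro exI[of _ "u * x * (cos (x * t) - cos (u * t))"] conjI D) (simp add: mult_nonneg_nonpos)
  qed
  then show ?thesis by simp
qed auto

lemma sinh_ge_self: "(0::real) \<le> x \<Longrightarrow> x \<le> sinh x"
proof -
  assume "0 \<le> x"
  have "(\<lambda>t. sinh t - t) 0 \<le> (\<lambda>t. sinh t - t) x"
    by (rule DERIV_nonneg_imp_nondecreasing[OF \<open>0 \<le> x\<close>])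
       (auto intro!: exI derivative_eq_intros cosh_real_ge_1)
  then show ?thesis by simp
qed

lemma sinh_le_mult:
  fixes x m :: real
  assumes "0 \<le> x" "x \<le> m"
  shows "sinh x \<le> cosh m * x"
proof -
  have "(\<lambda>t. cosh m * t - sinh t) 0 \<le> (\<lambda>t. cosh m * t - sinh t) x"
  proof (rule DERIV_nonneg_imp_nondecreasing[OF \<open>0 \<le> x\<close>])
    fix t assume "0 \<le> t" "t \<le> x"
    then have "cosh t \<le> cosh m" using assms by (subst cosh_real_nonneg_le_iff) auto
    then show "\<exists>y. DERIV (\<lambda>t. cosh m * t - sinh t) t :> y \<and> 0 \<le> y"
      by (auto intro!: exI derivative_eq_intros)
  qed
  then show ?thesis by simp
qed

text \<open>The two sides at the vertex are positive, but the opposite side may vanish: points on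
  two different geodesics may coincide.\<close>

definition triangle_sides :: "real \<Rightarrow> real \<Rightarrow> real \<Rightarrow> bool" where
  "triangle_sides x y z \<longleftrightarrow> 0 < x \<and> 0 < y \<and> \<bar>x - y\<bar> \<le> z \<and> z \<le> x + y"

lemma tri_dist: "a \<noteq> b \<Longrightarrow> a \<noteq> d \<Longrightarrow> triangle_sides (dist a b) (dist a d) (dist b d)"
  unfolding triangle_sides_def
  by (smt (verit) dist_commute dist_triangle dist_triangle2 zero_less_dist_iff)

lemma tri_scale: "0 < c \<Longrightarrow> triangle_sides x y z \<Longrightarrow> triangle_sides (c * x) (c * y) (c * z)"
  unfolding triangle_sides_def
  by (auto simp: abs_mult right_diff_distrib[symmetric] distrib_left[symmetric])

lemma ecos_scale: "0 < c \<Longrightarrow> ecos (c * x) (c * y) (c * z) = ecos x y z"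
proof -
  assume "0 < c"
  have "ecos (c * x) (c * y) (c * z) = (c\<^sup>2 * (x\<^sup>2 + y\<^sup>2 - z\<^sup>2)) / (c\<^sup>2 * (2 * x * y))"
    by (simp add: ecos_def algebra_simps power2_eq_square)
  with \<open>0 < c\<close> show ?thesis by (simp add: ecos_def)
qed

lemma ecos_bounds:
  assumes "triangle_sides x y z"
  shows "ecos x y z \<le> 1" "-1 \<le> ecos x y z"
proof -
  have p: "x > 0" "y > 0" "0 \<le> z + x - y" "0 \<le> z - x + y" "0 \<le> z" "z \<le> x + y"
    using assms by (auto simp: triangle_sides_def abs_le_iff)
  show "ecos x y z \<le> 1"
    using p one_minus_ecos[of x y z] by (smt (verit) divide_nonneg_nonneg mult_nonneg_nonneg)
  have "z\<^sup>2 \<le> (x + y)\<^sup>2" using p by (intro power_mono) auto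
  then show "-1 \<le> ecos x y z"
    using p by (simp add: ecos_def divide_simps power2_eq_square algebra_simps)
qed

lemma hcos_bounds:
  assumes "triangle_sides x y z"
  shows "hcos x y z \<le> 1" "-1 \<le> hcos x y z"
proof -
  have p: "x > 0" "y > 0" "0 \<le> z + x - y" "0 \<le> z - x + y" "0 \<le> z" "z \<le> x + y"
    using assms by (auto simp: triangle_sides_def abs_le_iff)
  have s: "sinh x * sinh y > 0" using p by simp
  have "0 \<le> 1 - hcos x y z"
    unfolding one_minus_hcos[OF p(1,2)] using p by (intro divide_nonneg_nonneg mult_nonneg_nonneg) auto
  then show "hcos x y z \<le> 1" by simp
  have "cosh z \<le> cosh (x + y)" using p by (subst cosh_real_nonneg_le_iff) auto
  then show "-1 \<le> hcos x y z"
    using s by (simp add: hcos_def pos_le_divide_eq cosh_add)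
qed

text \<open>The triangle inequality \<open>z \<le> x + y\<close> gives \<open>?u \<le> x\<close> and
  \<open>?v \<le> y\<close>, and \<open>sinh t / t\<close> increases. For the sphere
  \<open>sin t / t\<close> decreases, which puts the spherical cosine below the Euclidean
  one.\<close>

lemma ecos_le_hcos:
  assumes "triangle_sides x y z"
  shows "ecos x y z \<le> hcos x y z"
proof -
  let ?u = "(z + x - y) / 2" and ?v = "(z - x + y) / 2"
  have p: "x > 0" "y > 0" "0 \<le> ?u" "0 \<le> ?v" "?u \<le> x" "?v \<le> y"
    using assms by (auto simp: triangle_sides_def abs_le_iff)
  have "(x * sinh ?u) * (y * sinh ?v) \<le> (?u * sinh x) * (?v * sinh y)"
    using p by (intro mult_mono sinh_quotient_mono) auto
  then have "2 * (sinh ?u * sinh ?v) / (sinh x * sinh y) \<le> 2 * (?u * ?v) / (x * y)"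
    using p(1,2) by (simp add: divide_simps mult_ac)
  then show ?thesis
    using one_minus_ecos[OF p(1,2)] one_minus_hcos[OF p(1,2)] by (smt (verit))
qed

lemma scos_le_ecos:
  assumes "triangle_sides x y z" "x < pi" "y < pi"
  shows "scos x y z \<le> ecos x y z"
proof -
  let ?u = "(z + x - y) / 2" and ?v = "(z - x + y) / 2"
  have p: "x > 0" "y > 0" "0 \<le> ?u" "0 \<le> ?v" "?u \<le> x" "?v \<le> y"
    using assms by (auto simp: triangle_sides_def abs_le_iff)
  have q: "0 < sin x" "0 < sin y" using p assms by (auto intro: sin_gt_zero)
  have "(?u * sin x) * (?v * sin y) \<le> (x * sin ?u) * (y * sin ?v)"
  proof (rule mult_mono)
    show "?u * sin x \<le> x * sin ?u" "?v * sin y \<le> y * sin ?v"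
      using p assms by (intro sin_quotient_mono; simp)+
    then show "0 \<le> x * sin ?u"
      using p q by (smt (verit) mult_nonneg_nonneg)
    show "0 \<le> ?v * sin y"
      using p q by (intro mult_nonneg_nonneg) auto
  qed
  then have "2 * (?u * ?v) / (x * y) \<le> 2 * (sin ?u * sin ?v) / (sin x * sin y)"
    using p(1,2) q by (simp add: divide_simps mult_ac)
  then show ?thesis
    using one_minus_ecos[OF p(1,2)] one_minus_scos[of x y z] p assms by (smt (verit))
qed

text \<open>Keeps the spherical cosine in the domain of \<open>arccos\<close>: for sides below a
  quarter circle, \<open>x + y\<close> stays below \<open>pi\<close>, where \<open>cos\<close>
  decreases.\<close>

lemma scos_ge_minus1:
  assumes "triangle_sides x y z" "x < pi / 2" "y < pi / 2"
  shows "-1 \<le> scos x y z"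
proof -
  have p: "x > 0" "y > 0" "0 \<le> z" "z \<le> x + y"
    using assms by (auto simp: triangle_sides_def)
  have q: "0 < sin x * sin y" using p assms by (auto intro!: mult_pos_pos sin_gt_zero)
  have "cos (x + y) \<le> cos z" using p assms by (subst cos_mono_le_eq) auto
  then show ?thesis
    using q by (simp add: scos_def pos_le_divide_eq cos_add)
qed

lemma one_minus_ecos_le:
  assumes "triangle_sides x y z" "x \<le> m" "y \<le> m"
  shows "1 - ecos x y z \<le> (cosh m)\<^sup>2 * (1 - hcos x y z)"
proof -
  let ?u = "(z + x - y) / 2" and ?v = "(z - x + y) / 2" and ?M = "cosh m"
  have p: "x > 0" "y > 0" "0 \<le> ?u" "0 \<le> ?v"
    using assms by (auto simp: triangle_sides_def abs_le_iff)
  have "(?u * sinh x) * (?v * sinh y) \<le> (sinh ?u * (?M * x)) * (sinh ?v * (?M * y))"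
    using p assms by (intro mult_mono sinh_le_mult sinh_ge_self) auto
  then have "2 * (?u * ?v) / (x * y) \<le> ?M\<^sup>2 * (2 * (sinh ?u * sinh ?v) / (sinh x * sinh y))"
    using p(1,2) by (simp add: divide_simps mult_ac power2_eq_square)
  then show ?thesis
    using one_minus_ecos[OF p(1,2)] one_minus_hcos[OF p(1,2)] by simp
qed

text \<open>Bounding \<open>sinh\<close> by \<open>cosh m\<close> times its argument on both
  adjacent sides costs the factor \<open>(cosh m)\<^sup>2\<close>, which tends to 1 with
  \<open>m\<close> tending to 0. Monotonicity can thus be proved for the hyperbolic cosine although
  \<open>geodesic_angle\<close> is defined by Euclidean ones.\<close>

lemma hcos_ecos_close:
  assumes "triangle_sides x y z" "x \<le> m" "y \<le> m"
  shows "hcos x y z - ecos x y z \<le> 2 * ((cosh m)\<^sup>2 - 1)"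
proof -
  have "hcos x y z - ecos x y z \<le> ((cosh m)\<^sup>2 - 1) * (1 - hcos x y z)"
    using one_minus_ecos_le[OF assms] by (simp add: algebra_simps)
  also have "\<dots> \<le> ((cosh m)\<^sup>2 - 1) * 2"
    using hcos_bounds[OF assms(1)] by (intro mult_left_mono) (auto simp: one_le_power cosh_real_ge_1)
  finally show ?thesis by simp
qed

section \<open>Weakening the curvature bound to a hyperbolic four-point condition\<close>

lemma comparison_angle_0: "comparison_angle 0 a b d = arccos (ecos (dist a b) (dist a d) (dist b d))"
  by (simp add: comparison_angle_def model_angle_def ecos_def)

text \<open>For \<open>c > 0\<close> this is the comparison angle in the hyperbolic plane of
  curvature \<open>- c\<^sup>2\<close>.\<close>

definition hangle :: "real \<Rightarrow> 'a::metric_space \<Rightarrow> 'a \<Rightarrow> 'a \<Rightarrow> real" where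
  "hangle c a b d = arccos (hcos (c * dist a b) (c * dist a d) (c * dist b d))"

definition four_point :: "real \<Rightarrow> 'a::metric_space set \<Rightarrow> bool" where
  "four_point c S \<longleftrightarrow> (\<forall>a\<in>S. \<forall>b\<in>S. \<forall>x\<in>S. \<forall>y\<in>S. a \<notin> {b, x, y} \<longrightarrow>
      hangle c a b x + hangle c a x y + hangle c a y b \<le> 2 * pi)"

lemma hangle_le_0:
  assumes "0 < c" "a \<noteq> b" "a \<noteq> d"
  shows "hangle c a b d \<le> comparison_angle 0 a b d"
proof -
  have t: "triangle_sides (c * dist a b) (c * dist a d) (c * dist b d)"
    using assms by (intro tri_scale tri_dist)
  then have "ecos (dist a b) (dist a d) (dist b d) \<le> hcos (c * dist a b) (c * dist a d) (c * dist b d)"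
    using ecos_le_hcos[OF t] ecos_scale[OF assms(1)] by simp
  then show ?thesis
    unfolding hangle_def comparison_angle_0
    using ecos_bounds[OF tri_dist[OF assms(2,3)]] hcos_bounds[OF t] by (intro arccos_le_arccos) auto
qed

lemma comparison_angle_0_le_pos:
  assumes "0 < k" "a \<noteq> b" "a \<noteq> d" "sqrt k * dist a b < pi / 2" "sqrt k * dist a d < pi / 2"
  shows "comparison_angle 0 a b d \<le> comparison_angle k a b d"
proof -
  let ?c = "sqrt k"
  have c: "?c > 0" using assms by simp
  have t: "triangle_sides (?c * dist a b) (?c * dist a d) (?c * dist b d)"
    using assms c by (intro tri_scale tri_dist)
  have "comparison_angle k a b d = arccos (scos (?c * dist a b) (?c * dist a d) (?c * dist b d))"
    using assms by (simp add: comparison_angle_def model_angle_def scos_def Let_def)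
  moreover have "scos (?c * dist a b) (?c * dist a d) (?c * dist b d) \<le> ecos (dist a b) (dist a d) (dist b d)"
    using scos_le_ecos[OF t] ecos_scale[OF c] assms pi_gt_zero by auto
  ultimately show ?thesis
    unfolding comparison_angle_0
    using ecos_bounds[OF tri_dist[OF assms(2,3)]] scos_ge_minus1[OF t assms(4,5)]
    by (auto intro: arccos_le_arccos)
qed

text \<open>A smaller model curvature gives smaller comparison angles, so the bound
  \<open>2 * pi\<close> on their sum survives. Hence \<open>k \<ge> 0\<close> may be replaced by
  curvature \<open>-1\<close>, and for \<open>k < 0\<close> the condition is already
  hyperbolic.\<close>

lemma curvature_ge_four_point:
  assumes "curvature_ge k TYPE('a::metric_space)"
  obtains c where "c > 0" "\<And>x::'a. \<exists>r>0. four_point c (ball x r)"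
proof (cases "k < 0")
  case True
  have "\<exists>r>0. four_point (sqrt (- k)) (ball x r)" for x :: 'a
    using assms True
    by (auto simp: curvature_ge_def four_point_def hangle_def hcos_def comparison_angle_def
        model_angle_def Let_def)
  then show ?thesis using that[of "sqrt (-k)"] True by auto
next
  case False
  have "\<exists>r>0. four_point 1 (ball x r)" for x :: 'a
  proof -
    obtain r where r: "r > 0" and *: "\<forall>a \<in> ball x r. \<forall>b \<in> ball x r. \<forall>c \<in> ball x r. \<forall>d \<in> ball x r.
        a \<notin> {b, c, d} \<longrightarrow>
        comparison_angle k a b c + comparison_angle k a c d + comparison_angle k a d b \<le> 2 * pi"
      using spec[OF assms[unfolded curvature_ge_def], of x] by blast
    \<comment> \<open>Two points of a ball of radius \<open>pi / (4 * sqrt k)\<close> are less than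
      \<open>pi / (2 * sqrt k)\<close> apart, which keeps the sides below a quarter circle.\<close>
    define r' where "r' = (if k = 0 then r else min r (pi / (4 * sqrt k)))"
    have r': "r' > 0" "r' \<le> r" using r False by (auto simp: r'_def)
    have le: "hangle 1 a b d \<le> comparison_angle k a b d"
      if "a \<in> ball x r'" "b \<in> ball x r'" "d \<in> ball x r'" "a \<noteq> b" "a \<noteq> d" for a b d
    proof -
      have "hangle 1 a b d \<le> comparison_angle 0 a b d" using that by (intro hangle_le_0) auto
      moreover have "comparison_angle 0 a b d \<le> comparison_angle k a b d" if k: "k > 0"
      proof -
        have d: "dist a y < pi / (2 * sqrt k)" if "y \<in> ball x r'" for y
          using that \<open>a \<in> ball x r'\<close> k dist_triangle2[of a y x]
          by (auto simp: r'_def dist_commute split: if_splits)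
        have "sqrt k * dist a y < pi / 2" if "y \<in> ball x r'" for y
          using d[OF that] k by (simp add: field_simps)
        with that k show ?thesis
          using \<open>b \<in> ball x r'\<close> \<open>d \<in> ball x r'\<close> \<open>a \<noteq> b\<close> \<open>a \<noteq> d\<close> by (intro comparison_angle_0_le_pos) auto
      qed
      ultimately show ?thesis using False by (cases "k = 0") auto
    qed
    have "four_point 1 (ball x r')"
      unfolding four_point_def
    proof (intro ballI impI)
      fix a b y z assume h: "a \<in> ball x r'" "b \<in> ball x r'" "y \<in> ball x r'" "z \<in> ball x r'" "a \<notin> {b, y, z}"
      then have "comparison_angle k a b y + comparison_angle k a y z + comparison_angle k a z b \<le> 2 * pi"
        using r' * by auto
      then show "hangle 1 a b y + hangle 1 a y z + hangle 1 a z b \<le> 2 * pi"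
        using le[of a b y] le[of a y z] le[of a z b] h by auto
    qed
    with r' show ?thesis by blast
  qed
  then show ?thesis using that[of 1] by auto
qed

section \<open>Stewart inequalities from the four-point condition\<close>

lemma cos_lipschitz: "\<bar>cos x - cos y\<bar> \<le> \<bar>x - y\<bar>" for x y :: real
proof -
  have "\<bar>cos x - cos y\<bar> = 2 * \<bar>sin ((x + y) / 2)\<bar> * \<bar>sin ((y - x) / 2)\<bar>"
    by (simp add: cos_diff_cos abs_mult)
  also have "\<dots> \<le> 2 * 1 * \<bar>(y - x) / 2\<bar>"
    using abs_sin_x_le_abs_x[of "(y - x) / 2"] abs_sin_le_one[of "(x + y) / 2"] by (intro mult_mono) auto
  finally show ?thesis by simp
qed

text \<open>For \<open>C = pi\<close> this says that \<open>A + B \<le> pi\<close> makes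
  \<open>cos A + cos B\<close> nonnegative. In general \<open>A + B\<close> exceeds
  \<open>pi\<close> by at most \<open>pi - C\<close>, and \<open>cos\<close> is 1-Lipschitz.\<close>

lemma cos_add_ge_of_sum_le:
  fixes A B C :: real
  assumes "0 \<le> A" "A \<le> pi" "0 \<le> B" "B \<le> pi" "C \<le> pi" "A + B + C \<le> 2 * pi"
  shows "- (pi - C) \<le> cos A + cos B"
proof -
  define B' where "B' = min pi (pi + (pi - C) - A)"
  have "cos B' \<le> cos B"
    using assms by (subst cos_mono_le_eq) (auto simp: B'_def)
  moreover have "\<bar>cos B' - cos (pi - A)\<bar> \<le> pi - C"
    by (rule order.trans[OF cos_lipschitz]) (use assms in \<open>auto simp: B'_def abs_le_iff\<close>)
  moreover have "cos (pi - A) = - cos A" by simp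
  ultimately show ?thesis by linarith
qed

lemma hangle_bounds:
  assumes "0 < c" "a \<noteq> b" "a \<noteq> d"
  shows "0 \<le> hangle c a b d" "hangle c a b d \<le> pi"
    "cos (hangle c a b d) = hcos (c * dist a b) (c * dist a d) (c * dist b d)"
proof -
  have t: "triangle_sides (c * dist a b) (c * dist a d) (c * dist b d)"
    using assms by (intro tri_scale tri_dist)
  show "0 \<le> hangle c a b d" "hangle c a b d \<le> pi"
    "cos (hangle c a b d) = hcos (c * dist a b) (c * dist a d) (c * dist b d)"
    using hcos_bounds[OF t] by (auto simp: hangle_def arccos_lbound arccos_ubound)
qed

lemma hcos_commute: "hcos x y z = hcos y x z"
  by (simp add: hcos_def mult.commute)

text \<open>
  The angle defect in the last term lets \<open>a\<close> be a point of an almost minimal curve; the existence of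
  minimal geodesics is only derived later, from this inequality via packing numbers.
\<close>

lemma stewart_approx:
  assumes "four_point c S" "0 < c" "a \<in> S" "b \<in> S" "x \<in> S" "y \<in> S" "a \<noteq> b" "a \<noteq> x"
  shows "sinh (c * dist a x) * cosh (c * dist b y) + sinh (c * dist a b) * cosh (c * dist x y)
    \<le> sinh (c * dist a b + c * dist a x) * cosh (c * dist a y)
      + (pi - hangle c a b x) * sinh (c * dist a b) * sinh (c * dist a x) * sinh (c * dist a y)"
proof (cases "a = y")
  case True
  then show ?thesis by (simp add: sinh_add dist_commute)
next
  case False
  define s t z where "s = c * dist a b" "t = c * dist a x" "z = c * dist a y"
  have p: "sinh s > 0" "sinh t > 0" "sinh z > 0"
    using assms False by (auto simp: s_t_z_def)
  have "hangle c a b x + hangle c a x y + hangle c a y b \<le> 2 * pi"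
    using assms False by (auto simp: four_point_def)
  then have "- (pi - hangle c a b x) \<le> cos (hangle c a x y) + cos (hangle c a y b)"
    using assms False by (intro cos_add_ge_of_sum_le hangle_bounds) (auto simp: algebra_simps)
  also have "\<dots> = hcos t z (c * dist x y) + hcos s z (c * dist b y)"
    using assms False by (simp add: hangle_bounds(3) s_t_z_def hcos_commute dist_commute)
  finally have "- (pi - hangle c a b x) * (sinh s * sinh t * sinh z)
      \<le> (hcos t z (c * dist x y) + hcos s z (c * dist b y)) * (sinh s * sinh t * sinh z)"
    using p by (intro mult_right_mono) auto
  also have "\<dots> = (cosh t * cosh z - cosh (c * dist x y)) * sinh s
        + (cosh s * cosh z - cosh (c * dist b y)) * sinh t"
    using p by (simp add: hcos_def distrib_right)
  finally show ?thesis
    unfolding s_t_z_def[symmetric] sinh_add by (simp add: algebra_simps)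
qed

lemma hcos_degenerate: "0 < x \<Longrightarrow> 0 < y \<Longrightarrow> hcos x y (x + y) = -1"
  by (simp add: hcos_def cosh_add)

text \<open>The comparison angle at \<open>a\<close> is \<open>pi\<close>, so the defect term
  disappears; if \<open>a\<close> is an end of the segment, both sides agree.\<close>

lemma stewart:
  assumes "four_point c S" "0 < c" "a \<in> S" "b \<in> S" "x \<in> S" "y \<in> S"
    and "dist b x = dist a b + dist a x"
  shows "sinh (c * dist a x) * cosh (c * dist b y) + sinh (c * dist a b) * cosh (c * dist x y)
    \<le> sinh (c * dist a b + c * dist a x) * cosh (c * dist a y)"
proof (cases "a = b \<or> a = x")
  case False
  then have "hangle c a b x = pi"
    using assms(2,7) hcos_degenerate[of "c * dist a b" "c * dist a x"]
    by (simp add: hangle_def distrib_left)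
  then show ?thesis
    using stewart_approx[OF assms(1-6)] False by simp
qed auto

text \<open>Stewart's inequality seen from an end of the divided side: prolonging one side of a
  hinge from \<open>s\<close> to \<open>s + u\<close> can only raise the cosine at its vertex. Here
  \<open>t\<close> is the other side, \<open>z\<close> and \<open>w\<close> are the opposite sides
  before and after, and the error \<open>e\<close> is carried along.\<close>

lemma hcos_le_of_stewart:
  assumes "0 < s" "0 \<le> u" "0 < t"
    and "sinh u * cosh t + sinh s * C2 \<le> sinh (s + u) * cosh z + e" "C2 = cosh w"
  shows "hcos s t z \<le> hcos (s + u) t w + e / (sinh s * sinh (s + u) * sinh t)"
proof -
  have p: "sinh s > 0" "sinh (s + u) > 0" "sinh t > 0" using assms by auto
  have id: "cosh s * sinh (s + u) - sinh u = sinh s * cosh (s + u)"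
    using sinh_diff[of "s + u" s] by simp
  have "hcos s t z * (sinh s * sinh (s + u) * sinh t) = (cosh s * cosh t - cosh z) * sinh (s + u)"
    using p by (simp add: hcos_def)
  also have "\<dots> \<le> (cosh s * sinh (s + u) - sinh u) * cosh t - sinh s * C2 + e"
    using assms(4) by (simp add: algebra_simps)
  also have "\<dots> = (cosh (s + u) * cosh t - cosh w) * sinh s + e"
    unfolding id by (simp add: algebra_simps assms(5))
  also have "\<dots> = (hcos (s + u) t w + e / (sinh s * sinh (s + u) * sinh t)) * (sinh s * sinh (s + u) * sinh t)"
    using p by (simp add: hcos_def distrib_right)
  finally show ?thesis
    using p by (simp add: mult_le_cancel_right)
qed

text \<open>Monotonicity of comparison angles: as a point moves away from \<open>p\<close> along a
  shortest path, the comparison angle at \<open>p\<close> does not grow. Betweenness of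
  \<open>a\<close> stands in for a geodesic, whose existence is still open here.\<close>

lemma hcos_mono:
  assumes "four_point c S" "0 < c" "p \<in> S" "a \<in> S" "b \<in> S" "y \<in> S"
    and "dist p b = dist p a + dist a b" "p \<noteq> a" "p \<noteq> y"
  shows "hcos (c * dist p a) (c * dist p y) (c * dist a y) \<le> hcos (c * dist p b) (c * dist p y) (c * dist b y)"
proof -
  have "sinh (c * dist a b) * cosh (c * dist p y) + sinh (c * dist p a) * cosh (c * dist b y)
    \<le> sinh (c * dist p a + c * dist a b) * cosh (c * dist a y) + 0"
    using stewart[OF assms(1,2,4,3,5,6)] assms(7) by (simp add: dist_commute)
  from hcos_le_of_stewart[OF _ _ _ this refl] show ?thesis
    using assms by (simp add: distrib_left)
qed

text \<open>\<open>hcos_mono\<close> for points \<open>\<alpha> n\<close> that lie between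
  \<open>x\<close> and \<open>a\<close> only in the limit. The error has to be uniform in the
  partners \<open>y n\<close>, which will be moving points themselves; it is, because every
  \<open>dist (\<alpha> n) (y n)\<close> is at most \<open>s + t\<close>.\<close>

lemma hcos_shrink:
  fixes x a :: "'a::metric_space"
  assumes "four_point c S" "0 < c" "x \<in> S" "a \<in> S"
    and \<alpha>: "\<And>n. \<alpha> n \<in> S" "\<And>n. dist x (\<alpha> n) = s" "(\<lambda>n. dist (\<alpha> n) a) \<longlonglongrightarrow> dist x a - s"
    and y: "\<And>n. y n \<in> S" "\<And>n. dist x (y n) = t"
    and s: "0 < s" "s < dist x a" and t: "0 < t" and e: "0 < e"
  shows "\<forall>\<^sub>F n in sequentially. hcos (c * s) (c * t) (c * dist (\<alpha> n) (y n))
           \<le> hcos (c * dist x a) (c * t) (c * dist a (y n)) + e"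
proof -
  define u where "u = dist x a - s"
  define \<tau> where "\<tau> n = dist (\<alpha> n) a" for n
  have u: "0 < u" using s by (simp add: u_def)
  have \<tau>: "\<tau> \<longlonglongrightarrow> u" using \<alpha>(3) by (simp add: \<tau>_def[abs_def] u_def)
  have D: "cosh (c * dist (\<alpha> n) (y n)) \<le> cosh (c * (s + t))" "sinh (c * dist (\<alpha> n) (y n)) \<le> sinh (c * (s + t))" for n
    using dist_triangle[of "\<alpha> n" "y n" x] \<alpha>(2) y(2) \<open>0 < c\<close> s t
    by (auto simp: dist_commute cosh_real_nonneg_le_iff)
  \<comment> \<open>The triangle \<open>x\<close>, \<open>\<alpha> n\<close>, \<open>a\<close>
    degenerates, so its comparison angle at \<open>\<alpha> n\<close> tends to
    \<open>pi\<close>.\<close>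
  define \<delta> where "\<delta> n = pi - hangle c (\<alpha> n) x a" for n
  have "(\<lambda>n. hangle c (\<alpha> n) x a) \<longlonglongrightarrow> arccos (- 1)"
    unfolding hangle_def
  proof (rule continuous_on_tendsto_compose[OF continuous_on_arccos'])
    have "(\<lambda>n. hcos (c * s) (c * \<tau> n) (c * dist x a)) \<longlonglongrightarrow> hcos (c * s) (c * u) (c * dist x a)"
      unfolding hcos_def using \<tau> \<open>0 < c\<close> s u by (auto intro!: tendsto_intros)
    then show "(\<lambda>n. hcos (c * dist (\<alpha> n) x) (c * dist (\<alpha> n) a) (c * dist x a)) \<longlonglongrightarrow> - 1"
      using hcos_degenerate[of "c * s" "c * u"] \<alpha>(2) \<open>0 < c\<close> s u
      by (simp add: \<tau>_def dist_commute u_def distrib_left[symmetric])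
    show "\<forall>\<^sub>F n in sequentially. hcos (c * dist (\<alpha> n) x) (c * dist (\<alpha> n) a) (c * dist x a) \<in> {- 1..1}"
      using order_tendstoD(1)[OF \<tau> u]
    proof eventually_elim
      case (elim n)
      have "\<alpha> n \<noteq> x" "\<alpha> n \<noteq> a" using elim \<alpha>(2)[of n] s by (auto simp: \<tau>_def)
      from hcos_bounds[OF tri_scale[OF \<open>0 < c\<close> tri_dist[OF this]]] show ?case by auto
    qed
  qed auto
  then have \<delta>: "\<delta> \<longlonglongrightarrow> 0"
    unfolding \<delta>_def[abs_def] by (auto intro!: tendsto_eq_intros)
  \<comment> \<open>Two errors come from replacing \<open>\<tau> n\<close> by its limit
    \<open>u\<close> in the coefficients, the third from the angle defect
    \<open>\<delta> n\<close>.\<close>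
  define E where "E n = \<bar>sinh (c * u) - sinh (c * \<tau> n)\<bar> * cosh (c * t)
      + \<bar>sinh (c * s + c * \<tau> n) - sinh (c * s + c * u)\<bar> * cosh (c * (s + t))
      + \<bar>\<delta> n * sinh (c * s) * sinh (c * \<tau> n)\<bar> * sinh (c * (s + t))" for n
  have "E \<longlonglongrightarrow> \<bar>sinh (c * u) - sinh (c * u)\<bar> * cosh (c * t)
      + \<bar>sinh (c * s + c * u) - sinh (c * s + c * u)\<bar> * cosh (c * (s + t))
      + \<bar>0 * sinh (c * s) * sinh (c * u)\<bar> * sinh (c * (s + t))"
    unfolding E_def[abs_def] by (intro tendsto_intros \<tau> \<delta>)
  then have "(\<lambda>n. E n / (sinh (c * s) * sinh (c * s + c * u) * sinh (c * t))) \<longlonglongrightarrow> 0"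
    by (intro tendsto_divide_zero) simp
  then have "\<forall>\<^sub>F n in sequentially. E n / (sinh (c * s) * sinh (c * s + c * u) * sinh (c * t)) < e"
    using e by (intro order_tendstoD(2))
  with order_tendstoD(1)[OF \<tau> u] show ?thesis
  proof eventually_elim
    case (elim n)
    define z where "z = c * dist (\<alpha> n) (y n)"
    have ne: "\<alpha> n \<noteq> x" "\<alpha> n \<noteq> a" using elim \<alpha>(2)[of n] s by (auto simp: \<tau>_def)
    have "sinh (c * \<tau> n) * cosh (c * t) + sinh (c * s) * cosh (c * dist a (y n))
      \<le> sinh (c * s + c * \<tau> n) * cosh z + \<delta> n * sinh (c * s) * sinh (c * \<tau> n) * sinh z"
      using stewart_approx[OF assms(1,2) \<alpha>(1)[of n] assms(3,4) y(1)[of n] ne] \<alpha>(2)[of n] y(2)[of n]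
      by (simp add: \<tau>_def \<delta>_def z_def dist_commute)
    moreover have "sinh (c * u) * cosh (c * t) - sinh (c * \<tau> n) * cosh (c * t)
        \<le> \<bar>sinh (c * u) - sinh (c * \<tau> n)\<bar> * cosh (c * t)"
      unfolding left_diff_distrib[symmetric] by (intro mult_right_mono) (auto simp: order.trans[OF zero_le_one cosh_real_ge_1])
    moreover have "sinh (c * s + c * \<tau> n) * cosh z - sinh (c * s + c * u) * cosh z
        \<le> \<bar>sinh (c * s + c * \<tau> n) - sinh (c * s + c * u)\<bar> * cosh (c * (s + t))"
      unfolding left_diff_distrib[symmetric] using D[of n]
      by (intro mult_mono) (auto simp: z_def order.trans[OF zero_le_one cosh_real_ge_1])
    moreover have "\<delta> n * sinh (c * s) * sinh (c * \<tau> n) * sinh z \<le> \<bar>\<delta> n * sinh (c * s) * sinh (c * \<tau> n)\<bar> * sinh (c * (s + t))"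
      using D[of n] \<open>0 < c\<close> by (intro mult_mono) (auto simp: z_def)
    ultimately have "sinh (c * u) * cosh (c * t) + sinh (c * s) * cosh (c * dist a (y n))
      \<le> sinh (c * s + c * u) * cosh z + E n"
      unfolding E_def by linarith
    from hcos_le_of_stewart[OF _ _ _ this refl] show ?case
      using elim s t u \<open>0 < c\<close> by (simp add: z_def u_def distrib_left[symmetric])
  qed
qed

text \<open>Since \<open>2 * s * t * (1 - ecos s t z) = z^2 - (s - t)^2\<close>, the hypothesis on
  cosines becomes one on squared sides. The bound 2 on \<open>(cosh m)\<^sup>2\<close> pays for the
  passage between the geometries, and the slack \<open>z\<^sup>2 / (8 * s * t)\<close> costs half of
  \<open>z^2\<close>; together they account for the lost factor 2 in the conclusion.\<close>

lemma dist_lower_bound_of_hcos: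
  assumes "triangle_sides s t z" "triangle_sides (l * s) (l * t) z'" "s \<le> m" "t \<le> m" "0 < l" "l \<le> 1" "(cosh m)\<^sup>2 \<le> 2"
    and "hcos (l * s) (l * t) z' \<le> hcos s t z + z\<^sup>2 / (8 * s * t)"
  shows "l * z \<le> 2 * z'"
proof -
  let ?M = "(cosh m)\<^sup>2"
  have p: "s > 0" "t > 0" "0 \<le> z'" "0 \<le> z" using assms(1,2) by (auto simp: triangle_sides_def)
  have M: "?M \<ge> 1" by (simp add: one_le_power cosh_real_ge_1)
  have "1 - ecos s t z \<le> ?M * (1 - hcos s t z)"
    using assms by (intro one_minus_ecos_le)
  also have "\<dots> \<le> 2 * (1 - hcos (l * s) (l * t) z' + z\<^sup>2 / (8 * s * t))"
    using assms hcos_bounds(1)[OF assms(1)] by (intro mult_mono) auto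
  also have "\<dots> \<le> 2 * (1 - ecos (l * s) (l * t) z') + z\<^sup>2 / (4 * s * t)"
    using ecos_le_hcos[OF assms(2)] by (simp add: field_simps)
  finally have *: "1 - ecos s t z \<le> 2 * (1 - ecos (l * s) (l * t) z') + z\<^sup>2 / (4 * s * t)" .
  have 1: "(1 - ecos s t z) * (2 * s * t) = z\<^sup>2 - (s - t)\<^sup>2"
    using p by (simp add: ecos_def field_simps power2_eq_square)
  have 2: "(1 - ecos (l * s) (l * t) z') * (2 * s * t) * l\<^sup>2 = z'\<^sup>2 - l\<^sup>2 * (s - t)\<^sup>2"
    using p assms(5) by (simp add: ecos_def field_simps power2_eq_square)
  have 3: "z\<^sup>2 / (4 * s * t) * (2 * s * t) = z\<^sup>2 / 2" using p by (simp add: field_simps)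
  have "(1 - ecos s t z) * (2 * s * t) * l\<^sup>2 \<le> (2 * (1 - ecos (l * s) (l * t) z') + z\<^sup>2 / (4 * s * t)) * (2 * s * t) * l\<^sup>2"
    using * p assms by (intro mult_right_mono) auto
  then have "(z\<^sup>2 - (s - t)\<^sup>2) * l\<^sup>2 \<le> 2 * (z'\<^sup>2 - l\<^sup>2 * (s - t)\<^sup>2) + z\<^sup>2 / 2 * l\<^sup>2"
    unfolding 1 3[symmetric] 2[symmetric] by (simp add: algebra_simps)
  then have "l\<^sup>2 * z\<^sup>2 + l\<^sup>2 * (s - t)\<^sup>2 \<le> 2 * z'\<^sup>2 + l\<^sup>2 * z\<^sup>2 / 2"
    by (simp add: algebra_simps)
  moreover have "0 \<le> l\<^sup>2 * (s - t)\<^sup>2" by simp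
  ultimately have "l\<^sup>2 * z\<^sup>2 \<le> 4 * z'\<^sup>2"
    using zero_le_power2[of z'] by linarith
  then have "(l * z)\<^sup>2 \<le> (2 * z')\<^sup>2"
    by (simp add: power_mult_distrib)
  then show ?thesis
    using p by (intro power2_le_imp_le[of "l * z" "2 * z'"]) auto
qed

section \<open>A lower bound for the Hausdorff dimension\<close>

text \<open>\<open>D\<close> is the diameter of the \<open>i\<close>-th covering set, and
  \<open>n\<close> the last level of a tree with ratio \<open>\<mu>\<close> at which
  \<open>D\<close> is below half the separation. The branching condition
  \<open>1 \<le> real N * \<mu> powr s\<close> then bounds the weight of one branch at level
  \<open>Suc n\<close> by a multiple of \<open>D powr s\<close>. The geometric term serves sets of
  diameter 0, which are small at every level and get level \<open>i + 2\<close>.\<close>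

lemma choose_scale:
  fixes D l \<mu> s :: real and N i :: nat
  assumes "0 \<le> D" "D < l / 2" "0 < \<mu>" "\<mu> < 1" "0 < s" "1 \<le> real N * \<mu> powr s" "2 \<le> N"
  shows "\<exists>n. D < l / 2 * \<mu> ^ n \<and> (1 / real N) ^ Suc n \<le> (2 / l) powr s * D powr s + (1 / 2) ^ (i + 2)"
proof (cases "D = 0")
  case True
  have "(1 / real N) ^ Suc (i + 2) \<le> (1 / 2) ^ Suc (i + 2)"
    using assms(7) by (intro power_mono) (auto simp: field_simps)
  also have "\<dots> \<le> (1 / 2) ^ (i + 2)" by simp
  finally show ?thesis
    using True assms by (intro exI[of _ "i + 2"]) auto
next
  case False
  then have D: "0 < D" and l: "0 < l" using assms by auto
  obtain n0 where "\<mu> ^ n0 < D / (l / 2)"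
    using real_arch_pow_inv[of "D / (l / 2)" \<mu>] assms D l by auto
  then have ex: "\<exists>n. \<not> D < l / 2 * \<mu> ^ n"
    using l by (intro exI[of _ n0]) (simp add: field_simps)
  define k where "k = (LEAST n. \<not> D < l / 2 * \<mu> ^ n)"
  have k: "\<not> D < l / 2 * \<mu> ^ k" unfolding k_def by (rule LeastI_ex[OF ex])
  then obtain n where n: "k = Suc n" using assms(2) by (cases k) auto
  then have n1: "D < l / 2 * \<mu> ^ n" using not_less_Least[of n "\<lambda>n. \<not> D < l / 2 * \<mu> ^ n"] by (auto simp: k_def)
  have "1 / real N \<le> \<mu> powr s" using assms by (simp add: field_simps)
  then have "(1 / real N) ^ Suc n \<le> (\<mu> powr s) ^ Suc n" by (intro power_mono) auto
  also have "\<dots> = (\<mu> ^ Suc n) powr s"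
    using assms by (simp add: powr_realpow[symmetric] powr_powr powr_mult mult.commute powr_add)
  also have "\<dots> \<le> (2 / l * D) powr s"
    using k n l assms by (intro powr_mono2) (auto simp: field_simps)
  also have "\<dots> = (2 / l) powr s * D powr s" using l D by (subst powr_mult[symmetric]) auto
  finally show ?thesis using n1 by (intro exI[of _ n]) (auto intro: add_increasing2)
qed

lemma hausdorff_measure_cover:
  assumes "hausdorff_measure s A = 0" "0 < \<delta>" "0 < \<epsilon>"
  obtains U :: "nat \<Rightarrow> 'a::metric_space set" where "A \<subseteq> (\<Union>n. U n)" "\<And>n. bounded (U n)"
    "\<And>n. diameter (U n) \<le> \<delta>" "summable (\<lambda>n. diameter (U n) powr s)" "(\<Sum>n. diameter (U n) powr s) < \<epsilon>"
proof -
  let ?F = "{U :: nat \<Rightarrow> 'a set. A \<subseteq> (\<Union>n. U n) \<and> (\<forall>n. bounded (U n) \<and> diameter (U n) \<le> \<delta>)}"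
  have "(INF U \<in> ?F. \<Sum>n. ennreal (diameter (U n) powr s)) \<le> 0"
    unfolding assms(1)[symmetric] hausdorff_measure_def using assms(2) by (intro SUP_upper) auto
  also have "\<dots> < ennreal \<epsilon>" using assms(3) by simp
  finally obtain U where U: "U \<in> ?F" and lt: "(\<Sum>n. ennreal (diameter (U n) powr s)) < ennreal \<epsilon>"
    unfolding INF_less_iff by blast
  have sm: "summable (\<lambda>n. diameter (U n) powr s)"
    using lt by (intro summable_suminf_not_top) (auto simp: top_unique)
  have "(\<Sum>n. diameter (U n) powr s) < \<epsilon>"
    using lt assms(3) by (simp add: suminf_ennreal2[OF _ sm] ennreal_less_iff suminf_nonneg sm)
  then show ?thesis using that[of U] U sm by auto
qed

text \<open>A tree with \<open>N\<close> children per node, ratio \<open>\<mu>\<close> and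
  separation \<open>l * \<mu> ^ m\<close> at level \<open>m\<close> has a limit set of dimension at
  least \<open>s\<close> once \<open>N * \<mu> powr s\<close> reaches 1. Instead of a measure on the
  limit set, a cover of small total size is assumed and a branch avoiding all its members is
  followed.\<close>

lemma hausdorff_measure_nonzero:
  fixes p :: "'a::metric_space"
  assumes compl: "complete (UNIV :: 'a set)"
    and \<mu>: "0 < \<mu>" "\<mu> < 1" and L: "0 < L" and l: "4 * (L * \<mu> / (1 - \<mu>)) \<le> l"
    and s: "0 < s" "1 \<le> real N * \<mu> powr s"
    and ch: "\<And>y m. dist p y \<le> L / (1 - \<mu>) \<Longrightarrow>
      \<exists>f. (\<forall>i<N. dist y (f i) \<le> L * \<mu> ^ m) \<and> (\<forall>i<N. \<forall>j<N. i \<noteq> j \<longrightarrow> l * \<mu> ^ m \<le> dist (f i) (f j))"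
  shows "hausdorff_measure s (UNIV :: 'a set) \<noteq> 0"
proof
  assume H0: "hausdorff_measure s (UNIV :: 'a set) = 0"
  \<comment> \<open>The steps of length \<open>L * \<mu> ^ m\<close> from level \<open>m\<close> on
    add up to at most \<open>\<rho> * \<mu> ^ m\<close>, so a ball of this radius contains all
    descendants of a node.\<close>
  define \<rho> where "\<rho> = L / (1 - \<mu>)"
  have \<rho>: "0 < \<rho>" "4 * (\<rho> * \<mu>) \<le> l" "L + \<rho> * \<mu> = \<rho>" "L = \<rho> * (1 - \<mu>)"
    using \<mu> L l by (auto simp: \<rho>_def field_simps)
  have l0: "0 < l" using \<rho> \<mu> by (smt (verit) mult_pos_pos)
  have "\<mu> powr s < 1 powr s" using \<mu> s(1) by (intro powr_less_mono2) auto
  then have "N \<noteq> 0" "N \<noteq> 1" using s(2) by (auto intro: ccontr)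
  then have N: "2 \<le> N" by linarith
  define K where "K = (2 / l) powr s"
  have K: "0 < K" using l0 by (simp add: K_def)
  \<comment> \<open>Diameters at most \<open>l / 4\<close> make every set small at level 0, and the
    bound \<open>1 / (4 * K)\<close> makes the weights below sum to less than
    \<open>1 / 4 + 1 / 2\<close>.\<close>
  obtain U :: "nat \<Rightarrow> 'a set" where U: "UNIV \<subseteq> (\<Union>n. U n)" "\<And>n. bounded (U n)"
    "\<And>n. diameter (U n) \<le> l / 4" "summable (\<lambda>n. diameter (U n) powr s)" "(\<Sum>n. diameter (U n) powr s) < 1 / (4 * K)"
    using hausdorff_measure_cover[OF H0, of "l / 4" "1 / (4 * K)"] l0 K by auto
  have "diameter (U k) < l / 2" for k using U(3)[of k] l0 by linarith
  then have "\<forall>k. \<exists>n. diameter (U k) < l / 2 * \<mu> ^ n \<and>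
      (1 / real N) ^ Suc n \<le> K * diameter (U k) powr s + (1 / 2) ^ (k + 2)"
    unfolding K_def using U(2) \<mu> s N by (intro allI choose_scale) (auto intro: diameter_ge_0)
  then obtain n where n: "\<And>k. diameter (U k) < l / 2 * \<mu> ^ n k"
    "\<And>k. (1 / real N) ^ Suc (n k) \<le> K * diameter (U k) powr s + (1 / 2) ^ (k + 2)"
    by metis
  \<comment> \<open>The share of one branch at level \<open>Suc (n k)\<close>: a set that is small
    at level \<open>n k\<close> meets at most one of these.\<close>
  define a where "a k = (1 / real N) ^ Suc (n k)" for k
  have a0: "0 < a k" for k using N by (simp add: a_def)
  have sh: "summable (\<lambda>k. (1 / 2 :: real) ^ (k + 2))"
    by (intro summable_ignore_initial_segment summable_geometric) simp
  have sb: "summable (\<lambda>k. K * diameter (U k) powr s + (1 / 2) ^ (k + 2))"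
    by (intro summable_add summable_mult U(4) sh)
  have sa: "summable a"
    by (rule summable_comparison_test'[OF sb, of 0]) (use n(2) a0 in \<open>auto simp: a_def\<close>)
  have "a k \<le> K * diameter (U k) powr s + (1 / 2) ^ (k + 2)" for k
    unfolding a_def by (rule n(2))
  then have "suminf a \<le> (\<Sum>k. K * diameter (U k) powr s + (1 / 2) ^ (k + 2))"
    by (intro suminf_le sa sb)
  also have "\<dots> = K * (\<Sum>k. diameter (U k) powr s) + (\<Sum>k. (1 / 2) ^ (k + 2))"
    by (simp only: suminf_add[OF summable_mult[OF U(4)] sh, symmetric] suminf_mult[OF U(4)])
  also have "(\<Sum>k. (1 / 2 :: real) ^ (k + 2)) = 1 / 2"
    using suminf_geometric[of "1/2 :: real"] suminf_mult2[of "\<lambda>k. (1/2 :: real) ^ k" "1 / 4"]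
    by (simp add: power_add power2_eq_square)
  also have "K * (\<Sum>k. diameter (U k) powr s) < 1 / 4"
    using U(5) K by (simp add: field_simps)
  finally have suma: "suminf a < 1" by simp
  \<comment> \<open>Walk down the tree of separated points, always to the child where the scaled total weight
    \<open>real N ^ m * \<Psi> X\<close> of the covering sets still met is least; it stays below \<open>1\<close>, so the limit
    point lies in no covering set.\<close>
  define \<Psi> where "\<Psi> X = (\<Sum>k. if U k \<inter> X \<noteq> {} then a k else 0)" for X
  have s\<Psi>: "summable (\<lambda>k. if U k \<inter> X \<noteq> {} then a k else 0)" for X
    by (rule summable_comparison_test'[OF sa, of 0]) (use a0 in \<open>auto intro: less_imp_le\<close>)
  have le\<Psi>: "a k \<le> \<Psi> X" if "U k \<inter> X \<noteq> {}" for k X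
  proof -
    have "sum (\<lambda>k. if U k \<inter> X \<noteq> {} then a k else 0) {k} \<le> \<Psi> X"
      unfolding \<Psi>_def using a0 by (intro sum_le_suminf s\<Psi>) (auto intro: less_imp_le)
    then show ?thesis using that by simp
  qed
  define inv where "inv m y \<longleftrightarrow> dist p y \<le> \<rho> * (1 - \<mu> ^ m) \<and> real N ^ m * \<Psi> (cball y (\<rho> * \<mu> ^ m)) < 1" for m y
  \<comment> \<open>Beyond level \<open>n k\<close> the weight \<open>a k\<close> alone, scaled by
    \<open>real N ^ m\<close>, would already reach 1.\<close>
  have meets: "m \<le> n k" if "inv m y" "U k \<inter> cball y (\<rho> * \<mu> ^ m) \<noteq> {}" for m y k
  proof (rule ccontr)
    assume "\<not> m \<le> n k"
    then have "Suc (n k) \<le> m" by simp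
    then have "real N ^ Suc (n k) * a k \<le> real N ^ m * \<Psi> (cball y (\<rho> * \<mu> ^ m))"
      using N a0 by (intro mult_mono le\<Psi> that power_increasing) (auto intro: less_imp_le)
    also have "\<dots> < 1" using that by (simp add: inv_def)
    finally show False using N by (simp add: a_def power_one_over)
  qed
  have step: "\<exists>y'. inv (Suc m) y' \<and> dist y y' \<le> L * \<mu> ^ m" if iv: "inv m y" for m y
  proof -
    let ?X = "cball y (\<rho> * \<mu> ^ m)"
    have "dist p y \<le> \<rho> * (1 - \<mu> ^ m)" using iv by (simp add: inv_def)
    also have "\<dots> \<le> \<rho>" using \<rho> \<mu> by (intro mult_left_le) auto
    finally obtain f where f: "\<And>i. i < N \<Longrightarrow> dist y (f i) \<le> L * \<mu> ^ m"
      "\<And>i j. i < N \<Longrightarrow> j < N \<Longrightarrow> i \<noteq> j \<Longrightarrow> l * \<mu> ^ m \<le> dist (f i) (f j)"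
      using ch[of y m] unfolding \<rho>_def by blast
    define X where "X i = cball (f i) (\<rho> * \<mu> ^ Suc m)" for i
    have XX: "X i \<subseteq> ?X" if "i < N" for i
    proof
      fix z assume "z \<in> X i"
      then have "dist y z \<le> L * \<mu> ^ m + \<rho> * \<mu> ^ Suc m"
        using f(1)[OF that] dist_triangle[of y z "f i"] by (simp add: X_def)
      also have "\<dots> = (L + \<rho> * \<mu>) * \<mu> ^ m" by (simp add: algebra_simps)
      finally show "z \<in> ?X" unfolding \<rho>(3) by simp
    qed
    \<comment> \<open>The balls of two children have radius at most a quarter of the separation,
      which leaves a gap of half the separation, and \<open>U k\<close> is shorter than
      that.\<close>
    have uniq: "i = j" if ij: "i < N" "j < N" and u: "u \<in> U k" "u \<in> X i" and v: "v \<in> U k" "v \<in> X j" for i j k u v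
    proof (rule ccontr)
      assume "i \<noteq> j"
      have "m \<le> n k" using meets[OF iv, of k] XX[OF ij(1)] u by blast
      then have "l / 2 * \<mu> ^ n k \<le> l / 2 * \<mu> ^ m"
        using \<mu> l0 by (intro mult_left_mono power_decreasing) auto
      then have "dist u v < l / 2 * \<mu> ^ m"
        using diameter_bounded_bound[OF U(2) u(1) v(1)] n(1)[of k] by linarith
      moreover have "dist (f i) (f j) \<le> dist u v + 2 * (\<rho> * \<mu> ^ Suc m)"
      proof -
        have "dist (f i) u \<le> \<rho> * \<mu> ^ Suc m" "dist (f j) v \<le> \<rho> * \<mu> ^ Suc m"
          using u v by (auto simp: X_def)
        then show ?thesis
          using dist_triangle[of "f i" "f j" u] dist_triangle[of u "f j" v] by (simp add: dist_commute)
      qed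
      moreover have "4 * (\<rho> * \<mu> ^ Suc m) \<le> l * \<mu> ^ m"
        using mult_right_mono[OF \<rho>(2), of "\<mu> ^ m"] \<mu> by (simp add: algebra_simps)
      ultimately show False using f(2)[OF ij \<open>i \<noteq> j\<close>] by linarith
    qed
    have le: "(\<Sum>i<N. if U k \<inter> X i \<noteq> {} then a k else 0) \<le> (if U k \<inter> ?X \<noteq> {} then a k else 0)" for k
    proof (cases "\<exists>i<N. U k \<inter> X i \<noteq> {}")
      case True
      then obtain i where i: "i < N" "U k \<inter> X i \<noteq> {}" by blast
      have "(\<Sum>j<N. if U k \<inter> X j \<noteq> {} then a k else 0) = (\<Sum>j<N. if j = i then a k else 0)"
        by (intro sum.cong refl) (use i uniq in \<open>auto; blast\<close>)
      also have "\<dots> = a k" using i by simp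
      finally show ?thesis using i XX[OF i(1)] by auto
    qed (auto intro: less_imp_le a0)
    have "(\<Sum>i<N. \<Psi> (X i)) = (\<Sum>k. \<Sum>i<N. if U k \<inter> X i \<noteq> {} then a k else 0)"
      unfolding \<Psi>_def by (intro suminf_sum[symmetric] s\<Psi>)
    also have "\<dots> \<le> \<Psi> ?X"
      unfolding \<Psi>_def by (intro suminf_le le s\<Psi> summable_sum)
    finally have sum_le: "(\<Sum>i<N. \<Psi> (X i)) \<le> \<Psi> ?X" .
    \<comment> \<open>Every covering set counts for at most one child, so the least child is at or
      below the average.\<close>
    have "\<exists>i<N. real N * \<Psi> (X i) \<le> \<Psi> ?X"
    proof (rule ccontr)
      assume "\<not> ?thesis"
      then have "(\<Sum>i<N. \<Psi> ?X) < (\<Sum>i<N. real N * \<Psi> (X i))"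
        using N by (intro sum_strict_mono) (auto simp: not_le lessThan_empty_iff)
      then show False using sum_le N by (simp add: sum_distrib_left[symmetric])
    qed
    then obtain i where i: "i < N" "real N * \<Psi> (X i) \<le> \<Psi> ?X" by blast
    have "real N ^ Suc m * \<Psi> (X i) \<le> real N ^ m * \<Psi> ?X"
      using mult_left_mono[OF i(2), of "real N ^ m"] by (simp add: mult_ac)
    moreover have "dist p (f i) \<le> \<rho> * (1 - \<mu> ^ Suc m)"
      using iv f(1)[OF i(1)] dist_triangle[of p "f i" y] unfolding inv_def \<rho>(4) by (simp add: algebra_simps)
    ultimately show ?thesis
      using iv f(1)[OF i(1)] unfolding inv_def X_def by (intro exI[of _ "f i"]) auto
  qed
  have "inv 0 p"
  proof -
    have "\<Psi> (cball p (\<rho> * \<mu> ^ 0)) \<le> suminf a"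
      unfolding \<Psi>_def using a0 by (intro suminf_le s\<Psi> sa) (auto intro: less_imp_le)
    with suma show ?thesis by (simp add: inv_def)
  qed
  then obtain y where y: "\<And>m. inv m (y m)" "\<And>m. dist (y m) (y (Suc m)) \<le> L * \<mu> ^ m"
    using dependent_nat_choice[of inv "\<lambda>m y y'. dist y y' \<le> L * \<mu> ^ m"] step by metis
  have yd: "dist (y m) (y (m + j)) \<le> \<rho> * (\<mu> ^ m - \<mu> ^ (m + j))" for m j
  proof (induction j)
    case (Suc j)
    have "dist (y m) (y (m + Suc j)) \<le> dist (y m) (y (m + j)) + dist (y (m + j)) (y (Suc (m + j)))"
      by (simp add: dist_triangle)
    also have "\<dots> \<le> \<rho> * (\<mu> ^ m - \<mu> ^ (m + j)) + L * \<mu> ^ (m + j)"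
      by (intro add_mono Suc y)
    also have "\<dots> = \<rho> * (\<mu> ^ m - \<mu> ^ (m + Suc j))"
      unfolding \<rho>(4) by (simp add: algebra_simps)
    finally show ?case .
  qed simp
  have yc: "dist (y m) (y k) \<le> \<rho> * \<mu> ^ m" if "m \<le> k" for m k
  proof -
    have "\<rho> * (\<mu> ^ m - \<mu> ^ k) \<le> \<rho> * \<mu> ^ m" using \<rho> \<mu> by (intro mult_left_mono) auto
    then show ?thesis using yd[of m "k - m"] that by simp
  qed
  have "Cauchy y"
    unfolding Cauchy_altdef2
  proof (intro allI impI)
    fix e :: real assume "0 < e"
    then obtain m where "\<mu> ^ m < e / \<rho>" using real_arch_pow_inv[of "e / \<rho>" \<mu>] \<rho> \<mu> by auto
    then have "\<rho> * \<mu> ^ m < e" using \<rho> by (simp add: field_simps)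
    then show "\<exists>N. \<forall>n\<ge>N. dist (y n) (y N) < e"
      using yc by (metis dist_commute order.strict_trans1)
  qed
  then obtain z where z: "y \<longlonglongrightarrow> z"
    using compl unfolding complete_def by blast
  have zX: "z \<in> cball (y m) (\<rho> * \<mu> ^ m)" for m
    by (rule closed_sequentially[OF closed_cball _ LIMSEQ_ignore_initial_segment[OF z, of m]])
       (use yc in auto)
  \<comment> \<open>The limit point lies in the balls of all levels, so the set containing it would
    have to be small at all levels.\<close>
  obtain k where "z \<in> U k" using U(1) by blast
  then have "m \<le> n k" for m using meets[OF y(1)[of m], of k] zX[of m] by blast
  then show False using not_less_eq_eq by blast
qed

section \<open>Packing numbers of small balls\<close>

text \<open>The intermediate value theorem on an almost shortest curve gives the exact distance from
  \<open>x\<close>; the distance to \<open>a\<close> is only as good as the curve.\<close>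

lemma length_space_point:
  fixes x a :: "'a::metric_space"
  assumes "length_space TYPE('a)" "0 \<le> s" "s \<le> dist x a" "0 < e"
  obtains z where "dist x z = s" "dist z a \<le> dist x a - s + e"
proof -
  have "(INF g \<in> {g. path g \<and> pathstart g = x \<and> pathfinish g = a}. curve_length g) = ennreal (dist x a)"
    using assms(1) by (simp add: length_space_def)
  also have "\<dots> < ennreal (dist x a + e)"
    using assms(4) by (subst ennreal_less_iff) auto
  finally obtain g where g: "path g" "pathstart g = x" "pathfinish g = a"
    and len: "curve_length g < ennreal (dist x a + e)"
    unfolding INF_less_iff by blast
  have "continuous_on {0..1} (\<lambda>t. dist x (g t))"
    using g(1) by (auto simp: path_def intro!: continuous_intros)
  then obtain t where t: "0 \<le> t" "t \<le> 1" "dist x (g t) = s"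
    using IVT'[of "\<lambda>t. dist x (g t)" 0 s 1] g assms by (auto simp: pathstart_def pathfinish_def)
  have "(\<Sum>i < length [0, t, 1] - 1. ennreal (dist (g ([0, t, 1] ! i)) (g ([0, t, 1] ! Suc i)))) \<le> curve_length g"
    unfolding curve_length_def using t by (intro SUP_upper) auto
  then have "ennreal (dist (g 0) (g t)) + ennreal (dist (g t) (g 1)) \<le> curve_length g"
    by (simp add: lessThan_Suc add.commute)
  also note len
  finally have "ennreal (s + dist (g t) a) < ennreal (dist x a + e)"
    using g t assms(2) by (simp add: pathstart_def pathfinish_def ennreal_plus)
  then have "s + dist (g t) a < dist x a + e"
    using assms(2) by (subst (asm) ennreal_less_iff) auto
  then show ?thesis using that[of "g t"] t by auto
qed

lemma length_space_point_seq:
  fixes x a :: "'a::metric_space"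
  assumes "length_space TYPE('a)" "0 \<le> s" "s \<le> dist x a"
  obtains \<alpha> where "\<And>n. dist x (\<alpha> n) = s" "(\<lambda>n. dist (\<alpha> n) a) \<longlonglongrightarrow> dist x a - s"
proof -
  have "\<forall>n. \<exists>z. dist x z = s \<and> dist z a \<le> dist x a - s + 1 / real (Suc n)"
    using length_space_point[OF assms] by (metis of_nat_0_less_iff zero_less_Suc zero_less_divide_1_iff)
  then obtain \<alpha> where \<alpha>: "\<And>n. dist x (\<alpha> n) = s" "\<And>n. dist (\<alpha> n) a \<le> dist x a - s + 1 / real (Suc n)"
    by metis
  have "(\<lambda>n. dist (\<alpha> n) a) \<longlonglongrightarrow> dist x a - s"
  proof (rule tendsto_sandwich[OF _ _ tendsto_const])
    show "\<forall>\<^sub>F n in sequentially. dist x a - s \<le> dist (\<alpha> n) a"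
      using dist_triangle[of x a] \<alpha>(1) by (intro always_eventually allI) (smt (verit))
    show "\<forall>\<^sub>F n in sequentially. dist (\<alpha> n) a \<le> dist x a - s + 1 / real (Suc n)"
      using \<alpha>(2) by simp
    show "(\<lambda>n. dist x a - s + 1 / real (Suc n)) \<longlonglongrightarrow> dist x a - s"
      using tendsto_add[OF tendsto_const LIMSEQ_inverse_real_of_nat, of "dist x a - s"]
      by (simp add: inverse_eq_divide)
  qed
  with \<alpha>(1) show ?thesis using that by blast
qed

text \<open>A homothety towards \<open>y\<close> up to a factor 2. Each pair is contracted one end
  at a time, \<open>a i\<close> with \<open>a j\<close> fixed and then \<open>a j\<close> against
  the moved point \<open>\<alpha> i n\<close>, each time using half of the slack in
  \<open>dist_lower_bound_of_hcos\<close>. There are finitely many pairs, so one index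
  \<open>n\<close> suits them all.\<close>

lemma shrink_points:
  fixes y :: "'a::metric_space" and a :: "nat \<Rightarrow> 'a"
  assumes ls: "length_space TYPE('a)" and fp: "four_point c S" "0 < c"
    and S: "cball y D \<subseteq> S" "0 \<le> D" and m: "c * D \<le> m" "(cosh m)\<^sup>2 \<le> 2"
    and a: "\<And>i. i < N \<Longrightarrow> dist y (a i) \<le> D"
    and k: "0 < \<kappa>" "\<kappa> < 1"
  shows "\<exists>f. (\<forall>i<N. dist y (f i) = \<kappa> * dist y (a i)) \<and>
    (\<forall>i<N. \<forall>j<N. \<kappa> * dist (a i) (a j) \<le> 2 * dist (f i) (f j))"
proof -
  have "\<exists>\<alpha>. (\<forall>n. dist y (\<alpha> n) = \<kappa> * dist y (a i)) \<and> (\<lambda>n. dist (\<alpha> n) (a i)) \<longlonglongrightarrow> dist y (a i) - \<kappa> * dist y (a i)" for i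
    using length_space_point_seq[OF ls, of "\<kappa> * dist y (a i)" y "a i"] k
    by (metis mult_left_le_one_le mult_nonneg_nonneg less_imp_le zero_le_dist)
  then obtain \<alpha> where \<alpha>: "\<And>i n. dist y (\<alpha> i n) = \<kappa> * dist y (a i)"
    "\<And>i. (\<lambda>n. dist (\<alpha> i n) (a i)) \<longlonglongrightarrow> dist y (a i) - \<kappa> * dist y (a i)"
    by metis
  have yS: "y \<in> S" using S by auto
  have aS: "a i \<in> S" if "i < N" for i using S a[OF that] by auto
  have \<alpha>S: "\<alpha> i n \<in> S" if "i < N" for i n
  proof -
    have "\<kappa> * dist y (a i) \<le> D" using a[OF that] k
      by (meson less_imp_le mult_left_le_one_le order.trans zero_le_dist)
    then show ?thesis using S \<alpha>(1)[of i n] by auto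
  qed
  have pair: "\<forall>\<^sub>F n in sequentially. \<kappa> * dist (a i) (a j) \<le> 2 * dist (\<alpha> i n) (\<alpha> j n)"
    if ij: "i < N" "j < N" for i j
  proof -
    consider "a i = a j" | "a i = y" | "a j = y" | "a i \<noteq> y" "a j \<noteq> y" "a i \<noteq> a j" by blast
    then show ?thesis
    proof cases
      case 1 then show ?thesis by simp
    next
      case 2
      then have "\<alpha> i n = y" for n using \<alpha>(1)[of i n] by simp
      then show ?thesis using 2 \<alpha>(1)[of j] k by simp
    next
      case 3
      then have "\<alpha> j n = y" for n using \<alpha>(1)[of j n] by simp
      then show ?thesis using 3 \<alpha>(1)[of i] k by (simp add: dist_commute)
    next
      case 4
      define s t z where "s = dist y (a i)" "t = dist y (a j)" "z = dist (a i) (a j)"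
      have p: "0 < s" "0 < t" "0 < z" using 4 by (auto simp: s_t_z_def)
      have ks: "0 < \<kappa> * s" "\<kappa> * s < s" "0 < \<kappa> * t" "\<kappa> * t < t" using p k by auto
      define e where "e = z\<^sup>2 / (8 * s * t) / 2"
      have e: "0 < e" using p by (simp add: e_def)
      have "\<forall>\<^sub>F n in sequentially. hcos (c * (\<kappa> * s)) (c * t) (c * dist (\<alpha> i n) (a j))
           \<le> hcos (c * dist y (a i)) (c * t) (c * dist (a i) (a j)) + e"
        by (rule hcos_shrink[OF fp yS aS[OF ij(1)], where \<alpha> = "\<alpha> i" and y = "\<lambda>_. a j"])
           (use ks p e \<alpha> \<alpha>S aS ij in \<open>auto simp: s_t_z_def\<close>)
      moreover have "\<forall>\<^sub>F n in sequentially. hcos (c * (\<kappa> * t)) (c * (\<kappa> * s)) (c * dist (\<alpha> j n) (\<alpha> i n))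
           \<le> hcos (c * dist y (a j)) (c * (\<kappa> * s)) (c * dist (a j) (\<alpha> i n)) + e"
        by (rule hcos_shrink[OF fp yS aS[OF ij(2)], where \<alpha> = "\<alpha> j" and y = "\<alpha> i"])
           (use ks p e \<alpha> \<alpha>S aS ij in \<open>auto simp: s_t_z_def\<close>)
      ultimately show ?thesis
      proof eventually_elim
        case (elim n)
        let ?z' = "dist (\<alpha> i n) (\<alpha> j n)"
        have ts: "triangle_sides s t z" using tri_dist[of y "a i" "a j"] 4 by (auto simp: s_t_z_def)
        have "\<alpha> i n \<noteq> y" "\<alpha> j n \<noteq> y" using \<alpha>(1)[of i n] \<alpha>(1)[of j n] ks by (auto simp: s_t_z_def)
        then have ts': "triangle_sides (\<kappa> * s) (\<kappa> * t) ?z'"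
          using tri_dist[of y "\<alpha> i n" "\<alpha> j n"] \<alpha>(1) by (auto simp: s_t_z_def)
        have "hcos (c * (\<kappa> * s)) (c * (\<kappa> * t)) (c * ?z') \<le> hcos (c * s) (c * t) (c * z) + 2 * e"
          using elim by (simp add: s_t_z_def dist_commute hcos_commute)
        also have "2 * e = (c * z)\<^sup>2 / (8 * (c * s) * (c * t))"
          using fp by (simp add: e_def power_mult_distrib power2_eq_square)
        finally have h: "hcos (\<kappa> * (c * s)) (\<kappa> * (c * t)) (c * ?z') \<le> hcos (c * s) (c * t) (c * z) + (c * z)\<^sup>2 / (8 * (c * s) * (c * t))"
          by (simp add: mult.left_commute)
        have "c * s \<le> m" "c * t \<le> m"
          using a[OF ij(1)] a[OF ij(2)] m fp unfolding s_t_z_def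
          by (meson less_imp_le mult_left_mono order.trans)+
        then have "\<kappa> * (c * z) \<le> 2 * (c * ?z')"
          using tri_scale[OF fp(2) ts] tri_scale[OF fp(2) ts'] k m h
          by (intro dist_lower_bound_of_hcos[of "c * s" "c * t" "c * z" \<kappa> "c * ?z'" m]) (auto simp: mult.left_commute)
        then have "c * (\<kappa> * z) \<le> c * (2 * ?z')" by (simp add: mult.left_commute)
        then show ?case using fp by (simp add: s_t_z_def)
      qed
    qed
  qed
  have "\<forall>\<^sub>F n in sequentially. \<forall>i\<in>{..<N}. \<forall>j\<in>{..<N}. \<kappa> * dist (a i) (a j) \<le> 2 * dist (\<alpha> i n) (\<alpha> j n)"
    using pair by (intro eventually_ball_finite ballI) auto
  then obtain n where "\<forall>i\<in>{..<N}. \<forall>j\<in>{..<N}. \<kappa> * dist (a i) (a j) \<le> 2 * dist (\<alpha> i n) (\<alpha> j n)"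
    using eventually_happens'[OF sequentially_bot] by blast
  then show ?thesis using \<alpha>(1) by (intro exI[of _ "\<lambda>i. \<alpha> i n"]) auto
qed

text \<open>The bound \<open>N\<close> may depend on \<open>\<epsilon>\<close> but not on the scale
  \<open>\<rho>\<close>. A single scale would give total boundedness of a ball; the uniformity
  carries over to the directions at \<open>p\<close>, which are seen in the limit of small
  \<open>\<rho>\<close>.\<close>

definition packed :: "'a::metric_space \<Rightarrow> real \<Rightarrow> bool" where
  "packed p R \<longleftrightarrow> (\<forall>\<epsilon>>0. \<exists>N. \<forall>\<rho> A. 0 < \<rho> \<longrightarrow> \<rho> \<le> R \<longrightarrow> finite A \<longrightarrow> A \<subseteq> cball p \<rho> \<longrightarrow>
    (\<forall>a\<in>A. \<forall>b\<in>A. a \<noteq> b \<longrightarrow> \<epsilon> * \<rho> \<le> dist a b) \<longrightarrow> card A < N)"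

text \<open>\<open>N\<close> separated points of \<open>cball p \<rho>\<close> can be copied, shrunk
  by any power of \<open>\<mu>\<close>, around every point near \<open>p\<close>, which is the
  branching that \<open>hausdorff_measure_nonzero\<close> asks for. The ratio \<open>\<mu>\<close>
  is chosen from \<open>\<epsilon>\<close> alone, and \<open>N\<close> from \<open>\<mu>\<close> and
  \<open>s\<close>, so the bound does not see \<open>\<rho>\<close>.\<close>

lemma packing_bound:
  fixes p :: "'a::metric_space"
  assumes compl: "complete (UNIV :: 'a set)" and ls: "length_space TYPE('a)"
    and dim: "hausdorff_dim (UNIV :: 'a set) < \<infinity>"
    and fp: "four_point c (ball p r)" "0 < c" "0 < r"
  shows "\<exists>R>0. packed p R"
proof -
  obtain s where s: "0 < s" "hausdorff_measure s (UNIV :: 'a set) = 0"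
    using dim unfolding hausdorff_dim_def Inf_less_iff by auto
  have "((\<lambda>m::real. (cosh m)\<^sup>2) \<longlongrightarrow> (cosh 0)\<^sup>2) (at_right 0)"
    by (intro tendsto_intros)
  then have "\<forall>\<^sub>F m in at_right (0::real). (cosh m)\<^sup>2 < 2"
    by (rule order_tendstoD) simp
  then obtain m :: real where m: "0 < m" "(cosh m)\<^sup>2 \<le> 2"
    unfolding eventually_at_right_field by (metis dense less_imp_le)
  \<comment> \<open>Nodes of the tree stay within \<open>\<rho>\<close> of \<open>p\<close> and are
    at most \<open>2 * \<rho>\<close> from the points to be copied. So \<open>3 * R\<close> must fit
    into \<open>ball p r\<close>, and \<open>2 * R\<close> must be short enough for the hyperbolic
    estimates.\<close>
  define R where "R = min (r / 4) (m / (2 * c))"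
  have R: "0 < R" "3 * R < r" "c * (2 * R) \<le> m"
    using fp m by (auto simp: R_def min_def field_simps)
  have "packed p R"
    unfolding packed_def
  proof (intro allI impI)
    fix \<epsilon> :: real assume \<epsilon>: "0 < \<epsilon>"
    \<comment> \<open>Makes \<open>16 * \<mu> \<le> (1 - \<mu>) * \<epsilon>\<close>, which is
      \<open>4 * \<rho> * \<mu> \<le> l\<close> for the \<open>l\<close> below.\<close>
    define \<mu> where "\<mu> = min (1 / 2) (\<epsilon> / 32)"
    have \<mu>: "0 < \<mu>" "\<mu> < 1" "\<mu> \<le> 1 / 2" "\<mu> \<le> \<epsilon> / 32" using \<epsilon> by (auto simp: \<mu>_def)
    have \<mu>': "16 * \<mu> \<le> (1 - \<mu>) * \<epsilon>"
      using mult_right_mono[of "1 / 2" "1 - \<mu>" \<epsilon>] \<mu> \<epsilon> by linarith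
    obtain N :: nat where N: "1 / \<mu> powr s \<le> real N" using real_arch_simple by blast
    then have N1: "1 \<le> real N * \<mu> powr s" using \<mu> by (simp add: field_simps)
    have "card A < N"
      if h: "0 < \<rho>" "\<rho> \<le> R" "finite A" "A \<subseteq> cball p \<rho>" "\<forall>a\<in>A. \<forall>b\<in>A. a \<noteq> b \<longrightarrow> \<epsilon> * \<rho> \<le> dist a b" for \<rho> A
    proof (rule ccontr)
      assume "\<not> card A < N"
      then obtain B where B: "B \<subseteq> A" "card B = N" "finite B"
        by (metis not_less obtain_subset_with_card_n)
      obtain a where a: "bij_betw a {..<N} B"
        using B ex_bij_betw_nat_finite[OF B(3)] by (auto simp: atLeast0LessThan)
      have aA: "a i \<in> A" if "i < N" for i using a B that by (auto simp: bij_betw_def)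
      have sep: "\<epsilon> * \<rho> \<le> dist (a i) (a j)" if "i < N" "j < N" "i \<noteq> j" for i j
        using h(5) aA that bij_betw_imp_inj_on[OF a] by (metis inj_onD lessThan_iff)
      \<comment> \<open>\<open>L / (1 - \<mu>) = \<rho>\<close> keeps the tree in
        \<open>cball p \<rho>\<close>. Level \<open>n\<close> contracts by
        \<open>(1 - \<mu>) / 2 * \<mu> ^ n\<close>, which takes distances up to
        \<open>2 * \<rho>\<close> to at most \<open>L * \<mu> ^ n\<close>; the factor 2 lost by the
        homothety explains the 4 in \<open>l\<close>.\<close>
      define L where "L = \<rho> * (1 - \<mu>)"
      define l where "l = (1 - \<mu>) * \<epsilon> * \<rho> / 4"
      have L: "L / (1 - \<mu>) = \<rho>" using \<mu> by (simp add: L_def)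
      have "hausdorff_measure s (UNIV :: 'a set) \<noteq> 0"
      proof (rule hausdorff_measure_nonzero[OF compl \<mu>(1,2) _ _ s(1) N1])
        show "0 < L" using h \<mu> by (simp add: L_def)
        have "4 * (L * \<mu> / (1 - \<mu>)) = 4 * (\<rho> * \<mu>)" using \<mu> by (simp add: L_def)
        also have "\<dots> \<le> l" using mult_left_mono[OF \<mu>', of "\<rho> / 4"] h by (simp add: l_def mult_ac)
        finally show "4 * (L * \<mu> / (1 - \<mu>)) \<le> l" .
        fix y n assume y: "dist p y \<le> L / (1 - \<mu>)"
        define \<kappa> where "\<kappa> = (1 - \<mu>) / 2 * \<mu> ^ n"
        have "\<mu> ^ n \<le> 1" using \<mu> by (simp add: power_le_one)
        then have k: "0 < \<kappa>" "\<kappa> < 1" using \<mu> mult_mono[of "(1-\<mu>)/2" "1/2" "\<mu>^n" 1] by (auto simp: \<kappa>_def)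
        have D: "dist y (a i) \<le> 2 * \<rho>" if "i < N" for i
          using aA[OF that] h(4) y dist_triangle[of y "a i" p] unfolding L by (auto simp: dist_commute)
        have "cball y (2 * \<rho>) \<subseteq> ball p r"
        proof
          fix z assume "z \<in> cball y (2 * \<rho>)"
          then show "z \<in> ball p r"
            using y dist_triangle[of p z y] R h unfolding L by auto
        qed
        moreover have "c * (2 * \<rho>) \<le> m"
          using R(3) mult_left_mono[of "2 * \<rho>" "2 * R" c] h(2) fp(2) by linarith
        moreover have "0 \<le> 2 * \<rho>" using h by simp
        ultimately obtain f where f: "\<forall>i<N. dist y (f i) = \<kappa> * dist y (a i)"
          "\<forall>i<N. \<forall>j<N. \<kappa> * dist (a i) (a j) \<le> 2 * dist (f i) (f j)"
          using shrink_points[where N = N and a = a and y = y and D = "2 * \<rho>" and \<kappa> = \<kappa>, OF ls fp(1,2) _ _ _ m(2) D k] by blast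
        show "\<exists>f. (\<forall>i<N. dist y (f i) \<le> L * \<mu> ^ n) \<and> (\<forall>i<N. \<forall>j<N. i \<noteq> j \<longrightarrow> l * \<mu> ^ n \<le> dist (f i) (f j))"
        proof (intro exI[of _ f] conjI allI impI)
          fix i assume "i < N"
          then have "dist y (f i) \<le> \<kappa> * (2 * \<rho>)" using f(1) k mult_left_mono[OF D, of i \<kappa>] by simp
          then show "dist y (f i) \<le> L * \<mu> ^ n" by (simp add: \<kappa>_def L_def mult_ac)
        next
          fix i j assume ij: "i < N" "j < N" "i \<noteq> j"
          then have "\<kappa> * (\<epsilon> * \<rho>) \<le> 2 * dist (f i) (f j)"
            using f(2)[rule_format, OF ij(1,2)] mult_left_mono[OF sep[OF ij], of \<kappa>] k by linarith
          then show "l * \<mu> ^ n \<le> dist (f i) (f j)" by (simp add: \<kappa>_def l_def mult_ac)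
        qed
      qed
      with s(2) show False by simp
    qed
    then show "\<exists>N. \<forall>\<rho> A. 0 < \<rho> \<longrightarrow> \<rho> \<le> R \<longrightarrow> finite A \<longrightarrow> A \<subseteq> cball p \<rho> \<longrightarrow>
      (\<forall>a\<in>A. \<forall>b\<in>A. a \<noteq> b \<longrightarrow> \<epsilon> * \<rho> \<le> dist a b) \<longrightarrow> card A < N" by (intro exI[of _ N]) blast
  qed
  with R(1) show ?thesis by blast
qed

section \<open>Properness and minimal geodesics\<close>

text \<open>A separated set of greatest cardinality is a net. \<open>d\<close> is a bare function,
  so that both \<open>dist\<close> and \<open>geodesic_angle\<close> qualify.\<close>

lemma finite_net:
  fixes d :: "'b \<Rightarrow> 'b \<Rightarrow> real"
  assumes bound: "\<And>A. finite A \<Longrightarrow> A \<subseteq> S \<Longrightarrow> (\<forall>a\<in>A. \<forall>b\<in>A. a \<noteq> b \<longrightarrow> \<epsilon> \<le> d a b) \<Longrightarrow> card A < N"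
    and sym: "\<And>a b. a \<in> S \<Longrightarrow> b \<in> S \<Longrightarrow> d a b = d b a" and refl: "\<And>a. a \<in> S \<Longrightarrow> d a a < \<epsilon>"
  obtains K where "finite K" "K \<subseteq> S" "\<And>x. x \<in> S \<Longrightarrow> \<exists>k\<in>K. d k x < \<epsilon>"
proof -
  define P where "P A \<longleftrightarrow> finite A \<and> A \<subseteq> S \<and> (\<forall>a\<in>A. \<forall>b\<in>A. a \<noteq> b \<longrightarrow> \<epsilon> \<le> d a b)" for A
  have "P {}" "\<forall>A. P A \<longrightarrow> card A < N"
    using bound by (auto simp: P_def)
  from ex_has_greatest_nat[OF this] obtain K where K: "P K" "\<And>A. P A \<Longrightarrow> card A \<le> card K"
    by auto
  have "\<exists>k\<in>K. d k x < \<epsilon>" if x: "x \<in> S" for x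
  proof (rule ccontr)
    assume nK: "\<not> ?thesis"
    then have far: "\<epsilon> \<le> d k x" "\<epsilon> \<le> d x k" if "k \<in> K" for k
    proof -
      show *: "\<epsilon> \<le> d k x" using nK that by (auto simp: not_less)
      have "k \<in> S" using K(1) that by (auto simp: P_def)
      with * show "\<epsilon> \<le> d x k" using sym[of k x] x by simp
    qed
    then have "x \<notin> K" using refl[OF x] by (meson not_less)
    have "P (insert x K)"
      using K(1) x far by (simp add: P_def)
    then show False using K(2)[of "insert x K"] K(1) \<open>x \<notin> K\<close> by (simp add: P_def)
  qed
  then show ?thesis using that[of K] K(1) by (simp add: P_def)
qed

lemma locally_compact_of_packing:
  fixes p :: "'a::metric_space"
  assumes compl: "complete (UNIV :: 'a set)" and R: "0 < R" and pack: "packed p R"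
  shows "compact (cball p R)"
  unfolding compact_eq_totally_bounded
proof (intro conjI allI impI)
  show "complete (cball p R)"
    using complete_closed_subset[OF closed_cball _ compl] by auto
  fix e :: real assume e: "0 < e"
  obtain N where N: "\<And>\<rho> A. 0 < \<rho> \<Longrightarrow> \<rho> \<le> R \<Longrightarrow> finite A \<Longrightarrow> A \<subseteq> cball p \<rho> \<Longrightarrow>
      (\<forall>a\<in>A. \<forall>b\<in>A. a \<noteq> b \<longrightarrow> e / R * \<rho> \<le> dist a b) \<Longrightarrow> card A < N"
    using pack[unfolded packed_def, rule_format, OF divide_pos_pos[OF e R]] by blast
  obtain K where "finite K" "K \<subseteq> cball p R" "\<And>x. x \<in> cball p R \<Longrightarrow> \<exists>k\<in>K. dist k x < e"
  proof (rule finite_net[of "cball p R" e dist N])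
    fix A assume "finite A" "A \<subseteq> cball p R" "\<forall>a\<in>A. \<forall>b\<in>A. a \<noteq> b \<longrightarrow> e \<le> dist a b"
    then show "card A < N" using N[of R A] R by simp
  qed (use e in \<open>auto simp: dist_commute\<close>)
  then show "\<exists>k. finite k \<and> cball p R \<subseteq> (\<Union>x\<in>k. ball x e)"
    by (intro exI[of _ K]) fastforce
qed

text \<open>By the length property a point beyond the radius \<open>r\<close> is close to one at
  distance exactly \<open>r\<close>, so a net of the smaller, compact ball is a coarser net of the
  larger one.\<close>

lemma proper_cball_limit:
  fixes p :: "'a::metric_space"
  assumes compl: "complete (UNIV :: 'a set)" and ls: "length_space TYPE('a)"
    and R: "\<And>e. 0 < e \<Longrightarrow> \<exists>r. 0 \<le> r \<and> R - e < r \<and> compact (cball p r)"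
  shows "compact (cball p R)"
  unfolding compact_eq_totally_bounded
proof (intro conjI allI impI)
  show "complete (cball p R)"
    using complete_closed_subset[OF closed_cball _ compl] by auto
  fix e :: real assume e: "0 < e"
  then obtain r where r: "0 \<le> r" "R - e / 3 < r" "compact (cball p r)"
    using R[of "e / 3"] by auto
  then obtain K where K: "finite K" "cball p r \<subseteq> (\<Union>x\<in>K. ball x (e / 3))"
    using e unfolding compact_eq_totally_bounded by (metis divide_pos_pos zero_less_numeral)
  have "\<exists>k\<in>K. dist k x < e" if x: "x \<in> cball p R" for x
  proof -
    have "\<exists>z\<in>cball p r. dist z x \<le> 2 * (e / 3)"
    proof (cases "dist p x \<le> r")
      case True
      then show ?thesis using e by (intro bexI[of _ x]) auto
    next
      case False
      then obtain z where "dist p z = r" "dist z x \<le> dist p x - r + e / 3"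
        using length_space_point[OF ls, of r p x "e / 3"] r e by auto
      then show ?thesis using x r by (intro bexI[of _ z]) auto
    qed
    then obtain z where z: "z \<in> cball p r" "dist z x \<le> 2 * (e / 3)" by blast
    then obtain k where "k \<in> K" "dist k z < e / 3" using K(2) by auto
    then show ?thesis using z dist_triangle[of k x z] by (intro bexI[of _ k]) linarith+
  qed
  then show "\<exists>k. finite k \<and> cball p R \<subseteq> (\<Union>x\<in>k. ball x e)"
    using K(1) by (intro exI[of _ K]) fastforce
qed

lemma proper_cball_extend:
  fixes p :: "'a::metric_space"
  assumes ls: "length_space TYPE('a)" and lc: "\<And>x::'a. \<exists>r>0. compact (cball x r)"
    and R: "0 \<le> R" "compact (cball p R)"
  shows "\<exists>\<delta>>0. compact (cball p (R + \<delta>))"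
proof -
  obtain r where r: "\<And>x::'a. 0 < r x" "\<And>x::'a. compact (cball x (r x))"
    using lc by metis
  have "cball p R \<subseteq> (\<Union>x\<in>cball p R. ball x (r x / 2))"
    using r(1) by auto
  then obtain C where C: "C \<subseteq> cball p R" "finite C" "cball p R \<subseteq> (\<Union>x\<in>C. ball x (r x / 2))"
    by (rule compactE_image[OF R(2), rotated]) auto
  define \<delta> where "\<delta> = Min (insert 1 (r ` C)) / 4"
  have \<delta>: "0 < \<delta>" "\<And>x. x \<in> C \<Longrightarrow> \<delta> \<le> r x / 4"
    using C(2) r(1) by (auto simp: \<delta>_def)
  have "cball p (R + \<delta>) \<subseteq> (\<Union>x\<in>C. cball x (r x))"
  proof
    fix y assume y: "y \<in> cball p (R + \<delta>)"
    have "\<exists>z\<in>cball p R. dist z y \<le> 2 * \<delta>"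
    proof (cases "dist p y \<le> R")
      case True
      then show ?thesis using \<delta> by (intro bexI[of _ y]) auto
    next
      case False
      then obtain z where "dist p z = R" "dist z y \<le> dist p y - R + \<delta>"
        using length_space_point[OF ls, of R p y \<delta>] R \<delta> by auto
      then show ?thesis using y by (intro bexI[of _ z]) auto
    qed
    then obtain z where z: "z \<in> cball p R" "dist z y \<le> 2 * \<delta>" by blast
    then obtain x where x: "x \<in> C" "dist x z < r x / 2" using C(3) by auto
    then have "y \<in> cball x (r x)"
      using z \<delta>(2)[OF x(1)] dist_triangle[of x y z] by simp
    then show "y \<in> (\<Union>x\<in>C. cball x (r x))" using x by blast
  qed
  moreover have "compact (\<Union>x\<in>C. cball x (r x))"
    using C(2) r(2) by (intro compact_UN) auto
  ultimately have "compact (cball p (R + \<delta>))"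
    by (metis closed_cball compact_Int_closed inf.absorb_iff2)
  with \<delta> show ?thesis by blast
qed

text \<open>Hopf-Rinow-Cohn-Vossen: the radii of compact balls around \<open>p\<close> are closed
  under suprema by \<open>proper_cball_limit\<close>, and each can be exceeded by
  \<open>proper_cball_extend\<close>, so they are unbounded.\<close>

lemma hopf_rinow:
  fixes p :: "'a::metric_space"
  assumes compl: "complete (UNIV :: 'a set)" and ls: "length_space TYPE('a)"
    and lc: "\<And>x::'a. \<exists>r>0. compact (cball x r)"
  shows "compact (cball p R)"
proof (rule ccontr)
  assume R: "\<not> compact (cball p R)"
  define I where "I = {r. 0 \<le> r \<and> compact (cball p r)}"
  have mono: "compact (cball p r)" if "compact (cball p r')" "r \<le> r'" for r r'
    using that by (metis closed_cball compact_Int_closed inf.absorb_iff2 subset_cball)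
  have bdd: "bdd_above I"
  proof (rule bdd_aboveI[of _ R])
    fix r assume "r \<in> I"
    then show "r \<le> R" using R mono[of r R] by (cases "r \<le> R") (auto simp: I_def)
  qed
  have ne: "0 \<in> I" by (simp add: I_def)
  have S0: "0 \<le> Sup I" by (rule cSup_upper[OF ne bdd])
  have "compact (cball p (Sup I))"
  proof (rule proper_cball_limit[OF compl ls])
    fix e :: real assume "0 < e"
    then have "Sup I - e < Sup I" by simp
    then obtain r where "r \<in> I" "Sup I - e < r"
      using less_cSupE[of "Sup I - e" I] ne by auto
    then show "\<exists>r. 0 \<le> r \<and> Sup I - e < r \<and> compact (cball p r)" by (auto simp: I_def)
  qed
  then obtain \<delta> where "0 < \<delta>" "compact (cball p (Sup I + \<delta>))"
    using proper_cball_extend[OF ls lc S0] by blast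
  then have "Sup I + \<delta> \<in> I" using S0 by (simp add: I_def)
  then have "Sup I + \<delta> \<le> Sup I" by (rule cSup_upper[OF _ bdd])
  with \<open>0 < \<delta>\<close> show False by simp
qed

lemma between_point:
  fixes x y :: "'a::metric_space"
  assumes ls: "length_space TYPE('a)" and proper: "\<And>R. compact (cball x R)"
    and s: "0 \<le> s" "s \<le> dist x y"
  obtains z where "dist x z = s" "dist z y = dist x y - s"
proof -
  obtain \<alpha> where \<alpha>: "\<And>n. dist x (\<alpha> n) = s" "(\<lambda>n. dist (\<alpha> n) y) \<longlonglongrightarrow> dist x y - s"
    using length_space_point_seq[OF ls s] by blast
  have "seq_compact (cball x s)" using proper by (rule compact_imp_seq_compact)
  then obtain z r where z: "strict_mono (r :: nat \<Rightarrow> nat)" "(\<alpha> \<circ> r) \<longlonglongrightarrow> z"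
    using \<alpha>(1) unfolding seq_compact_def by (metis mem_cball order_refl)
  have "(\<lambda>n. dist x ((\<alpha> \<circ> r) n)) \<longlonglongrightarrow> dist x z" by (intro tendsto_intros z)
  then have 1: "dist x z = s" using \<alpha>(1) by (simp add: LIMSEQ_const_iff)
  have "(\<lambda>n. dist ((\<alpha> \<circ> r) n) y) \<longlonglongrightarrow> dist z y" by (intro tendsto_intros z)
  moreover have "(\<lambda>n. dist ((\<alpha> \<circ> r) n) y) \<longlonglongrightarrow> dist x y - s"
    using LIMSEQ_subseq_LIMSEQ[OF \<alpha>(2) z(1)] by (simp add: o_def)
  ultimately have "dist z y = dist x y - s" by (rule LIMSEQ_unique)
  with 1 show ?thesis by (rule that)
qed

text \<open>Zorn's lemma is applied to graphs of partial isometric maps on \<open>{0..D}\<close>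
  with both ends prescribed. A maximal one is total, because compactness of balls lets a missing
  parameter be added; this avoids a limit over dyadic parameters.\<close>

lemma min_geodesic_exists:
  fixes p q :: "'a::metric_space"
  assumes ls: "length_space TYPE('a)" and proper: "\<And>x R. compact (cball (x::'a) R)"
  shows "\<exists>\<gamma>. min_geodesic \<gamma> p q"
proof -
  define D where "D = dist p q"
  define P where "P G \<longleftrightarrow> fst ` G \<subseteq> {0..D} \<and> (0, p) \<in> G \<and> (D, q) \<in> G \<and>
      (\<forall>u\<in>G. \<forall>v\<in>G. dist (snd u) (snd v) = \<bar>fst u - fst v\<bar>)" for G :: "(real \<times> 'a) set"
  have "P {(0, p), (D, q)}" by (auto simp: P_def D_def dist_commute)
  moreover have "P (\<Union>C)" if "C \<noteq> {}" "subset.chain {G. P G} C" for C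
  proof -
    have C: "\<And>G. G \<in> C \<Longrightarrow> P G" "\<And>G H. G \<in> C \<Longrightarrow> H \<in> C \<Longrightarrow> G \<subseteq> H \<or> H \<subseteq> G"
      using that(2) by (auto simp: subset.chain_def)
    have "dist (snd u) (snd v) = \<bar>fst u - fst v\<bar>" if uv: "u \<in> \<Union>C" "v \<in> \<Union>C" for u v
    proof -
      obtain G H where "G \<in> C" "u \<in> G" "H \<in> C" "v \<in> H" using uv by blast
      then obtain K where "K \<in> C" "u \<in> K" "v \<in> K" using C(2)[of G H] by blast
      then show ?thesis using C(1) by (auto simp: P_def)
    qed
    moreover have "fst ` \<Union>C \<subseteq> {0..D}" using C(1) unfolding P_def by blast
    moreover have "(0, p) \<in> \<Union>C" "(D, q) \<in> \<Union>C" using that(1) C(1) unfolding P_def by blast+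
    ultimately show ?thesis by (simp add: P_def)
  qed
  ultimately obtain G where G: "P G" "\<And>H. P H \<Longrightarrow> G \<subseteq> H \<Longrightarrow> H = G"
    using subset_Zorn_nonempty[of "{G. P G}"] by auto
  have iso: "dist x y = \<bar>s - t\<bar>" if "(s, x) \<in> G" "(t, y) \<in> G" for s t x y
    using G(1) that unfolding P_def by fastforce
  have rng: "0 \<le> s" "s \<le> D" if "(s, x) \<in> G" for s x
    using G(1) that unfolding P_def by fastforce+
  have pG: "(0, p) \<in> G" "(D, q) \<in> G" using G(1) by (auto simp: P_def)
  have "\<exists>x. (s, x) \<in> G" if s: "0 \<le> s" "s \<le> D" for s
  proof -
    have "cball p D \<inter> (\<Inter>u\<in>G. cball (snd u) \<bar>s - fst u\<bar>) \<noteq> {}"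
    proof (rule compact_imp_fip_image[OF proper])
      fix G' assume G': "finite G'" "G' \<subseteq> G"
      \<comment> \<open>Of finitely many prescribed points only the neighbours of the parameter
        \<open>s\<close> on either side matter: a point between \<open>snd a\<close> and
        \<open>snd b\<close> meets the other constraints by the triangle inequality.\<close>
      define A where "A = {u \<in> insert (0, p) G'. fst u \<le> s}"
      define B where "B = {u \<in> insert (D, q) G'. s \<le> fst u}"
      have fin: "finite A" "finite B" "A \<noteq> {}" "B \<noteq> {}" using G'(1) s by (auto simp: A_def B_def)
      obtain a where a: "a \<in> A" "\<And>u. u \<in> A \<Longrightarrow> fst u \<le> fst a"
        using obtains_MAX[OF fin(1,3), of fst] fin by (metis Max_ge finite_imageI imageI)
      obtain b where b: "b \<in> B" "\<And>u. u \<in> B \<Longrightarrow> fst b \<le> fst u"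
        using obtains_MIN[OF fin(2,4), of fst] fin by (metis Min_le finite_imageI imageI)
      have abG: "A \<subseteq> G" "B \<subseteq> G" using G' pG by (auto simp: A_def B_def)
      have ab: "a \<in> G" "b \<in> G" using a(1) b(1) abG by auto
      have s_ab: "fst a \<le> s" "s \<le> fst b" using a(1) b(1) by (auto simp: A_def B_def)
      then have "dist (snd a) (snd b) = fst b - fst a"
        using iso[of "fst a" "snd a" "fst b" "snd b"] ab by simp
      then obtain z where z: "dist (snd a) z = s - fst a" "dist z (snd b) = fst b - s"
        using between_point[OF ls proper, of "s - fst a" "snd a" "snd b"] s_ab by auto
      have "dist (snd u) z \<le> \<bar>s - fst u\<bar>" if u: "u \<in> insert (0, p) G'" for u
      proof (cases "fst u \<le> s")
        case True
        then have "u \<in> A" using u by (simp add: A_def)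
        then have "dist (snd u) (snd a) = fst a - fst u"
          using iso[of "fst u" "snd u" "fst a" "snd a"] a(2)[of u] ab abG by auto
        then show ?thesis using z(1) dist_triangle[of "snd u" z "snd a"] by linarith
      next
        case False
        then have "u \<in> B" using u s by (auto simp: B_def)
        then have "dist (snd u) (snd b) = fst u - fst b"
          using iso[of "fst u" "snd u" "fst b" "snd b"] b(2)[of u] ab abG by auto
        then show ?thesis using z(2) dist_triangle[of "snd u" z "snd b"] False by (simp add: dist_commute)
      qed
      then have "z \<in> (\<Inter>u\<in>G'. cball (snd u) \<bar>s - fst u\<bar>)" "dist p z \<le> s"
        using s by fastforce+
      moreover have "z \<in> cball p D" using calculation(2) s by simp
      ultimately show "cball p D \<inter> (\<Inter>u\<in>G'. cball (snd u) \<bar>s - fst u\<bar>) \<noteq> {}"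
        by blast
    qed auto
    then obtain x where "\<forall>u\<in>G. dist (snd u) x \<le> \<bar>s - fst u\<bar>" by auto
    then have x: "\<And>t y. (t, y) \<in> G \<Longrightarrow> dist y x \<le> \<bar>s - t\<bar>" by fastforce
    \<comment> \<open>The upper bounds at \<open>p\<close> and \<open>q\<close> add up to
      \<open>D = dist p q\<close>, so they are sharp, and this forces the lower bound at every other
      point of the graph.\<close>
    have eq: "dist y x = \<bar>s - t\<bar>" if ty: "(t, y) \<in> G" for t y
    proof (rule antisym[OF x[OF ty]])
      have "dist y q = D - t" "dist p y = t" using iso[OF ty pG(2)] iso[OF pG(1) ty] rng[OF ty] by auto
      moreover have "dist x q \<le> D - s" "dist p x \<le> s" using x[OF pG(2)] x[OF pG(1)] s by (auto simp: dist_commute)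
      ultimately show "\<bar>s - t\<bar> \<le> dist y x"
        using dist_triangle[of y q x] dist_triangle[of p y x] by (auto simp: dist_commute)
    qed
    have "P (insert (s, x) G)"
      using G(1) eq s unfolding P_def by (auto simp: dist_commute abs_minus_commute)
    then have "insert (s, x) G = G" by (rule G(2)) auto
    then show ?thesis by auto
  qed
  then obtain \<gamma> where \<gamma>: "\<And>s. 0 \<le> s \<Longrightarrow> s \<le> D \<Longrightarrow> (s, \<gamma> s) \<in> G" by metis
  have "0 \<le> D" by (simp add: D_def)
  then have "dist (\<gamma> 0) p = 0" "dist (\<gamma> D) q = 0"
    using iso[OF \<gamma> pG(1)] iso[OF \<gamma> pG(2)] by auto
  then have "min_geodesic \<gamma> p q"
    unfolding min_geodesic_def D_def[symmetric] using iso[OF \<gamma> \<gamma>] by auto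
  then show ?thesis by blast
qed

section \<open>Angles and hinges\<close>

text \<open>Unlike \<open>min_geodesic\<close> it names a length instead of an endpoint, so that
  geodesics can be shortened freely.\<close>

definition is_geo :: "(real \<Rightarrow> 'a::metric_space) \<Rightarrow> 'a \<Rightarrow> real \<Rightarrow> bool" where
  "is_geo \<gamma> p l \<longleftrightarrow> 0 < l \<and> \<gamma> 0 = p \<and> (\<forall>s\<in>{0..l}. \<forall>t\<in>{0..l}. dist (\<gamma> s) (\<gamma> t) = \<bar>s - t\<bar>)"

lemma is_geo_mono: "is_geo \<gamma> p l \<Longrightarrow> 0 < l' \<Longrightarrow> l' \<le> l \<Longrightarrow> is_geo \<gamma> p l'"
  by (auto simp: is_geo_def)

lemma is_geo_of_min_geodesic: "min_geodesic \<gamma> p q \<Longrightarrow> p \<noteq> q \<Longrightarrow> is_geo \<gamma> p (dist p q)"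
  by (auto simp: is_geo_def min_geodesic_def)

lemma geodesics_from_iff: "\<gamma> \<in> geodesics_from p \<longleftrightarrow> (\<exists>l. is_geo \<gamma> p l)"
proof
  assume "\<gamma> \<in> geodesics_from p"
  then show "\<exists>l. is_geo \<gamma> p l"
    using is_geo_of_min_geodesic unfolding geodesics_from_def by fastforce
next
  assume "\<exists>l. is_geo \<gamma> p l"
  then obtain l where l: "is_geo \<gamma> p l" ..
  then have "dist p (\<gamma> l) = l" unfolding is_geo_def by fastforce
  with l have "min_geodesic \<gamma> p (\<gamma> l)" "\<gamma> l \<noteq> p" by (auto simp: is_geo_def min_geodesic_def)
  then show "\<gamma> \<in> geodesics_from p" by (auto simp: geodesics_from_def)
qed

lemma is_geo_dist:
  assumes "is_geo \<gamma> p l" "0 \<le> s" "s \<le> l"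
  shows "dist p (\<gamma> s) = s" "dist (\<gamma> s) p = s"
proof -
  have "dist (\<gamma> 0) (\<gamma> s) = \<bar>0 - s\<bar>" using assms unfolding is_geo_def by (metis atLeastAtMost_iff order.trans order_refl)
  then show "dist p (\<gamma> s) = s" using assms by (auto simp: is_geo_def)
  then show "dist (\<gamma> s) p = s" by (simp add: dist_commute)
qed

lemma is_geo_dist2:
  assumes "is_geo \<gamma> p l" "0 \<le> s" "s \<le> l" "0 \<le> t" "t \<le> l"
  shows "dist (\<gamma> s) (\<gamma> t) = \<bar>s - t\<bar>"
  using assms by (auto simp: is_geo_def)

abbreviation corner :: "(real \<times> real) filter" where
  "corner \<equiv> at_right 0 \<times>\<^sub>F at_right 0"

lemma eventually_corner:
  assumes "0 < l" "0 < m"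
  shows "\<forall>\<^sub>F x in corner. 0 < fst x \<and> fst x \<le> l \<and> 0 < snd x \<and> snd x \<le> m"
proof -
  have "\<forall>\<^sub>F x in at_right (0::real). 0 < x \<and> x \<le> b" if "0 < b" for b
    using that unfolding eventually_at_right_field by (intro exI[of _ b]) auto
  from this[OF assms(1)] this[OF assms(2)] show ?thesis
    unfolding eventually_prod_filter by fastforce
qed

lemma corner_fst: "(fst \<longlongrightarrow> 0) corner" and corner_snd: "(snd \<longlongrightarrow> 0) corner"
  by (auto intro!: filterlim_mono[OF filterlim_fst _ order_refl] filterlim_mono[OF filterlim_snd _ order_refl]
      simp: at_within_def)

definition hinge_hcos :: "real \<Rightarrow> (real \<Rightarrow> 'a::metric_space) \<Rightarrow> (real \<Rightarrow> 'a) \<Rightarrow> real \<Rightarrow> real \<Rightarrow> real" where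
  "hinge_hcos c \<gamma> \<sigma> s t = hcos (c * s) (c * t) (c * dist (\<gamma> s) (\<sigma> t))"

definition hinge_ecos :: "(real \<Rightarrow> 'a::metric_space) \<Rightarrow> (real \<Rightarrow> 'a) \<Rightarrow> real \<Rightarrow> real \<Rightarrow> real" where
  "hinge_ecos \<gamma> \<sigma> s t = ecos s t (dist (\<gamma> s) (\<sigma> t))"

lemma tri_geo:
  assumes "is_geo \<gamma> p l" "is_geo \<sigma> p m" "0 < s" "s \<le> l" "0 < t" "t \<le> m"
  shows "triangle_sides s t (dist (\<gamma> s) (\<sigma> t))"
proof -
  have d: "dist p (\<gamma> s) = s" "dist p (\<sigma> t) = t" using is_geo_dist(1)[OF assms(1), of s] is_geo_dist(1)[OF assms(2), of t] assms by auto
  then have "p \<noteq> \<gamma> s" "p \<noteq> \<sigma> t" using assms by auto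
  from tri_dist[OF this] show ?thesis by (simp add: d)
qed

lemma hc_mono:
  assumes "four_point c S" "0 < c" and g: "is_geo \<gamma> p l" "is_geo \<sigma> p m"
    and S: "\<gamma> ` {0..l} \<subseteq> S" "\<sigma> ` {0..m} \<subseteq> S"
    and st: "0 < s" "s \<le> s'" "s' \<le> l" "0 < t" "t \<le> t'" "t' \<le> m"
  shows "hinge_hcos c \<gamma> \<sigma> s t \<le> hinge_hcos c \<gamma> \<sigma> s' t'"
proof -
  have p: "p \<in> S" using S(1) g(1) by (force simp: is_geo_def)
  have in_S: "\<gamma> s \<in> S" "\<gamma> s' \<in> S" "\<sigma> t \<in> S" "\<sigma> t' \<in> S" using S st by auto
  have d: "dist p (\<gamma> s) = s" "dist p (\<gamma> s') = s'" "dist p (\<sigma> t) = t" "dist p (\<sigma> t') = t'"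
    using is_geo_dist[OF g(1)] is_geo_dist[OF g(2)] st by auto
  have d2: "dist (\<gamma> s) (\<gamma> s') = s' - s" "dist (\<sigma> t) (\<sigma> t') = t' - t"
    using is_geo_dist2[OF g(1)] is_geo_dist2[OF g(2)] st by auto
  have ne: "p \<noteq> \<gamma> s" "p \<noteq> \<gamma> s'" "p \<noteq> \<sigma> t" using d st by auto
  have "hinge_hcos c \<gamma> \<sigma> s t \<le> hinge_hcos c \<gamma> \<sigma> s' t"
    using hcos_mono[OF assms(1,2) p in_S(1,2,3)] ne d d2 by (simp add: hinge_hcos_def)
  also have "\<dots> \<le> hinge_hcos c \<gamma> \<sigma> s' t'"
    using hcos_mono[OF assms(1,2) p in_S(3,4,2)] ne d d2 by (simp add: hinge_hcos_def hcos_commute dist_commute)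
  finally show ?thesis .
qed

lemma hc_ec:
  assumes "0 < c" and g: "is_geo \<gamma> p l" "is_geo \<sigma> p m"
    and st: "0 < s" "s \<le> l" "0 < t" "t \<le> m" "s \<le> r" "t \<le> r"
  shows "hinge_ecos \<gamma> \<sigma> s t \<le> hinge_hcos c \<gamma> \<sigma> s t" "hinge_hcos c \<gamma> \<sigma> s t \<le> hinge_ecos \<gamma> \<sigma> s t + 2 * ((cosh (c * r))\<^sup>2 - 1)"
    "-1 \<le> hinge_ecos \<gamma> \<sigma> s t" "hinge_ecos \<gamma> \<sigma> s t \<le> 1" "-1 \<le> hinge_hcos c \<gamma> \<sigma> s t" "hinge_hcos c \<gamma> \<sigma> s t \<le> 1"
proof -
  have t: "triangle_sides s t (dist (\<gamma> s) (\<sigma> t))" using tri_geo[OF g] st by auto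
  note t' = tri_scale[OF assms(1) t]
  have "c * s \<le> c * r" "c * t \<le> c * r" using st assms(1) by auto
  from hcos_ecos_close[OF t' this] ecos_le_hcos[OF t'] hcos_bounds[OF t'] ecos_bounds[OF t]
  show "hinge_ecos \<gamma> \<sigma> s t \<le> hinge_hcos c \<gamma> \<sigma> s t" "hinge_hcos c \<gamma> \<sigma> s t \<le> hinge_ecos \<gamma> \<sigma> s t + 2 * ((cosh (c * r))\<^sup>2 - 1)"
    "-1 \<le> hinge_ecos \<gamma> \<sigma> s t" "hinge_ecos \<gamma> \<sigma> s t \<le> 1" "-1 \<le> hinge_hcos c \<gamma> \<sigma> s t" "hinge_hcos c \<gamma> \<sigma> s t \<le> 1"
    by (auto simp: hinge_hcos_def hinge_ecos_def ecos_scale[OF assms(1)])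
qed

text \<open>Hyperbolic hinge cosines are monotone in both sides, so in the corner they converge to
  their infimum; the Euclidean ones in the definition of the angle follow, since the gap between the
  two vanishes. The last clause is what the infimum adds: hinge comparison at every scale.\<close>

lemma angle_exists:
  assumes fp: "four_point c S" "0 < c" and g: "is_geo \<gamma> p l" "is_geo \<sigma> p m"
    and S: "\<gamma> ` {0..l} \<subseteq> S" "\<sigma> ` {0..m} \<subseteq> S"
  shows "0 \<le> geodesic_angle \<gamma> \<sigma>" "geodesic_angle \<gamma> \<sigma> \<le> pi"
    "((\<lambda>x. hinge_ecos \<gamma> \<sigma> (fst x) (snd x)) \<longlongrightarrow> cos (geodesic_angle \<gamma> \<sigma>)) corner"
    "\<And>s t. 0 < s \<Longrightarrow> s \<le> l \<Longrightarrow> 0 < t \<Longrightarrow> t \<le> m \<Longrightarrow> cos (geodesic_angle \<gamma> \<sigma>) \<le> hinge_hcos c \<gamma> \<sigma> s t"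
proof -
  have lm: "0 < l" "0 < m" using g by (auto simp: is_geo_def)
  note bnd = hc_ec[OF fp(2) g]
  define B where "B = {(s, t). 0 < s \<and> s \<le> l \<and> 0 < t \<and> t \<le> m}"
  define h where "h x = hinge_hcos c \<gamma> \<sigma> (fst x) (snd x)" for x
  define L where "L = Inf (h ` B)"
  have hb: "-1 \<le> h x" "h x \<le> 1" if "x \<in> B" for x
    using bnd[of "fst x" "snd x" "max (fst x) (snd x)"] that by (auto simp: B_def h_def)
  have lB: "(l, m) \<in> B" using lm by (simp add: B_def)
  have bdd: "bdd_below (h ` B)" using hb by (intro bdd_belowI[of _ "-1"]) auto
  have Lle: "L \<le> h x" if "x \<in> B" for x
    unfolding L_def using bdd that by (intro cInf_lower) auto
  have L1: "-1 \<le> L" "L \<le> 1"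
  proof -
    show "-1 \<le> L" unfolding L_def using hb lB by (intro cInf_greatest) auto
    show "L \<le> 1" using Lle[OF lB] hb[OF lB] by simp
  qed
  have evB: "\<forall>\<^sub>F x in corner. x \<in> B"
    using eventually_corner[OF lm] by (rule eventually_mono) (auto simp: B_def)
  have hL: "(h \<longlongrightarrow> L) corner"
  proof (rule order_tendstoI)
    fix a assume "a < L"
    show "\<forall>\<^sub>F x in corner. a < h x"
      using evB by (rule eventually_mono) (use Lle \<open>a < L\<close> in force)
  next
    fix a assume "L < a"
    then have "\<exists>x\<in>B. h x < a"
      using cInf_lessD[of "h ` B" a] lB unfolding L_def by blast
    then obtain y where y: "y \<in> B" "h y < a" by blast
    then have "\<forall>\<^sub>F x in corner. 0 < fst x \<and> fst x \<le> fst y \<and> 0 < snd x \<and> snd x \<le> snd y"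
      by (intro eventually_corner) (auto simp: B_def)
    then show "\<forall>\<^sub>F x in corner. h x < a"
    proof (rule eventually_mono)
      fix x assume x: "0 < fst x \<and> fst x \<le> fst y \<and> 0 < snd x \<and> snd x \<le> snd y"
      have "h x \<le> h y"
        unfolding h_def using x y(1) by (intro hc_mono[OF fp g S]) (auto simp: B_def)
      with y(2) show "h x < a" by simp
    qed
  qed
  define e where "e x = hinge_ecos \<gamma> \<sigma> (fst x) (snd x)" for x
  have ml: "((\<lambda>x. h x - 2 * ((cosh (c * max (fst x) (snd x)))\<^sup>2 - 1)) \<longlongrightarrow> L - 2 * ((cosh (c * max 0 0))\<^sup>2 - 1)) corner"
    by (intro tendsto_intros hL corner_fst corner_snd)
  have "(e \<longlongrightarrow> L) corner"
  proof (rule tendsto_sandwich[OF _ _ _ hL])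
    show "\<forall>\<^sub>F x in corner. h x - 2 * ((cosh (c * max (fst x) (snd x)))\<^sup>2 - 1) \<le> e x"
      using evB
    proof (rule eventually_mono)
      fix x assume "x \<in> B"
      then show "h x - 2 * ((cosh (c * max (fst x) (snd x)))\<^sup>2 - 1) \<le> e x"
        using bnd(2)[of "fst x" "snd x" "max (fst x) (snd x)"] by (auto simp: B_def h_def e_def)
    qed
    show "\<forall>\<^sub>F x in corner. e x \<le> h x"
      using evB
    proof (rule eventually_mono)
      fix x assume "x \<in> B"
      then show "e x \<le> h x"
        using bnd(1)[of "fst x" "snd x" "max (fst x) (snd x)"] by (auto simp: B_def h_def e_def)
    qed
    show "((\<lambda>x. h x - 2 * ((cosh (c * max (fst x) (snd x)))\<^sup>2 - 1)) \<longlongrightarrow> L) corner"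
      using ml by simp
  qed
  note eL = this
  have eb: "\<forall>\<^sub>F x in corner. e x \<in> {-1..1}"
    using evB
  proof (rule eventually_mono)
    fix x assume "x \<in> B"
    then show "e x \<in> {-1..1}"
      using bnd(3,4)[of "fst x" "snd x" "max (fst x) (snd x)"] by (auto simp: B_def e_def)
  qed
  have "((\<lambda>x. arccos (e x)) \<longlongrightarrow> arccos L) corner"
    using L1 by (intro continuous_on_tendsto_compose[OF continuous_on_arccos' eL _ eb]) auto
  moreover have "\<forall>\<^sub>F x in corner. arccos (e x) = (case x of (s, t) \<Rightarrow> comparison_angle 0 (\<gamma> 0) (\<gamma> s) (\<sigma> t))"
    using evB
  proof (rule eventually_mono)
    fix x assume "x \<in> B"
    moreover have "\<gamma> 0 = p" using g by (auto simp: is_geo_def)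
    ultimately show "arccos (e x) = (case x of (s, t) \<Rightarrow> comparison_angle 0 (\<gamma> 0) (\<gamma> s) (\<sigma> t))"
      using is_geo_dist(1)[OF g(1)] is_geo_dist(1)[OF g(2)]
      by (auto simp: B_def e_def hinge_ecos_def comparison_angle_0 split: prod.splits)
  qed
  ultimately have "((\<lambda>(s, t). comparison_angle 0 (\<gamma> 0) (\<gamma> s) (\<sigma> t)) \<longlongrightarrow> arccos L) corner"
    by (rule Lim_transform_eventually)
  moreover have "corner \<noteq> bot" by (simp add: prod_filter_eq_bot)
  ultimately have a: "geodesic_angle \<gamma> \<sigma> = arccos L"
    unfolding geodesic_angle_def by (intro tendsto_Lim)
  then have ca: "cos (geodesic_angle \<gamma> \<sigma>) = L" using L1 by simp
  show "0 \<le> geodesic_angle \<gamma> \<sigma>" "geodesic_angle \<gamma> \<sigma> \<le> pi"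
    unfolding a using L1 by (auto simp: arccos_lbound arccos_ubound)
  show "((\<lambda>x. hinge_ecos \<gamma> \<sigma> (fst x) (snd x)) \<longlongrightarrow> cos (geodesic_angle \<gamma> \<sigma>)) corner"
    using eL unfolding ca e_def[abs_def] .
  show "cos (geodesic_angle \<gamma> \<sigma>) \<le> hinge_hcos c \<gamma> \<sigma> s t" if "0 < s" "s \<le> l" "0 < t" "t \<le> m" for s t
    unfolding ca using Lle[of "(s, t)"] that by (simp add: B_def h_def)
qed

lemma dist_ec:
  "0 < s \<Longrightarrow> 0 < t \<Longrightarrow> (dist (\<gamma> s) (\<sigma> t))\<^sup>2 = s\<^sup>2 + t\<^sup>2 - 2 * s * t * hinge_ecos \<gamma> \<sigma> s t"
  by (simp add: hinge_ecos_def ecos_def)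

text \<open>Hinge comparison in Euclidean form. The difference between the hyperbolic and the
  Euclidean law of cosines is collected in the last term, where \<open>\<epsilon>\<close> can be
  made small by shrinking \<open>r\<close>.\<close>

lemma hinge:
  assumes fp: "four_point c S" "0 < c" and g: "is_geo \<gamma> p l" "is_geo \<sigma> p m"
    and S: "\<gamma> ` {0..l} \<subseteq> S" "\<sigma> ` {0..m} \<subseteq> S"
    and st: "0 \<le> s" "s \<le> l" "0 \<le> t" "t \<le> m" "s \<le> r" "t \<le> r"
    and r: "4 * ((cosh (c * r))\<^sup>2 - 1) \<le> \<epsilon>"
  shows "(dist (\<gamma> s) (\<sigma> t))\<^sup>2 \<le> s\<^sup>2 + t\<^sup>2 - 2 * s * t * cos (geodesic_angle \<gamma> \<sigma>) + \<epsilon> * s * t"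
proof (cases "s = 0 \<or> t = 0")
  case True
  moreover have "\<gamma> 0 = p" "\<sigma> 0 = p" using g by (auto simp: is_geo_def)
  ultimately show ?thesis
    using is_geo_dist[OF g(1), of s] is_geo_dist[OF g(2), of t] st by auto
next
  case False
  then have p: "0 < s" "0 < t" using st by auto
  have "cos (geodesic_angle \<gamma> \<sigma>) \<le> hinge_ecos \<gamma> \<sigma> s t + \<epsilon> / 2"
    using angle_exists(4)[OF fp g S, of s t] hc_ec(2)[OF fp(2) g, of s t r] p st r by linarith
  then have "2 * s * t * cos (geodesic_angle \<gamma> \<sigma>) \<le> 2 * s * t * (hinge_ecos \<gamma> \<sigma> s t + \<epsilon> / 2)"
    using p by (intro mult_left_mono) auto
  then show ?thesis
    unfolding dist_ec[OF p] by (simp add: algebra_simps)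
qed

section \<open>Completion of a pseudometric\<close>

text \<open>The laws are confined to \<open>S\<close> because nothing is known of
  \<open>geodesic_angle\<close> for functions that are not geodesics from a common point. Distinct
  elements may have distance 0, as geodesics that start together do.\<close>

locale pseudometric_on =
  fixes S :: "'b set" and d :: "'b \<Rightarrow> 'b \<Rightarrow> real"
  assumes refl0: "x \<in> S \<Longrightarrow> d x x = 0"
    and sym: "x \<in> S \<Longrightarrow> y \<in> S \<Longrightarrow> d x y = d y x"
    and tri: "x \<in> S \<Longrightarrow> y \<in> S \<Longrightarrow> z \<in> S \<Longrightarrow> d x z \<le> d x y + d y z"
begin

lemma nonneg: "x \<in> S \<Longrightarrow> y \<in> S \<Longrightarrow> 0 \<le> d x y"
  using tri[of x y x] refl0[of x] sym[of x y] by simp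

lemma seqs_in: "u \<in> cauchy_seqs S d \<Longrightarrow> u n \<in> S"
  by (auto simp: cauchy_seqs_def)

lemma seqs_Cauchy: "u \<in> cauchy_seqs S d \<Longrightarrow> 0 < e \<Longrightarrow> \<exists>N. \<forall>m\<ge>N. \<forall>n\<ge>N. d (u m) (u n) < e"
  by (auto simp: cauchy_seqs_def)

lemma quad: "x \<in> S \<Longrightarrow> y \<in> S \<Longrightarrow> x' \<in> S \<Longrightarrow> y' \<in> S \<Longrightarrow> \<bar>d x y - d x' y'\<bar> \<le> d x x' + d y y'"
  using tri[of x x' y] tri[of x' y' y] tri[of x' x y'] tri[of x y y'] sym[of x x'] sym[of y y'] by linarith

lemma seqs_convergent:
  assumes "u \<in> cauchy_seqs S d" "v \<in> cauchy_seqs S d"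
  shows "convergent (\<lambda>n. d (u n) (v n))"
proof -
  have "Cauchy (\<lambda>n. d (u n) (v n))"
    unfolding Cauchy_def
  proof (intro allI impI)
    fix e :: real assume "0 < e"
    then obtain N1 N2 where N: "\<And>m n. m \<ge> N1 \<Longrightarrow> n \<ge> N1 \<Longrightarrow> d (u m) (u n) < e / 2"
      "\<And>m n. m \<ge> N2 \<Longrightarrow> n \<ge> N2 \<Longrightarrow> d (v m) (v n) < e / 2"
      using seqs_Cauchy[OF assms(1) half_gt_zero[OF \<open>0 < e\<close>]] seqs_Cauchy[OF assms(2) half_gt_zero[OF \<open>0 < e\<close>]]
      by blast
    show "\<exists>M. \<forall>m\<ge>M. \<forall>n\<ge>M. dist (d (u m) (v m)) (d (u n) (v n)) < e"
    proof (intro exI allI impI)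
      fix m n assume "m \<ge> max N1 N2" "n \<ge> max N1 N2"
      then have "d (u m) (u n) < e / 2" "d (v m) (v n) < e / 2" using N by auto
      then show "dist (d (u m) (v m)) (d (u n) (v n)) < e"
        using quad[of "u m" "v m" "u n" "v n"] seqs_in assms by (simp add: dist_real_def)
    qed
  qed
  then show ?thesis by (simp add: Cauchy_convergent_iff)
qed

lemma rel_class:
  assumes "(u, u') \<in> cauchy_rel S d" "(v, v') \<in> cauchy_rel S d" "(\<lambda>n. d (u n) (v n)) \<longlonglongrightarrow> l"
  shows "(\<lambda>n. d (u' n) (v' n)) \<longlonglongrightarrow> l"
proof -
  have s: "u \<in> cauchy_seqs S d" "u' \<in> cauchy_seqs S d" "v \<in> cauchy_seqs S d" "v' \<in> cauchy_seqs S d"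
    and lim: "(\<lambda>n. d (u n) (u' n)) \<longlonglongrightarrow> 0" "(\<lambda>n. d (v n) (v' n)) \<longlonglongrightarrow> 0"
    using assms by (auto simp: cauchy_rel_def)
  have "(\<lambda>n. d (u' n) (v' n) - d (u n) (v n)) \<longlonglongrightarrow> 0"
  proof (rule Lim_null_comparison)
    show "(\<lambda>n. d (u n) (u' n) + d (v n) (v' n)) \<longlonglongrightarrow> 0"
      using tendsto_add[OF lim] by simp
    show "\<forall>\<^sub>F n in sequentially. norm (d (u' n) (v' n) - d (u n) (v n)) \<le> d (u n) (u' n) + d (v n) (v' n)"
      using quad[OF seqs_in[OF s(1)] seqs_in[OF s(3)] seqs_in[OF s(2)] seqs_in[OF s(4)]]
      by (simp add: abs_minus_commute)
  qed
  from tendsto_add[OF this assms(3)] show ?thesis by simp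
qed

lemma rel_refl: "u \<in> cauchy_seqs S d \<Longrightarrow> (u, u) \<in> cauchy_rel S d"
  by (simp add: cauchy_rel_def refl0 seqs_in)

lemma rel_sym: "(u, v) \<in> cauchy_rel S d \<Longrightarrow> (v, u) \<in> cauchy_rel S d"
proof -
  assume *: "(u, v) \<in> cauchy_rel S d"
  then have "d (u n) (v n) = d (v n) (u n)" for n
    using sym seqs_in by (auto simp: cauchy_rel_def)
  with * show ?thesis by (simp add: cauchy_rel_def)
qed

lemma rel_trans:
  assumes "(u, v) \<in> cauchy_rel S d" "(v, w) \<in> cauchy_rel S d"
  shows "(u, w) \<in> cauchy_rel S d"
proof -
  have "(\<lambda>n. d (u n) (w n)) \<longlonglongrightarrow> 0"
    using rel_class[OF rel_refl assms(2), of u 0] assms(1) by (auto simp: cauchy_rel_def)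
  then show ?thesis using assms by (auto simp: cauchy_rel_def)
qed

lemma equiv_rel: "equiv (cauchy_seqs S d) (cauchy_rel S d)"
proof (rule equivI)
  show "cauchy_rel S d \<subseteq> cauchy_seqs S d \<times> cauchy_seqs S d" by (auto simp: cauchy_rel_def)
  show "refl_on (cauchy_seqs S d) (cauchy_rel S d)" using rel_refl by (auto simp: refl_on_def)
  show "sym (cauchy_rel S d)" using rel_sym by (auto simp: sym_def)
  show "trans (cauchy_rel S d)" using rel_trans by (auto simp: trans_def)
qed

abbreviation "M \<equiv> cauchy_completion S d"
abbreviation "D \<equiv> cauchy_completion_dist d"
abbreviation "emb \<equiv> cauchy_completion_embed S d"

lemma class_rep:
  assumes "A \<in> M"
  obtains u where "u \<in> A" "u \<in> cauchy_seqs S d"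
proof -
  obtain u where "A = cauchy_rel S d `` {u}" "u \<in> cauchy_seqs S d"
    using assms unfolding cauchy_completion_def by (rule quotientE)
  then show ?thesis using that[of u] equiv_class_self[OF equiv_rel] by simp
qed

lemma class_rel: "A \<in> M \<Longrightarrow> u \<in> A \<Longrightarrow> v \<in> A \<Longrightarrow> (u, v) \<in> cauchy_rel S d"
  unfolding cauchy_completion_def using quotient_eq_iff[OF equiv_rel, of A A u v] by simp

lemma dist_tendsto:
  assumes "A \<in> M" "B \<in> M" "u \<in> A" "v \<in> B"
  shows "(\<lambda>n. d (u n) (v n)) \<longlonglongrightarrow> D A B"
proof -
  have "u \<in> cauchy_seqs S d" "v \<in> cauchy_seqs S d"
    using class_rel[OF assms(1,3,3)] class_rel[OF assms(2,4,4)] by (auto simp: cauchy_rel_def)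
  then obtain l where l: "(\<lambda>n. d (u n) (v n)) \<longlonglongrightarrow> l"
    using seqs_convergent by (auto simp: convergent_def)
  have all: "\<forall>u\<in>A. \<forall>v\<in>B. (\<lambda>n. d (u n) (v n)) \<longlonglongrightarrow> l"
    using rel_class[OF class_rel[OF assms(1,3)] class_rel[OF assms(2,4)] l] by auto
  have "l' = l" if "\<forall>u\<in>A. \<forall>v\<in>B. (\<lambda>n. d (u n) (v n)) \<longlonglongrightarrow> l'" for l'
    using that assms(3,4) LIMSEQ_unique[OF _ l] by simp
  with all have "D A B = l"
    unfolding cauchy_completion_dist_def by (intro the_equality)
  with l show ?thesis by simp
qed

lemma D_nonneg: "A \<in> M \<Longrightarrow> B \<in> M \<Longrightarrow> 0 \<le> D A B"
proof -
  assume A: "A \<in> M" and B: "B \<in> M"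
  obtain u v where "u \<in> A" "u \<in> cauchy_seqs S d" "v \<in> B" "v \<in> cauchy_seqs S d"
    using class_rep A B by metis
  then show ?thesis
    using LIMSEQ_le_const[OF dist_tendsto[OF A B]] nonneg seqs_in by blast
qed

lemma D_le:
  assumes "A \<in> M" "B \<in> M" "\<And>x y. x \<in> S \<Longrightarrow> y \<in> S \<Longrightarrow> d x y \<le> m"
  shows "D A B \<le> m"
proof -
  obtain u v where "u \<in> A" "u \<in> cauchy_seqs S d" "v \<in> B" "v \<in> cauchy_seqs S d"
    using class_rep assms by metis
  then show ?thesis
    using LIMSEQ_le_const2[OF dist_tendsto[OF assms(1,2)]] assms(3) seqs_in by blast
qed

lemma D_commute: "A \<in> M \<Longrightarrow> B \<in> M \<Longrightarrow> D A B = D B A"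
proof -
  assume A: "A \<in> M" and B: "B \<in> M"
  obtain u v where uv: "u \<in> A" "u \<in> cauchy_seqs S d" "v \<in> B" "v \<in> cauchy_seqs S d"
    using class_rep A B by metis
  have "d (v n) (u n) = d (u n) (v n)" for n using sym seqs_in uv by blast
  then show ?thesis
    using LIMSEQ_unique[OF dist_tendsto[OF A B uv(1,3)]] dist_tendsto[OF B A uv(3,1)] by simp
qed

lemma D_triangle: "A \<in> M \<Longrightarrow> B \<in> M \<Longrightarrow> C \<in> M \<Longrightarrow> D A C \<le> D A B + D B C"
proof -
  assume A: "A \<in> M" and B: "B \<in> M" and C: "C \<in> M"
  obtain u v w where uv: "u \<in> A" "u \<in> cauchy_seqs S d" "v \<in> B" "v \<in> cauchy_seqs S d" "w \<in> C" "w \<in> cauchy_seqs S d"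
    using class_rep A B C by metis
  show ?thesis
    by (rule LIMSEQ_le[OF dist_tendsto[OF A C uv(1,5)]
          tendsto_add[OF dist_tendsto[OF A B uv(1,3)] dist_tendsto[OF B C uv(3,5)]]])
       (use tri seqs_in uv in blast)
qed

lemma D_zero: "A \<in> M \<Longrightarrow> B \<in> M \<Longrightarrow> D A B = 0 \<longleftrightarrow> A = B"
proof -
  assume A: "A \<in> M" and B: "B \<in> M"
  obtain u v where uv: "u \<in> A" "u \<in> cauchy_seqs S d" "v \<in> B" "v \<in> cauchy_seqs S d"
    using class_rep A B by metis
  have "D A B = 0 \<longleftrightarrow> (u, v) \<in> cauchy_rel S d"
    using dist_tendsto[OF A B uv(1,3)] uv LIMSEQ_unique by (auto simp: cauchy_rel_def)
  also have "\<dots> \<longleftrightarrow> A = B"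
    using quotient_eq_iff[OF equiv_rel, of A B u v] A B uv unfolding cauchy_completion_def by blast
  finally show ?thesis .
qed

lemma const_seqs: "x \<in> S \<Longrightarrow> (\<lambda>_. x) \<in> cauchy_seqs S d"
  by (simp add: cauchy_seqs_def refl0)

lemma emb_in: "x \<in> S \<Longrightarrow> emb x \<in> M"
  unfolding cauchy_completion_embed_def cauchy_completion_def by (intro quotientI const_seqs)

lemma emb_mem: "x \<in> S \<Longrightarrow> (\<lambda>_. x) \<in> emb x"
  unfolding cauchy_completion_embed_def using rel_refl[OF const_seqs] by auto

lemma D_emb: "x \<in> S \<Longrightarrow> y \<in> S \<Longrightarrow> D (emb x) (emb y) = d x y"
  using dist_tendsto[of "emb x" "emb y" "\<lambda>_. x" "\<lambda>_. y"] by (simp add: emb_in emb_mem LIMSEQ_const_iff)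

lemma emb_dense:
  assumes "A \<in> M" "0 < e"
  obtains x where "x \<in> S" "D (emb x) A < e"
proof -
  obtain u where u: "u \<in> A" "u \<in> cauchy_seqs S d" using class_rep[OF assms(1)] .
  obtain N where N: "\<And>m n. m \<ge> N \<Longrightarrow> n \<ge> N \<Longrightarrow> d (u m) (u n) < e / 2"
    using seqs_Cauchy[OF u(2) half_gt_zero[OF assms(2)]] by blast
  have x: "u N \<in> S" by (rule seqs_in[OF u(2)])
  have "D (emb (u N)) A \<le> e / 2"
    by (rule LIMSEQ_le_const2[OF dist_tendsto[OF emb_in[OF x] assms(1) emb_mem[OF x] u(1)]])
       (use N in \<open>auto intro!: exI[of _ N] less_imp_le\<close>)
  then show ?thesis using that[OF x] assms(2) by simp
qed

lemma emb_Cauchy_limit: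
  assumes u: "u \<in> cauchy_seqs S d"
  obtains A where "A \<in> M" "(\<lambda>n. D (emb (u n)) A) \<longlonglongrightarrow> 0"
proof -
  define A where "A = cauchy_rel S d `` {u}"
  have A: "A \<in> M" unfolding A_def cauchy_completion_def by (intro quotientI u)
  have uA: "u \<in> A" unfolding A_def using rel_refl[OF u] by auto
  have "(\<lambda>n. D (emb (u n)) A) \<longlonglongrightarrow> 0"
    unfolding LIMSEQ_def
  proof (intro allI impI)
    fix e :: real assume e: "0 < e"
    then obtain N where N: "\<And>m n. m \<ge> N \<Longrightarrow> n \<ge> N \<Longrightarrow> d (u m) (u n) < e / 2"
      using seqs_Cauchy[OF u half_gt_zero[OF e]] by blast
    have "dist (D (emb (u n)) A) 0 < e" if "n \<ge> N" for n
    proof -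
      have x: "u n \<in> S" by (rule seqs_in[OF u])
      have "D (emb (u n)) A \<le> e / 2"
        by (rule LIMSEQ_le_const2[OF dist_tendsto[OF emb_in[OF x] A emb_mem[OF x] uA]])
           (use N that in \<open>auto intro!: exI[of _ N] less_imp_le\<close>)
      then show ?thesis using e D_nonneg[OF emb_in[OF x] A] by (simp add: dist_real_def)
    qed
    then show "\<exists>no. \<forall>n\<ge>no. dist (D (emb (u n)) A) 0 < e" by blast
  qed
  with A show ?thesis by (rule that)
qed

text \<open>Nets in \<open>S\<close> itself make its image totally bounded, which gives a Cauchy
  subsequence; the completion contains its limit.\<close>

lemma subseq_limit:
  assumes net: "\<And>e. 0 < e \<Longrightarrow> \<exists>K. finite K \<and> K \<subseteq> S \<and> (\<forall>x\<in>S. \<exists>k\<in>K. d k x < e)"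
    and x: "\<And>n. x n \<in> S"
  obtains r A where "strict_mono (r :: nat \<Rightarrow> nat)" "A \<in> M" "(\<lambda>n. D (emb (x (r n))) A) \<longlonglongrightarrow> 0"
proof -
  \<comment> \<open>A \<open>Metric_space\<close> is nonnegative and symmetric on the whole type,
    hence the value 0 outside \<open>M\<close>.\<close>
  define D' where "D' A B = (if A \<in> M \<and> B \<in> M then D A B else 0)" for A B
  interpret ms: Metric_space M D'
  proof
    fix A B
    show "0 \<le> D' A B" by (simp add: D'_def D_nonneg)
    show "D' A B = D' B A" using D_commute[of A B] by (simp add: D'_def)
    show "D' A B = 0 \<longleftrightarrow> A = B" if "A \<in> M" "B \<in> M" using that by (simp add: D'_def D_zero)
    show "D' A C \<le> D' A B + D' B C" if "A \<in> M" "B \<in> M" "C \<in> M" for C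
      using that D_triangle[of A B C] by (simp add: D'_def)
  qed
  have "ms.mtotally_bounded (emb ` S)"
    unfolding ms.mtotally_bounded_def
  proof (intro allI impI)
    fix e :: real assume "0 < e"
    then obtain K where K: "finite K" "K \<subseteq> S" "\<forall>x\<in>S. \<exists>k\<in>K. d k x < e" using net[of e] by auto
    have "emb ` S \<subseteq> (\<Union>x\<in>emb ` K. ms.mball x e)"
    proof clarify
      fix x assume "x \<in> S"
      then obtain k where k: "k \<in> K" "d k x < e" using K by blast
      then have "emb x \<in> ms.mball (emb k) e"
        using K(2) \<open>x \<in> S\<close> by (auto simp: ms.in_mball D'_def emb_in D_emb subsetD)
      then show "emb x \<in> (\<Union>x\<in>emb ` K. ms.mball x e)" using k(1) by blast
    qed
    then show "\<exists>K. finite K \<and> K \<subseteq> emb ` S \<and> emb ` S \<subseteq> (\<Union>x\<in>K. ms.mball x e)"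
      using K by (intro exI[of _ "emb ` K"]) auto
  qed
  moreover have "range (\<lambda>n. emb (x n)) \<subseteq> emb ` S" using x by auto
  ultimately have "\<exists>r :: nat \<Rightarrow> nat. strict_mono r \<and> ms.MCauchy ((\<lambda>n. emb (x n)) \<circ> r)"
    unfolding ms.mtotally_bounded_sequentially by simp
  then obtain r :: "nat \<Rightarrow> nat" where r: "strict_mono r" "ms.MCauchy ((\<lambda>n. emb (x n)) \<circ> r)"
    by blast
  have "(\<lambda>n. x (r n)) \<in> cauchy_seqs S d"
    using r(2) x by (auto simp: ms.MCauchy_def cauchy_seqs_def D'_def emb_in D_emb)
  from emb_Cauchy_limit[OF this] obtain A where "A \<in> M" "(\<lambda>n. D (emb (x (r n))) A) \<longlonglongrightarrow> 0" .
  with r(1) show ?thesis by (rule that)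
qed

end

section \<open>Directions at a point\<close>

abbreviation dir :: "'a::metric_space \<Rightarrow> (real \<Rightarrow> 'a) \<Rightarrow> 'a direction" where
  "dir p \<gamma> \<equiv> cauchy_completion_embed (geodesics_from p) geodesic_angle \<gamma>"

text \<open>
  Viewed at scale \<open>l n\<close>, the points \<open>x n\<close> tend to the point \<open>a\<xi>\<close> of the tangent cone. Directions need
  not be represented by geodesics, hence the approximation by \<open>\<tau>\<close>.
\<close>

definition tangent_along :: "'a::metric_space \<Rightarrow> 'a direction \<Rightarrow> real \<Rightarrow> (nat \<Rightarrow> real) \<Rightarrow> (nat \<Rightarrow> 'a) \<Rightarrow> bool" where
  "tangent_along p \<xi> a l x \<longleftrightarrow> (\<forall>e>0. \<exists>\<tau>\<in>geodesics_from p. dir_dist (dir p \<tau>) \<xi> < e \<and>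
    (\<forall>\<^sub>F n in sequentially. dist (x n) (\<tau> (a * l n)) \<le> e * l n))"

section \<open>Planar trigonometry\<close>

lemma one_minus_cos_le: "2 * (1 - cos x) \<le> x\<^sup>2" for x :: real
proof -
  have "1 - cos x = 2 * (sin (x / 2))\<^sup>2" using cos_double_sin[of "x / 2"] by simp
  also have "(sin (x / 2))\<^sup>2 \<le> (x / 2)\<^sup>2"
    using abs_sin_x_le_abs_x[of "x / 2"] unfolding abs_le_square_iff .
  finally show ?thesis by (simp add: power2_eq_square)
qed

lemma chord_eq: "sqrt (2 - 2 * cos t) = 2 * sin (t / 2)" if "0 \<le> t" "t \<le> pi" for t :: real
proof -
  have "(2 * sin (t / 2))\<^sup>2 = 2 - 2 * cos t" using cos_double_sin[of "t / 2"] by (simp add: power_mult_distrib)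
  moreover have "0 \<le> 2 * sin (t / 2)" using that sin_ge_zero[of "t / 2"] by simp
  ultimately show ?thesis by (rule real_sqrt_unique)
qed

text \<open>The hypothesis compares, in the plane, the chord of angle \<open>C\<close> with a detour
  over a point at distance \<open>b\<close> on a ray that makes angles \<open>A\<close> and
  \<open>B\<close> with the outer rays. The best \<open>b\<close> is where the chord of angle
  \<open>A + B = 2 * h\<close> meets this ray: the chord is at distance \<open>cos h\<close> from
  the vertex and the ray deviates by \<open>e\<close> from the bisector, so
  \<open>b = cos h / cos e\<close> and the detour has length \<open>2 * sin h\<close>.\<close>

lemma planar_angle_triangle:
  fixes A B C :: real
  assumes r: "0 \<le> A" "A \<le> pi" "0 \<le> B" "B \<le> pi" "0 \<le> C" "C \<le> pi"
    and N: "\<And>b. 0 \<le> b \<Longrightarrow> sqrt (2 - 2 * cos C) \<le> sqrt (1 + b\<^sup>2 - 2 * b * cos A) + sqrt (b\<^sup>2 + 1 - 2 * b * cos B)"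
  shows "C \<le> A + B"
proof (cases "A + B < pi")
  case True
  define h e where "h = (A + B) / 2" and "e = (A - B) / 2"
  have AB: "A = h + e" "B = h - e" by (simp_all add: h_def e_def field_simps)
  have "2 * h = A + B" "2 * e = A - B" by (simp_all add: h_def e_def)
  then have "0 \<le> h \<and> h < pi / 2 \<and> - h \<le> e \<and> e \<le> h" using True r by (intro conjI; linarith)
  then have he: "0 \<le> h" "h < pi / 2" "- h \<le> e" "e \<le> h" by auto
  have ce: "0 < cos e" using he by (intro cos_gt_zero_pi) auto
  have ch: "0 < cos h" using he by (intro cos_gt_zero_pi) auto
  have id: "1 + (cos h / cos e)\<^sup>2 - 2 * (cos h / cos e) * cos (h + e') = (sin (h + e') / cos e)\<^sup>2"
    if "e' = e \<or> e' = - e" for e'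
  proof -
    have s: "(sin h)\<^sup>2 = 1 - (cos h)\<^sup>2" "(sin e)\<^sup>2 = 1 - (cos e)\<^sup>2" by (simp_all add: sin_squared_eq)
    have sh: "sin h * sin h = 1 - cos h * cos h" "sin e * sin e = 1 - cos e * cos e"
      using s by (simp_all add: power2_eq_square)
    have ce': "cos e' = cos e" and se': "sin e' * sin e' = 1 - cos e * cos e" using that sh by auto
    have "(cos e)\<^sup>2 + (cos h)\<^sup>2 - 2 * cos h * cos e * cos (h + e') = (sin (h + e'))\<^sup>2"
    proof -
      have "(sin (h + e'))\<^sup>2 = (sin h * sin h) * (cos e' * cos e') + 2 * (sin h * sin e') * (cos h * cos e') + (cos h * cos h) * (sin e' * sin e')"
        by (simp add: sin_add power2_eq_square algebra_simps)
      also have "\<dots> = (cos e)\<^sup>2 + (cos h)\<^sup>2 - 2 * cos h * cos e * (cos h * cos e' - sin h * sin e')"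
        unfolding sh se' ce' by (simp add: power2_eq_square algebra_simps)
      finally show ?thesis by (simp add: cos_add)
    qed
    then show ?thesis using ce by (simp add: field_simps power2_eq_square)
  qed
  have "sqrt (2 - 2 * cos C) \<le> \<bar>sin (h + e) / cos e\<bar> + \<bar>sin (h + - e) / cos e\<bar>"
    using N[of "cos h / cos e"] ch ce id[of e] id[of "- e"] by (simp add: AB add.commute)
  also have "\<dots> = (sin (h + e) + sin (h + - e)) / cos e"
    using he ce sin_ge_zero[of "h + e"] sin_ge_zero[of "h + - e"] by (simp add: add_divide_distrib)
  also have "\<dots> = 2 * sin h" using ce by (simp add: sin_add sin_diff)
  finally have "sin (C / 2) \<le> sin h" using chord_eq[OF r(5,6)] by simp
  then have "C / 2 \<le> h" using he r by (subst (asm) sin_mono_le_eq) auto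
  then show ?thesis by (simp add: h_def)
qed (use r in auto)

text \<open>All that is used of an Alexandrov space from here on: \<open>fp\<close> carries the
  curvature bound and \<open>pack\<close> the finite dimension.\<close>

locale alexandrov =
  fixes c :: real and space :: "'a::metric_space itself"
  assumes c_pos: "0 < c"
    and fp: "\<And>x::'a. \<exists>r>0. four_point c (ball x r)"
    and geo: "\<And>p q::'a. \<exists>\<gamma>. min_geodesic \<gamma> p q"
    and pack: "\<And>p::'a. \<exists>R>0. packed p R"
    and proper: "\<And>(x::'a) R. compact (cball x R)"
begin

lemma geo_image: "is_geo \<gamma> p l \<Longrightarrow> l < r \<Longrightarrow> \<gamma> ` {0..l} \<subseteq> ball (p::'a) r"
  using is_geo_dist(1)[of \<gamma> p l] by auto

lemma geo_short:
  assumes "\<gamma> \<in> geodesics_from (p::'a)" "0 < r"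
  obtains l where "is_geo \<gamma> p l" "l < r"
proof -
  obtain m where m: "is_geo \<gamma> p m" using assms(1) by (auto simp: geodesics_from_iff)
  then have "0 < m" by (simp add: is_geo_def)
  then have g: "is_geo \<gamma> p (min m (r / 2))" using assms(2) by (intro is_geo_mono[OF m]) auto
  show ?thesis by (rule that[OF g]) (use assms(2) in simp)
qed

lemma angle_props:
  assumes "\<gamma> \<in> geodesics_from (p::'a)" "\<sigma> \<in> geodesics_from p"
  shows "0 \<le> geodesic_angle \<gamma> \<sigma>" "geodesic_angle \<gamma> \<sigma> \<le> pi"
    "((\<lambda>x. hinge_ecos \<gamma> \<sigma> (fst x) (snd x)) \<longlongrightarrow> cos (geodesic_angle \<gamma> \<sigma>)) corner"
proof -
  obtain r where r: "r > 0" "four_point c (ball p r)" using fp by blast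
  obtain l m where lm: "is_geo \<gamma> p l" "l < r" "is_geo \<sigma> p m" "m < r"
    using geo_short[OF assms(1) r(1)] geo_short[OF assms(2) r(1)] by metis
  note * = angle_exists[OF r(2) c_pos lm(1,3) geo_image[OF lm(1,2)] geo_image[OF lm(3,4)]]
  show "0 \<le> geodesic_angle \<gamma> \<sigma>" "geodesic_angle \<gamma> \<sigma> \<le> pi"
    "((\<lambda>x. hinge_ecos \<gamma> \<sigma> (fst x) (snd x)) \<longlongrightarrow> cos (geodesic_angle \<gamma> \<sigma>)) corner"
    by (fact *(1) *(2) *(3))+
qed

text \<open>The limit is a distance in the Euclidean cone over the directions, because the angle is
  defined as a limit of Euclidean hinges. At the apex, for \<open>a = 0\<close> or
  \<open>b = 0\<close>, there is no hinge and the distance is read off a single geodesic.\<close>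

lemma geodesic_dist_limit:
  assumes g: "\<gamma> \<in> geodesics_from (p::'a)" "\<sigma> \<in> geodesics_from p" and ab: "0 \<le> a" "0 \<le> b"
    and l: "\<And>n. 0 < l n" "l \<longlonglongrightarrow> 0"
  shows "(\<lambda>n. dist (\<gamma> (a * l n)) (\<sigma> (b * l n)) / l n) \<longlonglongrightarrow> sqrt (a\<^sup>2 + b\<^sup>2 - 2 * a * b * cos (geodesic_angle \<gamma> \<sigma>))"
proof -
  have small: "\<forall>\<^sub>F n in sequentially. x * l n \<le> m" if "0 < m" for x m
  proof -
    have "(\<lambda>n. x * l n) \<longlonglongrightarrow> x * 0" by (intro tendsto_intros l)
    then have "\<forall>\<^sub>F n in sequentially. x * l n < m" using that by (intro order_tendstoD) auto
    then show ?thesis by (rule eventually_mono) simp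
  qed
  obtain L M where LM: "is_geo \<gamma> p L" "is_geo \<sigma> p M" using g by (auto simp: geodesics_from_iff)
  have LM0: "0 < L" "0 < M" "\<gamma> 0 = p" "\<sigma> 0 = p" using LM by (auto simp: is_geo_def)
  have l0: "0 \<le> l n" for n using l(1)[of n] by simp
  consider "a = 0" | "b = 0" | "0 < a" "0 < b" using ab by fastforce
  then show ?thesis
  proof cases
    case 1
    have "\<forall>\<^sub>F n in sequentially. b = dist (\<gamma> (a * l n)) (\<sigma> (b * l n)) / l n"
      using small[OF LM0(2), of b]
    proof (rule eventually_mono)
      fix n assume "b * l n \<le> M"
      then show "b = dist (\<gamma> (a * l n)) (\<sigma> (b * l n)) / l n"
        using 1 LM0 is_geo_dist(1)[OF LM(2), of "b * l n"] l(1)[of n] ab l0 by simp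
    qed
    then show ?thesis using 1 ab by (intro tendsto_eventually) (auto elim: eventually_mono)
  next
    case 2
    have "\<forall>\<^sub>F n in sequentially. a = dist (\<gamma> (a * l n)) (\<sigma> (b * l n)) / l n"
      using small[OF LM0(1), of a]
    proof (rule eventually_mono)
      fix n assume "a * l n \<le> L"
      then show "a = dist (\<gamma> (a * l n)) (\<sigma> (b * l n)) / l n"
        using 2 LM0 is_geo_dist(2)[OF LM(1), of "a * l n"] l(1)[of n] ab l0 by simp
    qed
    then show ?thesis using 2 ab by (intro tendsto_eventually) (auto elim: eventually_mono)
  next
    case 3
    have fl: "filterlim (\<lambda>n. x * l n) (at_right 0) sequentially" if "0 < x" for x
      unfolding filterlim_at
    proof
      show "(\<lambda>n. x * l n) \<longlonglongrightarrow> 0" using tendsto_mult_left[OF l(2), of x] by simp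
      show "\<forall>\<^sub>F n in sequentially. x * l n \<in> {0<..} \<and> x * l n \<noteq> 0"
        using mult_pos_pos[OF that l(1)] by (intro always_eventually allI) (metis greaterThan_iff less_irrefl)
    qed
    have "filterlim (\<lambda>n. (a * l n, b * l n)) corner sequentially"
      by (intro filterlim_Pair fl 3)
    from filterlim_compose[OF angle_props(3)[OF g] this]
    have e: "(\<lambda>n. hinge_ecos \<gamma> \<sigma> (a * l n) (b * l n)) \<longlonglongrightarrow> cos (geodesic_angle \<gamma> \<sigma>)" by simp
    have "dist (\<gamma> (a * l n)) (\<sigma> (b * l n)) / l n = sqrt (a\<^sup>2 + b\<^sup>2 - 2 * a * b * hinge_ecos \<gamma> \<sigma> (a * l n) (b * l n))" for n
    proof -
      have "a\<^sup>2 + b\<^sup>2 - 2 * a * b * hinge_ecos \<gamma> \<sigma> (a * l n) (b * l n) = (dist (\<gamma> (a * l n)) (\<sigma> (b * l n)))\<^sup>2 / (l n)\<^sup>2"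
        using 3 l(1)[of n] dist_ec[of "a * l n" "b * l n" \<gamma> \<sigma>] by (simp add: field_simps power2_eq_square)
      then show ?thesis using l0 by (simp add: real_sqrt_divide)
    qed
    then show ?thesis by (simp, intro tendsto_intros e)
  qed
qed

lemma angle_refl: "\<gamma> \<in> geodesics_from (p::'a) \<Longrightarrow> geodesic_angle \<gamma> \<gamma> = 0"
proof -
  assume g: "\<gamma> \<in> geodesics_from p"
  have "(\<lambda>n. dist (\<gamma> (1 * inverse (real (Suc n)))) (\<gamma> (1 * inverse (real (Suc n)))) / inverse (real (Suc n)))
      \<longlonglongrightarrow> sqrt (1\<^sup>2 + 1\<^sup>2 - 2 * 1 * 1 * cos (geodesic_angle \<gamma> \<gamma>))"
    by (intro geodesic_dist_limit[OF g g] LIMSEQ_inverse_real_of_nat) auto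
  then have "cos (geodesic_angle \<gamma> \<gamma>) = 1" by (simp add: LIMSEQ_const_iff)
  then show ?thesis
    using angle_props(1,2)[OF g g] cos_inj_pi[of "geodesic_angle \<gamma> \<gamma>" 0] by simp
qed

lemma angle_sym:
  assumes g: "\<gamma> \<in> geodesics_from (p::'a)" "\<sigma> \<in> geodesics_from p"
  shows "geodesic_angle \<gamma> \<sigma> = geodesic_angle \<sigma> \<gamma>"
proof -
  let ?l = "\<lambda>n. inverse (real (Suc n))"
  have "(\<lambda>n. dist (\<gamma> (1 * ?l n)) (\<sigma> (1 * ?l n)) / ?l n) \<longlonglongrightarrow> sqrt (1\<^sup>2 + 1\<^sup>2 - 2 * 1 * 1 * cos (geodesic_angle \<gamma> \<sigma>))"
    "(\<lambda>n. dist (\<sigma> (1 * ?l n)) (\<gamma> (1 * ?l n)) / ?l n) \<longlonglongrightarrow> sqrt (1\<^sup>2 + 1\<^sup>2 - 2 * 1 * 1 * cos (geodesic_angle \<sigma> \<gamma>))"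
    by (rule geodesic_dist_limit[OF g] geodesic_dist_limit[OF g(2,1)]; simp add: LIMSEQ_inverse_real_of_nat del: of_nat_Suc)+
  then have "sqrt (1\<^sup>2 + 1\<^sup>2 - 2 * 1 * 1 * cos (geodesic_angle \<gamma> \<sigma>)) = sqrt (1\<^sup>2 + 1\<^sup>2 - 2 * 1 * 1 * cos (geodesic_angle \<sigma> \<gamma>))"
    unfolding dist_commute[of "\<sigma> _"] by (rule LIMSEQ_unique)
  then have "cos (geodesic_angle \<gamma> \<sigma>) = cos (geodesic_angle \<sigma> \<gamma>)" by simp
  then show ?thesis
    by (rule cos_inj_pi[OF angle_props(1,2)[OF g] angle_props(1,2)[OF g(2,1)]])
qed

text \<open>The points at distances 1, \<open>b\<close> and 1 along the three geodesics, rescaled,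
  obey the triangle inequality; in the limit it becomes the hypothesis of
  \<open>planar_angle_triangle\<close>.\<close>

lemma angle_triangle:
  assumes g: "\<gamma> \<in> geodesics_from (p::'a)" "\<sigma> \<in> geodesics_from p" "\<tau> \<in> geodesics_from p"
  shows "geodesic_angle \<gamma> \<tau> \<le> geodesic_angle \<gamma> \<sigma> + geodesic_angle \<sigma> \<tau>"
proof (rule planar_angle_triangle)
  fix b :: real assume b: "0 \<le> b"
  let ?l = "\<lambda>n. inverse (real (Suc n))"
  have l: "\<And>n. 0 < ?l n" "?l \<longlonglongrightarrow> 0" using LIMSEQ_inverse_real_of_nat by auto
  have "sqrt (1\<^sup>2 + 1\<^sup>2 - 2 * 1 * 1 * cos (geodesic_angle \<gamma> \<tau>))
    \<le> sqrt (1\<^sup>2 + b\<^sup>2 - 2 * 1 * b * cos (geodesic_angle \<gamma> \<sigma>)) + sqrt (b\<^sup>2 + 1\<^sup>2 - 2 * b * 1 * cos (geodesic_angle \<sigma> \<tau>))"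
  proof (rule LIMSEQ_le[OF geodesic_dist_limit[OF g(1,3) _ _ l]
        tendsto_add[OF geodesic_dist_limit[OF g(1,2) _ b l] geodesic_dist_limit[OF g(2,3) b _ l]]])
    show "\<exists>N. \<forall>n\<ge>N. dist (\<gamma> (1 * ?l n)) (\<tau> (1 * ?l n)) / ?l n
        \<le> dist (\<gamma> (1 * ?l n)) (\<sigma> (b * ?l n)) / ?l n + dist (\<sigma> (b * ?l n)) (\<tau> (1 * ?l n)) / ?l n"
      unfolding add_divide_distrib[symmetric]
      by (intro exI[of _ 0] allI impI divide_right_mono dist_triangle) simp
  qed auto
  then show "sqrt (2 - 2 * cos (geodesic_angle \<gamma> \<tau>))
    \<le> sqrt (1 + b\<^sup>2 - 2 * b * cos (geodesic_angle \<gamma> \<sigma>)) + sqrt (b\<^sup>2 + 1 - 2 * b * cos (geodesic_angle \<sigma> \<tau>))"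
    by simp
qed (use angle_props(1,2) g in auto)

end

sublocale alexandrov \<subseteq> dirs: pseudometric_on "geodesics_from (p::'a)" geodesic_angle for p
  by unfold_locales (fact angle_refl angle_sym angle_triangle)+

context alexandrov
begin

lemma dir_facts:
  fixes p :: 'a
  shows "\<gamma> \<in> geodesics_from p \<Longrightarrow> dir p \<gamma> \<in> directions p"
    "\<gamma> \<in> geodesics_from p \<Longrightarrow> \<sigma> \<in> geodesics_from p \<Longrightarrow> dir_dist (dir p \<gamma>) (dir p \<sigma>) = geodesic_angle \<gamma> \<sigma>"
    "\<xi> \<in> directions p \<Longrightarrow> \<eta> \<in> directions p \<Longrightarrow> 0 \<le> dir_dist \<xi> \<eta>"
    "\<xi> \<in> directions p \<Longrightarrow> \<eta> \<in> directions p \<Longrightarrow> dir_dist \<xi> \<eta> \<le> pi"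
    "\<xi> \<in> directions p \<Longrightarrow> \<eta> \<in> directions p \<Longrightarrow> dir_dist \<xi> \<eta> = dir_dist \<eta> \<xi>"
    "\<xi> \<in> directions p \<Longrightarrow> \<eta> \<in> directions p \<Longrightarrow> \<zeta> \<in> directions p \<Longrightarrow> dir_dist \<xi> \<zeta> \<le> dir_dist \<xi> \<eta> + dir_dist \<eta> \<zeta>"
    "\<xi> \<in> directions p \<Longrightarrow> dir_dist \<xi> \<xi> = 0"
  unfolding directions_def dir_dist_def
        apply (fact dirs.emb_in)
       apply (fact dirs.D_emb)
      apply (fact dirs.D_nonneg)
     apply (rule dirs.D_le, assumption, assumption, rule angle_props(2), assumption, assumption)
    apply (fact dirs.D_commute)
   apply (fact dirs.D_triangle)
  apply (simp add: dirs.D_zero)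
  done

lemma dir_dense:
  assumes "\<xi> \<in> directions (p::'a)" "0 < e"
  obtains \<tau> where "\<tau> \<in> geodesics_from p" "dir_dist (dir p \<tau>) \<xi> < e"
  by (rule dirs.emb_dense[OF assms[unfolded directions_def], folded dir_dist_def]) (rule that)

text \<open>Finitely many geodesics with mutual angles at least \<open>e1\<close> have, at one
  common small scale, points separated by more than \<open>sin (e1 / 2)\<close> times this scale;
  that is half the limiting chord and leaves room for strictness. The scale depends on the family,
  which is why the packing bound must be uniform in scale.\<close>

lemma geodesics_net:
  assumes "0 < e"
  shows "\<exists>K. finite K \<and> K \<subseteq> geodesics_from (p::'a) \<and> (\<forall>x\<in>geodesics_from p. \<exists>k\<in>K. geodesic_angle k x < e)"
proof -
  define e1 where "e1 = min e 1" \<comment> \<open>so that \<open>sin\<close> is monotone up to \<open>e1 / 2\<close>\<close>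
  have e1: "0 < e1" "e1 \<le> 1" "e1 \<le> e" using assms by (auto simp: e1_def)
  have e1pi: "e1 < pi" using e1 pi_gt3 by linarith
  define \<epsilon> where "\<epsilon> = sin (e1 / 2)"
  have \<epsilon>: "0 < \<epsilon>" unfolding \<epsilon>_def using e1 e1pi by (intro sin_gt_zero) auto
  obtain R where R: "0 < R" "packed p R" using pack by blast
  then obtain N where N: "\<forall>\<rho> A. 0 < \<rho> \<longrightarrow> \<rho> \<le> R \<longrightarrow> finite A \<longrightarrow> A \<subseteq> cball p \<rho> \<longrightarrow>
      (\<forall>a\<in>A. \<forall>b\<in>A. a \<noteq> b \<longrightarrow> \<epsilon> * \<rho> \<le> dist a b) \<longrightarrow> card A < N"
    using \<epsilon> unfolding packed_def by meson
  obtain K where "finite K" "K \<subseteq> geodesics_from p" "\<And>x. x \<in> geodesics_from p \<Longrightarrow> \<exists>k\<in>K. geodesic_angle k x < e1"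
  proof (rule finite_net[of "geodesics_from p" e1 geodesic_angle N])
    fix A assume A: "finite A" "A \<subseteq> geodesics_from p" "\<forall>a\<in>A. \<forall>b\<in>A. a \<noteq> b \<longrightarrow> e1 \<le> geodesic_angle a b"
    let ?l = "\<lambda>n. inverse (real (Suc n))"
    have l: "\<And>n. 0 < ?l n" "?l \<longlonglongrightarrow> 0" using LIMSEQ_inverse_real_of_nat by auto
    have 1: "\<forall>\<^sub>F n in sequentially. a \<noteq> b \<longrightarrow> \<epsilon> * ?l n < dist (a (?l n)) (b (?l n))" if ab: "a \<in> A" "b \<in> A" for a b
    proof (cases "a = b")
      case False
      have g: "a \<in> geodesics_from p" "b \<in> geodesics_from p" using ab A(2) by auto
      let ?t = "geodesic_angle a b"
      have t: "e1 \<le> ?t" "0 \<le> ?t" "?t \<le> pi" using A(3) ab False angle_props(1,2)[OF g] by auto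
      have "sin (e1 / 2) \<le> sin (?t / 2)" using t e1 by (subst sin_mono_le_eq) auto
      then have "\<epsilon> < sqrt (1\<^sup>2 + 1\<^sup>2 - 2 * 1 * 1 * cos ?t)" using \<epsilon> chord_eq[OF t(2,3)] by (simp add: \<epsilon>_def)
      from order_tendstoD(1)[OF geodesic_dist_limit[OF g _ _ l] this]
      have "\<forall>\<^sub>F n in sequentially. \<epsilon> < dist (a (1 * ?l n)) (b (1 * ?l n)) / ?l n" by simp
      then show ?thesis by (rule eventually_mono) (use l(1) in \<open>simp add: pos_less_divide_eq del: of_nat_Suc\<close>)
    qed simp
    have 2: "\<forall>\<^sub>F n in sequentially. dist p (a (?l n)) = ?l n" if a: "a \<in> A" for a
    proof -
      obtain m where m: "is_geo a p m" using a A(2) geodesics_from_iff by blast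
      then have "0 < m" by (auto simp: is_geo_def)
      from order_tendstoD(2)[OF l(2) this] show ?thesis
        by (rule eventually_mono) (use is_geo_dist(1)[OF m] l(1) in \<open>auto intro: less_imp_le\<close>)
    qed
    have "\<forall>\<^sub>F n in sequentially. (\<forall>a\<in>A. \<forall>b\<in>A. a \<noteq> b \<longrightarrow> \<epsilon> * ?l n < dist (a (?l n)) (b (?l n))) \<and>
        (\<forall>a\<in>A. dist p (a (?l n)) = ?l n) \<and> ?l n < R"
      using A(1) 1 2 order_tendstoD(2)[OF l(2) R(1)]
      by (intro eventually_conj eventually_ball_finite ballI) auto
    from eventually_happens'[OF sequentially_bot this]
    obtain n where nn: "(\<forall>a\<in>A. \<forall>b\<in>A. a \<noteq> b \<longrightarrow> \<epsilon> * ?l n < dist (a (?l n)) (b (?l n))) \<and>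
        (\<forall>a\<in>A. dist p (a (?l n)) = ?l n) \<and> ?l n < R"
      by (rule exE)
    have n: "\<And>a b. a \<in> A \<Longrightarrow> b \<in> A \<Longrightarrow> a \<noteq> b \<Longrightarrow> \<epsilon> * ?l n < dist (a (?l n)) (b (?l n))"
        "\<And>a. a \<in> A \<Longrightarrow> dist p (a (?l n)) = ?l n" "?l n < R"
      using nn by (simp_all del: of_nat_Suc)
    have inj: "inj_on (\<lambda>a. a (?l n)) A"
    proof (rule inj_onI, rule ccontr)
      fix a b assume "a \<in> A" "b \<in> A" "a (?l n) = b (?l n)" "a \<noteq> b"
      then show False using n(1)[of a b] mult_pos_pos[OF \<epsilon> l(1)[of n]] by (simp del: of_nat_Suc)
    qed
    have "card ((\<lambda>a. a (?l n)) ` A) < N"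
    proof (rule N[rule_format, of "?l n"])
      show "0 < ?l n" by (rule l(1))
      show "?l n \<le> R" using n(3) by simp
      show "finite ((\<lambda>a. a (?l n)) ` A)" using A(1) by simp
      show "(\<lambda>a. a (?l n)) ` A \<subseteq> cball p (?l n)" using n(2) by (auto simp del: of_nat_Suc)
      fix a b assume "a \<in> (\<lambda>a. a (?l n)) ` A" "b \<in> (\<lambda>a. a (?l n)) ` A" "a \<noteq> b"
      then obtain a' b' where "a' \<in> A" "b' \<in> A" "a = a' (?l n)" "b = b' (?l n)" "a' \<noteq> b'" by blast
      then show "\<epsilon> * ?l n \<le> dist a b" using n(1)[of a' b'] by simp
    qed
    then show "card A < N" using card_image[OF inj] by simp
  next
    fix a b assume "a \<in> geodesics_from p" "b \<in> geodesics_from p"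
    then show "geodesic_angle a b = geodesic_angle b a" by (rule angle_sym)
  next
    fix a assume "a \<in> geodesics_from p"
    then show "geodesic_angle a a < e1" using e1 by (simp add: angle_refl)
  qed blast
  then show ?thesis using e1 by (intro exI[of _ K]) force
qed

lemma directions_subseq:
  assumes "\<And>n. g n \<in> geodesics_from (p::'a)"
  obtains r \<xi> where "strict_mono (r :: nat \<Rightarrow> nat)" "\<xi> \<in> directions p" "(\<lambda>n. dir_dist (dir p (g (r n))) \<xi>) \<longlonglongrightarrow> 0"
  by (rule dirs.subseq_limit[of p g, OF _ assms, folded directions_def dir_dist_def])
     (assumption | rule geodesics_net that)+

end

section \<open>Points approaching along a direction\<close>

lemma small_cosh:
  fixes c :: real
  assumes "0 < \<epsilon>"
  obtains r where "0 < r" "4 * ((cosh (c * r))\<^sup>2 - 1) \<le> \<epsilon>"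
proof -
  have "((\<lambda>r. 4 * ((cosh (c * r))\<^sup>2 - 1)) \<longlongrightarrow> 4 * ((cosh (c * 0))\<^sup>2 - 1)) (at_right 0)"
    by (intro tendsto_intros)
  then have "\<forall>\<^sub>F r in at_right 0. 4 * ((cosh (c * r))\<^sup>2 - 1) < \<epsilon>"
    using assms by (intro order_tendstoD(2)) auto
  then obtain b where b: "0 < b" "\<And>r. 0 < r \<Longrightarrow> r < b \<Longrightarrow> 4 * ((cosh (c * r))\<^sup>2 - 1) < \<epsilon>"
    unfolding eventually_at_right_field by blast
  show ?thesis by (rule that[of "b / 2"]) (use b(1) less_imp_le[OF b(2)[of "b / 2"]] in auto)
qed

lemma acute_of_cos_nonneg:
  fixes t :: real
  assumes "t \<le> pi" "0 \<le> cos t"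
  shows "t \<le> pi / 2"
proof (rule ccontr)
  assume "\<not> t \<le> pi / 2"
  then have "cos t < cos (pi / 2)" using assms(1) by (intro cos_monotone_0_pi) auto
  then show False using assms(2) by simp
qed

context alexandrov
begin

lemma dir_dist_quad:
  fixes p :: 'a
  assumes "\<xi> \<in> directions p" "\<eta> \<in> directions p" "\<xi>' \<in> directions p" "\<eta>' \<in> directions p"
  shows "\<bar>dir_dist \<xi> \<eta> - dir_dist \<xi>' \<eta>'\<bar> \<le> dir_dist \<xi> \<xi>' + dir_dist \<eta> \<eta>'"
  using dir_facts(6)[OF assms(1,3,2)] dir_facts(6)[OF assms(3,4,2)] dir_facts(6)[OF assms(3,1,4)]
    dir_facts(6)[OF assms(1,2,4)] dir_facts(5)[OF assms(1,3)] dir_facts(5)[OF assms(2,4)] by linarith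

lemma dir_dist_tendsto:
  fixes p :: 'a
  assumes "\<xi> \<in> directions p" "\<eta> \<in> directions p" "\<And>n. x n \<in> directions p" "\<And>n. y n \<in> directions p"
    and "(\<lambda>n. dir_dist (x n) \<xi>) \<longlonglongrightarrow> 0" "(\<lambda>n. dir_dist (y n) \<eta>) \<longlonglongrightarrow> 0"
  shows "(\<lambda>n. dir_dist (x n) (y n)) \<longlonglongrightarrow> dir_dist \<xi> \<eta>"
proof -
  have "(\<lambda>n. dir_dist (x n) (y n) - dir_dist \<xi> \<eta>) \<longlonglongrightarrow> 0"
  proof (rule Lim_null_comparison)
    show "(\<lambda>n. dir_dist (x n) \<xi> + dir_dist (y n) \<eta>) \<longlonglongrightarrow> 0"
      using tendsto_add[OF assms(5,6)] by simp
    show "\<forall>\<^sub>F n in sequentially. norm (dir_dist (x n) (y n) - dir_dist \<xi> \<eta>) \<le> dir_dist (x n) \<xi> + dir_dist (y n) \<eta>"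
      using dir_dist_quad[OF assms(3,4,1,2)] by simp
  qed
  then show ?thesis by (simp add: LIM_zero_iff)
qed

text \<open>Both sequences follow geodesics up to an error \<open>d * l n\<close>, the angle of
  these geodesics differs by less than \<open>2 * d\<close> from that of the directions, and the
  cone distance is continuous in the angle.\<close>

lemma tang_dist:
  fixes p :: 'a
  assumes dirs: "\<xi> \<in> directions p" "\<eta> \<in> directions p" and ab: "0 \<le> a" "0 \<le> b"
    and l: "\<And>n. 0 < l n" "l \<longlonglongrightarrow> 0" and t: "tangent_along p \<xi> a l x" "tangent_along p \<eta> b l y"
  shows "(\<lambda>n. dist (x n) (y n) / l n) \<longlonglongrightarrow> sqrt (a\<^sup>2 + b\<^sup>2 - 2 * a * b * cos (dir_dist \<xi> \<eta>))"
proof (rule tendstoI)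
  fix e :: real assume e: "0 < e"
  define g where "g t = sqrt (a\<^sup>2 + b\<^sup>2 - 2 * a * b * cos t)" for t
  let ?\<alpha> = "dir_dist \<xi> \<eta>"
  have "isCont g ?\<alpha>" unfolding g_def[abs_def] by (intro continuous_intros)
  then obtain \<delta> where \<delta>: "0 < \<delta>" "\<And>t. dist t ?\<alpha> < \<delta> \<Longrightarrow> dist (g t) (g ?\<alpha>) < e / 4"
    unfolding continuous_at_eps_delta using e by (metis zero_less_divide_iff zero_less_numeral)
  define d where "d = min (\<delta> / 2) (e / 4)"
  have d: "0 < d" "2 * d \<le> \<delta>" "4 * d \<le> e" using \<delta> e by (auto simp: d_def)
  obtain \<tau> where \<tau>: "\<tau> \<in> geodesics_from p" "dir_dist (dir p \<tau>) \<xi> < d"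
    "\<forall>\<^sub>F n in sequentially. dist (x n) (\<tau> (a * l n)) \<le> d * l n"
    using t(1) d(1) unfolding tangent_along_def by blast
  obtain \<tau>' where \<tau>': "\<tau>' \<in> geodesics_from p" "dir_dist (dir p \<tau>') \<eta> < d"
    "\<forall>\<^sub>F n in sequentially. dist (y n) (\<tau>' (b * l n)) \<le> d * l n"
    using t(2) d(1) unfolding tangent_along_def by blast
  let ?\<theta> = "geodesic_angle \<tau> \<tau>'"
  have "dist ?\<theta> ?\<alpha> < \<delta>"
    using dir_dist_quad[OF dir_facts(1)[OF \<tau>(1)] dir_facts(1)[OF \<tau>'(1)] dirs] \<tau> \<tau>' d
    by (simp add: dist_real_def dir_facts(2))
  then have g: "dist (g ?\<theta>) (g ?\<alpha>) < e / 4" by (rule \<delta>(2))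
  have "(\<lambda>n. dist (\<tau> (a * l n)) (\<tau>' (b * l n)) / l n) \<longlonglongrightarrow> g ?\<theta>"
    unfolding g_def by (rule geodesic_dist_limit[OF \<tau>(1) \<tau>'(1) ab l])
  then have "\<forall>\<^sub>F n in sequentially. dist (dist (\<tau> (a * l n)) (\<tau>' (b * l n)) / l n) (g ?\<theta>) < e / 4"
    using e by (intro tendstoD) auto
  with \<tau>(3) \<tau>'(3)
  show "\<forall>\<^sub>F n in sequentially. dist (dist (x n) (y n) / l n) (sqrt (a\<^sup>2 + b\<^sup>2 - 2 * a * b * cos ?\<alpha>)) < e"
    unfolding g_def[symmetric]
  proof eventually_elim
    case (elim n)
    let ?u = "\<tau> (a * l n)" and ?v = "\<tau>' (b * l n)"
    have "\<bar>dist (x n) (y n) - dist ?u ?v\<bar> \<le> dist (x n) ?u + dist (y n) ?v"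
      using dist_triangle[of "x n" "y n" ?u] dist_triangle[of ?u "y n" ?v]
        dist_triangle[of ?u ?v "x n"] dist_triangle[of "x n" ?v "y n"]
      by (auto simp: dist_commute abs_le_iff)
    also have "\<dots> \<le> e / 2 * l n"
    proof -
      have "4 * (d * l n) \<le> e * l n" using mult_right_mono[OF d(3), of "l n"] l(1)[of n] by (simp add: mult.assoc)
      then show ?thesis using elim(1,2) by simp
    qed
    finally have "\<bar>dist (x n) (y n) / l n - dist ?u ?v / l n\<bar> \<le> e / 2"
      using l(1)[of n] by (simp add: diff_divide_distrib[symmetric] abs_divide pos_divide_le_eq)
    then show ?case using elim(3) g e unfolding dist_real_def by linarith
  qed
qed

lemma tang_geodesic:
  fixes p :: 'a
  assumes "\<gamma> \<in> geodesics_from p" "\<And>n. 0 < l n"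
  shows "tangent_along p (dir p \<gamma>) a l (\<lambda>n. \<gamma> (a * l n))"
  unfolding tangent_along_def
  using assms dir_facts(7)[OF dir_facts(1)[OF assms(1)]]
  by (auto intro!: bexI[of _ \<gamma>] always_eventually mult_nonneg_nonneg less_imp_le)

text \<open>For \<open>a = 0\<close> the limit point is the apex of the cone, which lies on every
  ray.\<close>

lemma tang_zero:
  fixes p :: 'a
  assumes "\<xi> \<in> directions p" "\<And>n. 0 < l n" "(\<lambda>n. dist p (x n) / l n) \<longlonglongrightarrow> 0"
  shows "tangent_along p \<xi> 0 l x"
  unfolding tangent_along_def
proof (intro allI impI)
  fix e :: real assume e: "0 < e"
  obtain \<tau> where \<tau>: "\<tau> \<in> geodesics_from p" "dir_dist (dir p \<tau>) \<xi> < e" by (rule dir_dense[OF assms(1) e])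
  have "\<tau> 0 = p" using \<tau>(1) by (auto simp: geodesics_from_iff is_geo_def)
  moreover have "\<forall>\<^sub>F n in sequentially. dist p (x n) / l n < e"
    by (rule order_tendstoD(2)[OF assms(3) e])
  ultimately have "\<forall>\<^sub>F n in sequentially. dist (x n) (\<tau> (0 * l n)) \<le> e * l n"
    using assms(2) by (auto elim!: eventually_mono simp: pos_divide_less_eq dist_commute intro: less_imp_le)
  with \<tau> show "\<exists>\<tau>\<in>geodesics_from p. dir_dist (dir p \<tau>) \<xi> < e \<and>
      (\<forall>\<^sub>F n in sequentially. dist (x n) (\<tau> (0 * l n)) \<le> e * l n)" by blast
qed

text \<open>The geodesics to \<open>x n\<close> vary with \<open>n\<close>, whereas the points have
  to be compared with one fixed \<open>\<tau>\<close>. Hinge comparison does this at the common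
  parameter \<open>s n\<close>, and a slide along \<open>\<tau>\<close> moves the parameter to
  \<open>a * l n\<close>.\<close>

lemma tang_of_points:
  fixes p :: 'a
  assumes \<xi>: "\<xi> \<in> directions p" and l: "\<And>n. 0 < l n" "l \<longlonglongrightarrow> 0" and a: "0 \<le> a"
    and x: "\<And>n. x n \<noteq> p" "\<And>n. min_geodesic (g n) p (x n)" "(\<lambda>n. dir_dist (dir p (g n)) \<xi>) \<longlonglongrightarrow> 0"
    and lim: "(\<lambda>n. dist p (x n) / l n) \<longlonglongrightarrow> a"
  shows "tangent_along p \<xi> a l x"
  unfolding tangent_along_def
proof (intro allI impI)
  fix e :: real assume e: "0 < e"
  \<comment> \<open>Eventually \<open>s n \<le> (a + 1) * l n\<close>; the hinge contributes
    \<open>3 * d\<close> times that, the slide \<open>d * l n\<close>.\<close>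
  define d where "d = e / (3 * (a + 1) + 1)"
  have den: "0 < 3 * (a + 1) + 1" "1 \<le> 3 * (a + 1) + 1" using a by auto
  have d: "0 < d" "d \<le> e" "d * (3 * (a + 1) + 1) = e"
    using e den by (auto simp: d_def divide_le_eq mult_le_cancel_left1)
  obtain \<tau> where \<tau>: "\<tau> \<in> geodesics_from p" "dir_dist (dir p \<tau>) \<xi> < d" by (rule dir_dense[OF \<xi> d(1)])
  define s where "s n = dist p (x n)" for n
  have gg: "is_geo (g n) p (s n)" for n unfolding s_def using is_geo_of_min_geodesic x(1,2) by metis
  have gx: "g n (s n) = x n" for n using x(2)[of n] by (simp add: min_geodesic_def s_def)
  have g: "g n \<in> geodesics_from p" for n using gg geodesics_from_iff by blast
  have s0: "0 < s n" for n using x(1)[of n] by (simp add: s_def)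
  have slim: "s \<longlonglongrightarrow> 0"
  proof -
    have "(\<lambda>n. (s n / l n) * l n) \<longlonglongrightarrow> a * 0" unfolding s_def by (intro tendsto_intros lim l)
    moreover have "(s n / l n) * l n = s n" for n using l(1)[of n] by simp
    ultimately show ?thesis by simp
  qed
  obtain r where r: "r > 0" "four_point c (ball p r)" using fp by blast
  obtain L where L: "is_geo \<tau> p L" "L < r" by (rule geo_short[OF \<tau>(1) r(1)])
  have L0: "0 < L" using L by (simp add: is_geo_def)
  obtain r' where r': "0 < r'" "4 * ((cosh (c * r'))\<^sup>2 - 1) \<le> d\<^sup>2" using small_cosh[of "d\<^sup>2" c] d by auto
  have "\<forall>\<^sub>F n in sequentially. dist (s n / l n) a < d" using tendstoD[OF lim d(1)] by (simp add: s_def)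
  moreover have "\<forall>\<^sub>F n in sequentially. s n / l n < a + 1"
    using order_tendstoD(2)[OF lim, of "a + 1"] by (simp add: s_def)
  moreover have "\<forall>\<^sub>F n in sequentially. s n < min r (min L r')"
    using order_tendstoD(2)[OF slim, of "min r (min L r')"] r L0 r' by simp
  moreover have "\<forall>\<^sub>F n in sequentially. dir_dist (dir p (g n)) \<xi> < d" by (rule order_tendstoD(2)[OF x(3) d(1)])
  moreover have "\<forall>\<^sub>F n in sequentially. a * l n < L"
    using order_tendstoD(2)[OF tendsto_mult_left[OF l(2), of a], of L] L0 by simp
  ultimately have "\<forall>\<^sub>F n in sequentially. dist (x n) (\<tau> (a * l n)) \<le> e * l n"
  proof eventually_elim
    case (elim n)
    have al: "\<bar>s n - a * l n\<bar> \<le> d * l n"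
    proof -
      have "\<bar>s n / l n - a\<bar> * l n \<le> d * l n"
        using elim(1) l(1)[of n] by (intro mult_right_mono) (auto simp: dist_real_def)
      moreover have "\<bar>s n / l n - a\<bar> * l n = \<bar>s n - a * l n\<bar>"
      proof -
        have "\<bar>s n / l n - a\<bar> * l n = \<bar>(s n / l n - a) * l n\<bar>" using l(1)[of n] by (simp add: abs_mult)
        also have "(s n / l n - a) * l n = s n - a * l n" using l(1)[of n] by (simp add: left_diff_distrib)
        finally show ?thesis .
      qed
      ultimately show ?thesis by simp
    qed
    have sl: "s n \<le> (a + 1) * l n" using elim(2) l(1)[of n] by (simp add: pos_divide_less_eq)
    let ?\<theta> = "geodesic_angle (g n) \<tau>"
    have th: "0 \<le> ?\<theta>" "?\<theta> \<le> 2 * d"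
    proof -
      show "0 \<le> ?\<theta>" by (rule angle_props(1)[OF g \<tau>(1)])
      have "?\<theta> = dir_dist (dir p (g n)) (dir p \<tau>)" by (rule dir_facts(2)[OF g \<tau>(1), symmetric])
      also have "\<dots> \<le> dir_dist (dir p (g n)) \<xi> + dir_dist \<xi> (dir p \<tau>)"
        by (rule dir_facts(6)[OF dir_facts(1)[OF g] \<xi> dir_facts(1)[OF \<tau>(1)]])
      also have "dir_dist \<xi> (dir p \<tau>) = dir_dist (dir p \<tau>) \<xi>"
        by (rule dir_facts(5)[OF \<xi> dir_facts(1)[OF \<tau>(1)]])
      finally show "?\<theta> \<le> 2 * d" using elim(4) \<tau>(2) by simp
    qed
    have "(dist (g n (s n)) (\<tau> (s n)))\<^sup>2 \<le> (s n)\<^sup>2 + (s n)\<^sup>2 - 2 * s n * s n * cos ?\<theta> + d\<^sup>2 * s n * s n"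
      using elim(3) s0[of n] L
      by (intro hinge[OF r(2) c_pos gg L(1) geo_image[OF gg] geo_image[OF L(1,2)] _ _ _ _ _ _ r'(2)]) auto
    also have "\<dots> = (s n)\<^sup>2 * (2 * (1 - cos ?\<theta>) + d\<^sup>2)" by (simp add: power2_eq_square algebra_simps)
    \<comment> \<open>The cosine term is at most \<open>(2 * d)^2\<close> and the hinge error is
      \<open>d^2\<close>; the sum stays below \<open>(3 * d)^2\<close>.\<close>
    also have "\<dots> \<le> (s n)\<^sup>2 * (3 * d)\<^sup>2"
    proof (rule mult_left_mono)
      have "?\<theta>\<^sup>2 \<le> (2 * d)\<^sup>2" using th by (intro power_mono) auto
      then have "?\<theta>\<^sup>2 \<le> 4 * d\<^sup>2" by (simp add: power_mult_distrib)
      moreover have "(3 * d)\<^sup>2 = 9 * d\<^sup>2" by (simp add: power_mult_distrib)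
      ultimately show "2 * (1 - cos ?\<theta>) + d\<^sup>2 \<le> (3 * d)\<^sup>2"
        using one_minus_cos_le[of ?\<theta>] zero_le_power2[of d] by linarith
    qed simp
    also have "\<dots> = (s n * (3 * d))\<^sup>2" by (simp add: power_mult_distrib)
    finally have "dist (g n (s n)) (\<tau> (s n)) \<le> s n * (3 * d)"
      using s0[of n] d by (auto intro: power2_le_imp_le)
    then have 1: "dist (x n) (\<tau> (s n)) \<le> (a + 1) * l n * (3 * d)"
      unfolding gx using mult_right_mono[OF sl, of "3 * d"] d by linarith
    have "dist (\<tau> (s n)) (\<tau> (a * l n)) = \<bar>s n - a * l n\<bar>"
      using elim(3,5) s0[of n] a l(1)[of n] by (intro is_geo_dist2[OF L(1)]) auto
    then have "dist (x n) (\<tau> (a * l n)) \<le> (a + 1) * l n * (3 * d) + d * l n"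
      using 1 al dist_triangle[of "x n" "\<tau> (a * l n)" "\<tau> (s n)"] by linarith
    also have "\<dots> = (d * (3 * (a + 1) + 1)) * l n" by (simp add: algebra_simps)
    finally show ?case unfolding d(3) .
  qed
  with \<tau> d show "\<exists>\<tau>\<in>geodesics_from p. dir_dist (dir p \<tau>) \<xi> < e \<and>
      (\<forall>\<^sub>F n in sequentially. dist (x n) (\<tau> (a * l n)) \<le> e * l n)" by (intro bexI[of _ \<tau>]) auto
qed

end

section \<open>Extremality from the cosine condition\<close>

text \<open>The function \<open>(M^2 + a^2 - 2 * M * a * k) / M^2\<close> has its minimum at
  \<open>M = 1\<close>, where its derivative is \<open>2 * a * (k - a)\<close>.\<close>

lemma quadratic_touching:
  fixes a k :: real
  assumes f: "\<And>M. 0 < M \<Longrightarrow> M\<^sup>2 * (1 + a\<^sup>2 - 2 * a * k) \<le> M\<^sup>2 + a\<^sup>2 - 2 * M * a * k" and a: "0 < a"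
  shows "a = k"
proof (rule ccontr)
  assume "a \<noteq> k"
  define K where "K = 2 * a * k - a\<^sup>2"
  have ne: "K \<noteq> a\<^sup>2" using \<open>a \<noteq> k\<close> a by (simp add: K_def power2_eq_square)
  have f': "0 \<le> \<delta> * (K - a\<^sup>2 + K * \<delta>)" if "-1 < \<delta>" for \<delta>
    using f[of "1 + \<delta>"] that by (simp add: K_def power2_eq_square algebra_simps)
  \<comment> \<open>The sign of \<open>\<delta>\<close> makes the linear term in \<open>f'\<close>
    negative; the denominator keeps \<open>\<delta>\<close> above \<open>-1\<close> and the
    quadratic term at most half as large as the linear one.\<close>
  define \<delta> where "\<delta> = (a\<^sup>2 - K) / (2 * (\<bar>K\<bar> + 1))"
  have den: "0 < 2 * (\<bar>K\<bar> + 1)" by simp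
  have "- (2 * (\<bar>K\<bar> + 1)) < a\<^sup>2 - K" using zero_le_power2[of a] abs_ge_self[of K] abs_ge_zero[of K] by (smt (verit))
  then have "-1 < \<delta>" using den unfolding \<delta>_def by (subst pos_less_divide_eq) auto
  from f'[OF this] have "0 \<le> \<delta> * (K - a\<^sup>2 + K * \<delta>)" .
  also have "\<dots> = (a\<^sup>2 - K) * (a\<^sup>2 - K) * (K - 2 * (\<bar>K\<bar> + 1)) / (2 * (\<bar>K\<bar> + 1))\<^sup>2"
    using den unfolding \<delta>_def by (simp add: divide_simps power2_eq_square) (simp add: algebra_simps)
  also have "\<dots> < 0"
  proof -
    have "0 < (a\<^sup>2 - K) * (a\<^sup>2 - K)" using ne by (simp add: zero_less_mult_iff not_less) linarith
    moreover have "K - 2 * (\<bar>K\<bar> + 1) < 0" using abs_ge_self[of K] abs_ge_zero[of K] by (smt (verit))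
    moreover have "0 < (2 * (\<bar>K\<bar> + 1))\<^sup>2" using den by simp
    ultimately show ?thesis by (intro divide_neg_pos mult_pos_neg)
  qed
  finally show False by simp
qed

context alexandrov
begin

lemma directions_of_subset: "\<xi> \<in> directions_of (p::'a) F \<Longrightarrow> \<xi> \<in> directions p"
  by (simp add: directions_of_def)

lemma directions_ofE:
  assumes "\<xi> \<in> directions_of (p::'a) F"
  obtains x g where "\<And>n. x n \<in> F" "\<And>n. x n \<noteq> p" "\<And>n. min_geodesic (g n) p (x n)" "x \<longlonglongrightarrow> p"
    "(\<lambda>n. dir_dist (dir p (g n)) \<xi>) \<longlonglongrightarrow> 0"
proof -
  obtain x \<theta> where x: "\<forall>i :: nat. x i \<in> F - {p} \<and> \<theta> i \<in> dirs_to p (x i)" "x \<longlonglongrightarrow> p"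
    "(\<lambda>i. dir_dist (\<theta> i) \<xi>) \<longlonglongrightarrow> 0"
    using assms unfolding directions_of_def by blast
  have "\<forall>i. \<exists>g. \<theta> i = dir p g \<and> min_geodesic g p (x i)" using x(1) unfolding dirs_to_def by blast
  then obtain g where g: "\<And>i. \<theta> i = dir p (g i)" "\<And>i. min_geodesic (g i) p (x i)" by metis
  show ?thesis by (rule that[of x g]) (use x g in auto)
qed

lemma directions_ofI:
  assumes "\<xi> \<in> directions (p::'a)" "\<And>n. x n \<in> F" "\<And>n. x n \<noteq> p" "\<And>n. min_geodesic (g n) p (x n)" "x \<longlonglongrightarrow> p"
    "(\<lambda>n. dir_dist (dir p (g n)) \<xi>) \<longlonglongrightarrow> 0"
  shows "\<xi> \<in> directions_of p F"
  unfolding directions_of_def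
  using assms by (auto simp: dirs_to_def intro!: exI[of _ x] exI[of _ "\<lambda>n. dir p (g n)"])

lemma geodesics_from_min: "min_geodesic g (p::'a) x \<Longrightarrow> x \<noteq> p \<Longrightarrow> g \<in> geodesics_from p"
  by (auto simp: geodesics_from_def)

lemma inverse_Suc_lim: "(\<lambda>n. inverse (real (Suc n))) \<longlonglongrightarrow> 0" "0 < inverse (real (Suc n))"
  using LIMSEQ_inverse_real_of_nat by auto

text \<open>The directions of \<open>F\<close> at \<open>p\<close> form a compact set: a diagonal
  choice takes points of \<open>F\<close> near \<open>p\<close> with directions within
  \<open>1 / (n + 1)\<close> of \<open>\<xi> n\<close>, and a limit of such directions is again one
  of \<open>F\<close>.\<close>

lemma directions_of_limit:
  assumes \<xi>: "\<And>n. \<xi> n \<in> directions_of (p::'a) F"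
  obtains r \<xi>0 where "strict_mono (r :: nat \<Rightarrow> nat)" "\<xi>0 \<in> directions_of p F" "(\<lambda>n. dir_dist (\<xi> (r n)) \<xi>0) \<longlonglongrightarrow> 0"
proof -
  have "\<exists>y h. y \<in> F \<and> y \<noteq> p \<and> min_geodesic h p y \<and> dist y p < inverse (real (Suc n)) \<and>
      dir_dist (dir p h) (\<xi> n) < inverse (real (Suc n))" for n
  proof -
    obtain x g where x: "\<And>n. x n \<in> F" "\<And>n. x n \<noteq> p" "\<And>n. min_geodesic (g n) p (x n)" "x \<longlonglongrightarrow> p"
      "(\<lambda>m. dir_dist (dir p (g m)) (\<xi> n)) \<longlonglongrightarrow> 0" by (rule directions_ofE[OF \<xi>[of n]]) blast
    have "\<forall>\<^sub>F m in sequentially. dist (x m) p < inverse (real (Suc n)) \<and> dir_dist (dir p (g m)) (\<xi> n) < inverse (real (Suc n))"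
      using tendstoD[OF x(4) inverse_Suc_lim(2)] order_tendstoD(2)[OF x(5) inverse_Suc_lim(2)]
      by (rule eventually_conj)
    from eventually_happens'[OF sequentially_bot this]
    obtain m where m: "dist (x m) p < inverse (real (Suc n))" "dir_dist (dir p (g m)) (\<xi> n) < inverse (real (Suc n))"
      by blast
    show ?thesis by (rule exI[of _ "x m"], rule exI[of _ "g m"]) (intro conjI x m)
  qed
  then obtain y h where y: "\<And>n. y n \<in> F" "\<And>n. y n \<noteq> p" "\<And>n. min_geodesic (h n) p (y n)"
    "\<And>n. dist (y n) p < inverse (real (Suc n))" "\<And>n. dir_dist (dir p (h n)) (\<xi> n) < inverse (real (Suc n))"
    by metis
  have h: "h n \<in> geodesics_from p" for n using geodesics_from_min y(2,3) by blast
  obtain r \<xi>0 where r: "strict_mono (r :: nat \<Rightarrow> nat)" "\<xi>0 \<in> directions p" "(\<lambda>n. dir_dist (dir p (h (r n))) \<xi>0) \<longlonglongrightarrow> 0"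
    by (rule directions_subseq[of h p, OF h])
  have yp: "y \<longlonglongrightarrow> p"
  proof (rule metric_tendsto_imp_tendsto[OF inverse_Suc_lim(1)])
    show "\<forall>\<^sub>F n in sequentially. dist (y n) p \<le> dist (inverse (real (Suc n))) 0"
      using y(4) by (auto intro!: always_eventually less_imp_le simp: dist_real_def simp del: of_nat_Suc)
  qed
  have 1: "\<xi>0 \<in> directions_of p F"
    by (rule directions_ofI[OF r(2), of "\<lambda>n. y (r n)" F "\<lambda>n. h (r n)"])
       (use y r LIMSEQ_subseq_LIMSEQ[OF yp r(1)] in \<open>auto simp: o_def\<close>)
  have d: "dir p (h n) \<in> directions p" "\<xi> n \<in> directions p" for n
    using dir_facts(1)[OF h] directions_of_subset[OF \<xi>] by auto
  have il: "(\<lambda>n. inverse (real (Suc (r n)))) \<longlonglongrightarrow> 0"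
    using LIMSEQ_subseq_LIMSEQ[OF inverse_Suc_lim(1) r(1)] by (simp add: o_def)
  have 2: "(\<lambda>n. dir_dist (\<xi> (r n)) \<xi>0) \<longlonglongrightarrow> 0"
  proof (rule tendsto_sandwich[OF _ _ tendsto_const])
    show "\<forall>\<^sub>F n in sequentially. 0 \<le> dir_dist (\<xi> (r n)) \<xi>0"
      by (intro always_eventually allI dir_facts(3)[OF d(2) r(2)])
    show "\<forall>\<^sub>F n in sequentially. dir_dist (\<xi> (r n)) \<xi>0 \<le> inverse (real (Suc (r n))) + dir_dist (dir p (h (r n))) \<xi>0"
    proof (intro always_eventually allI)
      fix n
      show "dir_dist (\<xi> (r n)) \<xi>0 \<le> inverse (real (Suc (r n))) + dir_dist (dir p (h (r n))) \<xi>0"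
        using dir_facts(6)[OF d(2)[of "r n"] d(1)[of "r n"] r(2)] dir_facts(5)[OF d(2)[of "r n"] d(1)[of "r n"]] y(5)[of "r n"]
        by linarith
    qed
    show "(\<lambda>n. inverse (real (Suc (r n))) + dir_dist (dir p (h (r n))) \<xi>0) \<longlonglongrightarrow> 0"
      using tendsto_add[OF il r(3)] by simp
  qed
  show ?thesis by (rule that[OF r(1) 1 2])
qed

text \<open>Hypothesis \<open>m\<close> says that in the cone no \<open>M\<eta>\<close> is nearer to
  \<open>\<xi>\<close> than to the apex. If \<open>k = cos |\<eta>\<xi>|\<close> were positive,
  \<open>M = 1 / k\<close> would violate this, the squared distance to \<open>\<xi>\<close> being
  \<open>M^2 - 1\<close>. The error \<open>e\<close> is there because one application has only a
  lower limit to offer.\<close>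

lemma cos_nonpos_of_minimizing:
  fixes p :: 'a
  assumes \<gamma>: "\<gamma> \<in> geodesics_from p" and \<xi>: "\<xi> \<in> directions p" and l: "\<And>n. 0 < l n" "l \<longlonglongrightarrow> 0"
    and t: "tangent_along p \<xi> 1 l x"
    and m: "\<And>M e. 0 < M \<Longrightarrow> 0 < e \<Longrightarrow> \<forall>\<^sub>F n in sequentially. (1 - e) * (M * l n) \<le> dist (\<gamma> (M * l n)) (x n)"
  shows "cos (dir_dist (dir p \<gamma>) \<xi>) \<le> 0"
proof (rule ccontr)
  define k where "k = cos (dir_dist (dir p \<gamma>) \<xi>)"
  assume "\<not> cos (dir_dist (dir p \<gamma>) \<xi>) \<le> 0"
  then have k: "0 < k" by (simp add: k_def)
  define M where "M = 1 / k"
  have M: "0 < M" "M * k = 1" using k by (auto simp: M_def)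
  have lim: "(\<lambda>n. dist (\<gamma> (M * l n)) (x n) / l n) \<longlonglongrightarrow> sqrt (M\<^sup>2 + 1\<^sup>2 - 2 * M * 1 * k)"
    unfolding k_def using M
    by (intro tang_dist[OF dir_facts(1)[OF \<gamma>] \<xi> _ _ l tang_geodesic[OF \<gamma> l(1)] t]) auto
  have le: "(1 - e) * M \<le> sqrt (M\<^sup>2 + 1\<^sup>2 - 2 * M * 1 * k)" if e: "0 < e" for e
  proof (rule tendsto_lowerbound[OF lim _ sequentially_bot])
    show "\<forall>\<^sub>F n in sequentially. (1 - e) * M \<le> dist (\<gamma> (M * l n)) (x n) / l n"
      using m[OF M(1) e] by (rule eventually_mono) (use l(1) in \<open>simp add: pos_le_divide_eq mult.assoc\<close>)
  qed
  have "M \<le> sqrt (M\<^sup>2 + 1\<^sup>2 - 2 * M * 1 * k)"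
  proof (rule field_le_epsilon)
    fix e :: real assume "0 < e"
    then have "(1 - e / M) * M \<le> sqrt (M\<^sup>2 + 1\<^sup>2 - 2 * M * 1 * k)" using M by (intro le) auto
    moreover have "(1 - e / M) * M = M - e" using M by (simp add: field_simps)
    ultimately show "M \<le> sqrt (M\<^sup>2 + 1\<^sup>2 - 2 * M * 1 * k) + e" by simp
  qed
  also have "sqrt (M\<^sup>2 + 1\<^sup>2 - 2 * M * 1 * k) = sqrt (M\<^sup>2 - 1)" using M(2) by simp
  also have "\<dots> < sqrt (M\<^sup>2)" by (rule real_sqrt_less_mono) simp
  also have "\<dots> = M" using M by simp
  finally show False by simp
qed

definition cos_condition :: "'a \<Rightarrow> 'a set \<Rightarrow> 'a direction \<Rightarrow> 'a direction \<Rightarrow> bool" where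
  "cos_condition p F \<eta> \<zeta> \<longleftrightarrow>
    (if directions_of p F = {} then cos (dir_dist \<eta> \<zeta>) \<ge> 0
     else \<exists>\<xi> \<in> directions_of p F. dir_dist \<eta> \<xi> \<le> pi / 2 \<and>
              cos (dir_dist \<eta> \<zeta>) \<ge> cos (dir_dist \<eta> \<xi>) * cos (dir_dist \<zeta> \<xi>))"

lemma dirs_to_subset: "r \<noteq> (p::'a) \<Longrightarrow> dirs_to p r \<subseteq> directions p"
  unfolding dirs_to_def using dir_facts(1) geodesics_from_min by blast

lemma dir_setdist_bdd:
  assumes "q \<noteq> (p::'a)" "r \<noteq> p"
  shows "bdd_below {dir_dist \<xi> \<eta> |\<xi> \<eta>. \<xi> \<in> dirs_to p q \<and> \<eta> \<in> dirs_to p r}"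
  by (rule bdd_belowI[of _ 0]) (use dirs_to_subset[OF assms(1)] dirs_to_subset[OF assms(2)] dir_facts(3) in blast)

lemma extremal_of_cos_condition:
  assumes F: "closed (F :: 'a set)"
    and cond: "\<And>p \<eta> \<zeta>. p \<in> F \<Longrightarrow> \<eta> \<in> directions p \<Longrightarrow> \<zeta> \<in> directions p \<Longrightarrow> cos_condition p F \<eta> \<zeta>"
  shows "extremal F"
  unfolding extremal_def
proof (intro conjI F allI impI ballI)
  fix q p r assume q: "q \<notin> F" and p: "p \<in> F" and min: "\<forall>x\<in>F. dist q p \<le> dist q x" and r: "r \<noteq> p"
  have pq: "q \<noteq> p" using p q by auto
  obtain \<gamma> \<sigma> where g: "min_geodesic \<gamma> p q" "min_geodesic \<sigma> p r" using geo by metis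
  have gf: "\<gamma> \<in> geodesics_from p" "\<sigma> \<in> geodesics_from p" using geodesics_from_min g pq r by blast+
  let ?\<eta> = "dir p \<gamma>" and ?\<zeta> = "dir p \<sigma>"
  have d: "?\<eta> \<in> directions p" "?\<zeta> \<in> directions p" using dir_facts(1) gf by auto
  have "0 \<le> cos (dir_dist ?\<eta> ?\<zeta>)"
  proof (cases "directions_of p F = {}")
    case True
    then show ?thesis using cond[OF p d] by (simp add: cos_condition_def)
  next
    case False
    then obtain \<xi> where \<xi>: "\<xi> \<in> directions_of p F" "dir_dist ?\<eta> \<xi> \<le> pi / 2"
      "cos (dir_dist ?\<eta> ?\<zeta>) \<ge> cos (dir_dist ?\<eta> \<xi>) * cos (dir_dist ?\<zeta> \<xi>)"
      using cond[OF p d] by (auto simp: cos_condition_def)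
    have \<xi>d: "\<xi> \<in> directions p" by (rule directions_of_subset[OF \<xi>(1)])
    obtain x h where x: "\<And>n. x n \<in> F" "\<And>n. x n \<noteq> p" "\<And>n. min_geodesic (h n) p (x n)" "x \<longlonglongrightarrow> p"
      "(\<lambda>n. dir_dist (dir p (h n)) \<xi>) \<longlonglongrightarrow> 0" by (rule directions_ofE[OF \<xi>(1)]) blast
    define l where "l n = dist p (x n)" for n
    have l0: "0 < l n" for n using x(2)[of n] by (simp add: l_def)
    have ll: "l \<longlonglongrightarrow> 0" unfolding l_def using tendsto_dist[OF tendsto_const x(4), of p] by simp
    have one: "(\<lambda>n. dist p (x n) / l n) \<longlonglongrightarrow> 1" using l0 by (simp add: l_def)
    have "cos (dir_dist ?\<eta> \<xi>) \<le> 0"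
    proof (rule cos_nonpos_of_minimizing[OF gf(1) \<xi>d l0 ll])
      show "tangent_along p \<xi> 1 l x" by (rule tang_of_points[OF \<xi>d l0 ll _ x(2,3,5) one]) simp
      fix M e :: real assume M: "0 < M" "0 < e"
      have gp: "is_geo \<gamma> p (dist p q)" using is_geo_of_min_geodesic[OF g(1)] pq by auto
      have gq: "\<gamma> (dist p q) = q" using g(1) by (simp add: min_geodesic_def)
      have "\<forall>\<^sub>F n in sequentially. M * l n < dist p q"
        using order_tendstoD(2)[OF tendsto_mult_left[OF ll, of M], of "dist p q"] pq by simp
      then show "\<forall>\<^sub>F n in sequentially. (1 - e) * (M * l n) \<le> dist (\<gamma> (M * l n)) (x n)"
      proof eventually_elim
        case (elim n)
        have Ml: "0 \<le> M * l n" using M l0[of n] by simp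
        \<comment> \<open>Since \<open>\<gamma>\<close> leads to \<open>q\<close>, the point
          \<open>p\<close> is nearest in \<open>F\<close> not only to \<open>q\<close> but to every
          point of \<open>\<gamma>\<close>.\<close>
        have "dist q (\<gamma> (M * l n)) = dist p q - M * l n"
          using is_geo_dist2[OF gp, of "dist p q" "M * l n"] elim Ml by (simp add: gq)
        moreover have "dist p q \<le> dist q (x n)" using min[rule_format, OF x(1)[of n]] dist_commute[of p q] by simp
        ultimately have "M * l n \<le> dist (\<gamma> (M * l n)) (x n)"
          using dist_triangle[of q "x n" "\<gamma> (M * l n)"] by linarith
        moreover have "(1 - e) * (M * l n) \<le> 1 * (M * l n)" using M Ml by (intro mult_right_mono) auto
        ultimately show ?case by simp
      qed
    qed
    moreover have "0 \<le> cos (dir_dist ?\<eta> \<xi>)"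
      using \<xi>(2) dir_facts(3)[OF d(1) \<xi>d] by (intro cos_ge_zero) auto
    ultimately have "cos (dir_dist ?\<eta> \<xi>) = 0" by simp
    then show ?thesis using \<xi>(3) by simp
  qed
  then have "dir_dist ?\<eta> ?\<zeta> \<le> pi / 2" using dir_facts(4)[OF d] by (intro acute_of_cos_nonneg)
  moreover have "dir_setdist (dirs_to p q) (dirs_to p r) \<le> dir_dist ?\<eta> ?\<zeta>"
    unfolding dir_setdist_def
    by (rule cInf_lower[OF _ dir_setdist_bdd[OF pq r]]) (use g in \<open>auto simp: dirs_to_def\<close>)
  ultimately show "dir_setdist (dirs_to p q) (dirs_to p r) \<le> pi / 2" by simp
qed

text \<open>The approximating geodesics come with varying \<open>\<xi> n\<close>, for which
  \<open>directions_of_limit\<close> supplies a limit in \<open>directions_of p F\<close>. Emptiness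
  of this set does not depend on \<open>n\<close>, so the two cases do not mix.\<close>

lemma cos_condition_of_dense:
  fixes p :: 'a
  assumes geo_cond: "\<And>\<gamma> \<sigma>. \<gamma> \<in> geodesics_from p \<Longrightarrow> \<sigma> \<in> geodesics_from p \<Longrightarrow> cos_condition p F (dir p \<gamma>) (dir p \<sigma>)"
    and d: "\<eta> \<in> directions p" "\<zeta> \<in> directions p"
  shows "cos_condition p F \<eta> \<zeta>"
proof -
  have "\<exists>\<gamma>\<in>geodesics_from p. dir_dist (dir p \<gamma>) \<xi> < inverse (real (Suc n))" if "\<xi> \<in> directions p" for \<xi> n
    by (rule dir_dense[OF that inverse_Suc_lim(2)]) blast
  then obtain \<gamma> \<sigma> where g: "\<And>n. \<gamma> n \<in> geodesics_from p" "\<And>n. dir_dist (dir p (\<gamma> n)) \<eta> < inverse (real (Suc n))"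
    "\<And>n. \<sigma> n \<in> geodesics_from p" "\<And>n. dir_dist (dir p (\<sigma> n)) \<zeta> < inverse (real (Suc n))"
    using d by metis
  have dd: "dir p (\<gamma> n) \<in> directions p" "dir p (\<sigma> n) \<in> directions p" for n using dir_facts(1) g by auto
  have lim: "(\<lambda>n. dir_dist (dir p (\<gamma> n)) \<eta>) \<longlonglongrightarrow> 0" "(\<lambda>n. dir_dist (dir p (\<sigma> n)) \<zeta>) \<longlonglongrightarrow> 0"
  proof -
    show "(\<lambda>n. dir_dist (dir p (\<gamma> n)) \<eta>) \<longlonglongrightarrow> 0"
      by (rule tendsto_sandwich[OF _ _ tendsto_const inverse_Suc_lim(1)])
         (use dir_facts(3)[OF dd(1) d(1)] g(2) in \<open>auto intro!: always_eventually less_imp_le simp del: of_nat_Suc\<close>)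
    show "(\<lambda>n. dir_dist (dir p (\<sigma> n)) \<zeta>) \<longlonglongrightarrow> 0"
      by (rule tendsto_sandwich[OF _ _ tendsto_const inverse_Suc_lim(1)])
         (use dir_facts(3)[OF dd(2) d(2)] g(4) in \<open>auto intro!: always_eventually less_imp_le simp del: of_nat_Suc\<close>)
  qed
  have c: "cos_condition p F (dir p (\<gamma> n)) (dir p (\<sigma> n))" for n by (rule geo_cond[OF g(1,3)])
  have main: "(\<lambda>n. cos (dir_dist (dir p (\<gamma> n)) (dir p (\<sigma> n)))) \<longlonglongrightarrow> cos (dir_dist \<eta> \<zeta>)"
    by (rule tendsto_cos[OF dir_dist_tendsto[OF d dd lim]])
  show ?thesis
  proof (cases "directions_of p F = {}")
    case True
    then have "0 \<le> cos (dir_dist \<eta> \<zeta>)"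
      using c by (intro LIMSEQ_le_const[OF main]) (auto simp: cos_condition_def)
    with True show ?thesis by (simp add: cos_condition_def)
  next
    case False
    then have "\<forall>n. \<exists>\<xi> \<in> directions_of p F. dir_dist (dir p (\<gamma> n)) \<xi> \<le> pi / 2 \<and>
        cos (dir_dist (dir p (\<gamma> n)) \<xi>) * cos (dir_dist (dir p (\<sigma> n)) \<xi>) \<le> cos (dir_dist (dir p (\<gamma> n)) (dir p (\<sigma> n)))"
      using c by (simp add: cos_condition_def)
    then obtain \<xi> where \<xi>: "\<And>n. \<xi> n \<in> directions_of p F" "\<And>n. dir_dist (dir p (\<gamma> n)) (\<xi> n) \<le> pi / 2"
      "\<And>n. cos (dir_dist (dir p (\<gamma> n)) (\<xi> n)) * cos (dir_dist (dir p (\<sigma> n)) (\<xi> n)) \<le> cos (dir_dist (dir p (\<gamma> n)) (dir p (\<sigma> n)))"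
      by metis
    obtain r \<xi>0 where r: "strict_mono (r :: nat \<Rightarrow> nat)" "\<xi>0 \<in> directions_of p F" "(\<lambda>n. dir_dist (\<xi> (r n)) \<xi>0) \<longlonglongrightarrow> 0"
      by (rule directions_of_limit[of \<xi> p F, OF \<xi>(1)])
    have \<xi>d: "\<xi>0 \<in> directions p" "\<And>n. \<xi> n \<in> directions p" using directions_of_subset r(2) \<xi>(1) by auto
    have limr: "(\<lambda>n. dir_dist (dir p (\<gamma> (r n))) \<eta>) \<longlonglongrightarrow> 0" "(\<lambda>n. dir_dist (dir p (\<sigma> (r n))) \<zeta>) \<longlonglongrightarrow> 0"
      using LIMSEQ_subseq_LIMSEQ[OF lim(1) r(1)] LIMSEQ_subseq_LIMSEQ[OF lim(2) r(1)] by (simp_all add: o_def)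
    have 1: "(\<lambda>n. dir_dist (dir p (\<gamma> (r n))) (\<xi> (r n))) \<longlonglongrightarrow> dir_dist \<eta> \<xi>0"
      by (rule dir_dist_tendsto[OF d(1) \<xi>d(1) dd(1) \<xi>d(2) limr(1) r(3)])
    have 2: "(\<lambda>n. dir_dist (dir p (\<sigma> (r n))) (\<xi> (r n))) \<longlonglongrightarrow> dir_dist \<zeta> \<xi>0"
      by (rule dir_dist_tendsto[OF d(2) \<xi>d(1) dd(2) \<xi>d(2) limr(2) r(3)])
    have 3: "(\<lambda>n. cos (dir_dist (dir p (\<gamma> (r n))) (dir p (\<sigma> (r n))))) \<longlonglongrightarrow> cos (dir_dist \<eta> \<zeta>)"
      using LIMSEQ_subseq_LIMSEQ[OF main r(1)] by (simp add: o_def)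
    have "dir_dist \<eta> \<xi>0 \<le> pi / 2" by (rule LIMSEQ_le_const2[OF 1]) (use \<xi>(2) in auto)
    moreover have "cos (dir_dist \<eta> \<xi>0) * cos (dir_dist \<zeta> \<xi>0) \<le> cos (dir_dist \<eta> \<zeta>)"
      by (rule LIMSEQ_le[OF tendsto_mult[OF tendsto_cos[OF 1] tendsto_cos[OF 2]] 3]) (use \<xi>(3) in auto)
    ultimately show ?thesis using False r(2) by (auto simp: cos_condition_def)
  qed
qed

end

section \<open>The cosine condition from extremality\<close>

context alexandrov
begin

lemma nearest_point:
  fixes z :: 'a
  assumes "closed F" "F \<noteq> {}"
  obtains x where "x \<in> F" "\<And>y. y \<in> F \<Longrightarrow> dist z x \<le> dist z y"
proof -
  obtain w where w: "w \<in> F" using assms(2) by blast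
  have "compact (cball z (dist z w) \<inter> F)" by (rule compact_Int_closed[OF proper assms(1)])
  moreover have "cball z (dist z w) \<inter> F \<noteq> {}" using w by auto
  moreover have "continuous_on (cball z (dist z w) \<inter> F) (dist z)" by (intro continuous_intros)
  ultimately have "\<exists>x\<in>cball z (dist z w) \<inter> F. \<forall>y\<in>cball z (dist z w) \<inter> F. dist z x \<le> dist z y"
    by (rule continuous_attains_inf)
  then obtain x where x: "x \<in> cball z (dist z w) \<inter> F" "\<And>y. y \<in> cball z (dist z w) \<inter> F \<Longrightarrow> dist z x \<le> dist z y"
    by blast
  show ?thesis
  proof (rule that[of x])
    show "x \<in> F" using x(1) by simp
    fix y assume "y \<in> F"
    then show "dist z x \<le> dist z y"
      using x(2)[of y] x(1) by (cases "dist z y \<le> dist z w") auto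
  qed
qed

lemma min_geodesic_initial: "is_geo \<gamma> (p::'a) L \<Longrightarrow> 0 < t \<Longrightarrow> t \<le> L \<Longrightarrow> min_geodesic \<gamma> p (\<gamma> t)"
  using is_geo_dist(1)[of \<gamma> p L t] by (auto simp: min_geodesic_def is_geo_def)

text \<open>Extremality speaks only of points outside \<open>F\<close>. A geodesic that meets
  \<open>F\<close> at arbitrarily small parameters has its direction in
  \<open>directions_of p F\<close>; any other stays outside for a while.\<close>

lemma geodesic_leaves:
  fixes p :: 'a
  assumes \<gamma>: "is_geo \<gamma> p L" and n: "dir p \<gamma> \<notin> directions_of p F"
  obtains b where "0 < b" "\<And>t. 0 < t \<Longrightarrow> t < b \<Longrightarrow> \<gamma> t \<notin> F"
proof (rule ccontr)
  assume "\<not> thesis"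
  with that have *: "\<And>b. 0 < b \<Longrightarrow> \<exists>t. 0 < t \<and> t < b \<and> \<gamma> t \<in> F" by blast
  have gf: "\<gamma> \<in> geodesics_from p" using \<gamma> geodesics_from_iff by blast
  have L: "0 < L" using \<gamma> by (simp add: is_geo_def)
  have "\<forall>n. \<exists>t. 0 < t \<and> t < min L (inverse (real (Suc n))) \<and> \<gamma> t \<in> F"
    by (intro allI *) (use L in auto)
  then obtain t where t: "\<And>n. 0 < t n" "\<And>n. t n < min L (inverse (real (Suc n)))" "\<And>n. \<gamma> (t n) \<in> F" by metis
  have tl: "t \<longlonglongrightarrow> 0"
    by (rule tendsto_sandwich[OF _ _ tendsto_const inverse_Suc_lim(1)])
       (use t in \<open>auto intro!: always_eventually less_imp_le simp del: of_nat_Suc\<close>)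
  have dt: "dist p (\<gamma> (t n)) = t n" for n
    using is_geo_dist(1)[OF \<gamma>, of "t n"] t(1,2)[of n] by simp
  have "dir p \<gamma> \<in> directions_of p F"
  proof (rule directions_ofI[of _ p "\<lambda>n. \<gamma> (t n)" F "\<lambda>_. \<gamma>"])
    show "dir p \<gamma> \<in> directions p" by (rule dir_facts(1)[OF gf])
    show "\<gamma> (t n) \<in> F" for n by (rule t(3))
    show "\<gamma> (t n) \<noteq> p" for n using dt[of n] t(1)[of n] by auto
    show "min_geodesic \<gamma> p (\<gamma> (t n))" for n
      using t(1,2)[of n] by (intro min_geodesic_initial[OF \<gamma>]) auto
    show "(\<lambda>n. \<gamma> (t n)) \<longlonglongrightarrow> p"
      by (rule metric_tendsto_imp_tendsto[OF tl]) (use dt t(1) in \<open>auto simp: dist_commute intro!: always_eventually\<close>)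
    show "(\<lambda>n. dir_dist (dir p \<gamma>) (dir p \<gamma>)) \<longlonglongrightarrow> 0" using dir_facts(7)[OF dir_facts(1)[OF gf]] by simp
  qed
  with n show False by simp
qed

text \<open>\<open>\<phi>\<close> is the lower limit of \<open>D s / s\<close> at 0, obtained as the
  supremum of eventual lower slopes. The ratio itself need not converge: the scales \<open>t\<close>
  realise the lower limit, and the last clause keeps it as a bound at all small scales, multiples of
  \<open>t\<close> included.\<close>

lemma minimal_scales:
  fixes p :: 'a and D :: "real \<Rightarrow> real"
  assumes D: "\<And>t. 0 < t \<Longrightarrow> t < b \<Longrightarrow> 0 \<le> D t \<and> D t \<le> t" and b: "0 < b"
  obtains \<phi> t where "\<And>n. 0 < t n" "\<And>n. t n < b" "t \<longlonglongrightarrow> 0" "(\<lambda>n. D (t n) / t n) \<longlonglongrightarrow> \<phi>" "\<phi> \<le> 1"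
    "\<And>e. 0 < e \<Longrightarrow> \<exists>\<delta>>0. \<forall>s. 0 < s \<longrightarrow> s < \<delta> \<longrightarrow> (\<phi> - e) * s \<le> D s"
proof -
  define C where "C = {k. \<exists>\<delta>>0. \<forall>s. 0 < s \<longrightarrow> s < \<delta> \<longrightarrow> k * s \<le> D s}"
  have C0: "0 \<in> C" unfolding C_def using b D by (auto intro!: exI[of _ b])
  have C1: "k \<le> 1" if kC: "k \<in> C" for k
  proof -
    obtain \<delta> where \<delta>: "\<delta> > 0" "\<forall>s. 0 < s \<longrightarrow> s < \<delta> \<longrightarrow> k * s \<le> D s" using kC by (auto simp: C_def)
    define s where "s = min \<delta> b / 2"
    have s: "0 < s" "s < \<delta>" "s < b" using \<delta> b by (auto simp: s_def min_def)
    have "k * s \<le> D s" using \<delta>(2) s by simp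
    also have "\<dots> \<le> 1 * s" using D[OF s(1,3)] by simp
    finally have "k * s \<le> 1 * s" .
    then show ?thesis using s by simp
  qed
  have bdd: "bdd_above C" by (rule bdd_aboveI[of _ 1]) (rule C1)
  define \<phi> where "\<phi> = Sup C"
  have \<phi>1: "\<phi> \<le> 1" unfolding \<phi>_def using C0 C1 by (intro cSup_least) auto
  have low: "\<exists>\<delta>>0. \<forall>s. 0 < s \<longrightarrow> s < \<delta> \<longrightarrow> (\<phi> - e) * s \<le> D s" if e: "0 < e" for e
  proof -
    have "\<phi> - e < Sup C" using e by (simp add: \<phi>_def)
    then obtain k where k: "k \<in> C" "\<phi> - e < k" using less_cSupE[of "\<phi> - e" C] C0 by blast
    then obtain \<delta> where \<delta>: "\<delta> > 0" "\<And>s. 0 < s \<Longrightarrow> s < \<delta> \<Longrightarrow> k * s \<le> D s" by (auto simp: C_def)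
    have "(\<phi> - e) * s \<le> D s" if s: "0 < s" "s < \<delta>" for s
    proof -
      have "(\<phi> - e) * s \<le> k * s" using k(2) s by (intro mult_right_mono) auto
      also have "\<dots> \<le> D s" by (rule \<delta>(2)[OF s])
      finally show ?thesis .
    qed
    with \<delta>(1) show ?thesis by blast
  qed
  have up: "\<exists>s. 0 < s \<and> s < min b d \<and> D s < (\<phi> + d) * s" if d: "0 < d" for d
  proof (rule ccontr)
    assume n: "\<not> ?thesis"
    have "(\<phi> + d) * s \<le> D s" if "0 < s" "s < min b d" for s
      using n that by (meson not_less)
    moreover have "0 < min b d" using b d by simp
    ultimately have "\<phi> + d \<in> C" unfolding C_def by blast
    then have "\<phi> + d \<le> \<phi>" unfolding \<phi>_def by (rule cSup_upper[OF _ bdd])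
    with d show False by simp
  qed
  have "\<forall>n. \<exists>s. 0 < s \<and> s < min b (inverse (real (Suc n))) \<and> D s < (\<phi> + inverse (real (Suc n))) * s"
    by (intro allI up inverse_Suc_lim(2))
  then obtain t where t: "\<And>n. 0 < t n" "\<And>n. t n < min b (inverse (real (Suc n)))"
    "\<And>n. D (t n) < (\<phi> + inverse (real (Suc n))) * t n" by metis
  have tl: "t \<longlonglongrightarrow> 0"
    by (rule tendsto_sandwich[OF _ _ tendsto_const inverse_Suc_lim(1)])
       (use t in \<open>auto intro!: always_eventually less_imp_le simp del: of_nat_Suc\<close>)
  have "(\<lambda>n. D (t n) / t n) \<longlonglongrightarrow> \<phi>"
  proof (rule order_tendstoI)
    fix u assume "u < \<phi>"
    define e where "e = (\<phi> - u) / 2"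
    have e: "0 < e" "u < \<phi> - e" using \<open>u < \<phi>\<close> by (auto simp: e_def field_simps)
    obtain \<delta> where \<delta>: "\<delta> > 0" "\<And>s. 0 < s \<Longrightarrow> s < \<delta> \<Longrightarrow> (\<phi> - e) * s \<le> D s" using low[OF e(1)] by blast
    show "\<forall>\<^sub>F n in sequentially. u < D (t n) / t n"
      using order_tendstoD(2)[OF tl \<delta>(1)]
    proof (rule eventually_mono)
      fix n assume "t n < \<delta>"
      then have "\<phi> - e \<le> D (t n) / t n" using \<delta>(2)[OF t(1)] t(1)[of n] by (simp add: pos_le_divide_eq)
      with e(2) show "u < D (t n) / t n" by simp
    qed
  next
    fix u assume "\<phi> < u"
    then have "0 < u - \<phi>" by simp
    from order_tendstoD(2)[OF inverse_Suc_lim(1) this]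
    show "\<forall>\<^sub>F n in sequentially. D (t n) / t n < u"
    proof (rule eventually_mono)
      fix n assume "inverse (real (Suc n)) < u - \<phi>"
      moreover have "D (t n) / t n < \<phi> + inverse (real (Suc n))"
        using t(3)[of n] t(1)[of n] by (simp add: pos_divide_less_eq)
      ultimately show "D (t n) / t n < u" by simp
    qed
  qed
  from that[OF t(1) _ tl this \<phi>1 low] show ?thesis using t(2) by simp
qed

text \<open>A hinge with angle at most \<open>pi / 2\<close> obeys one half of Pythagoras, up to the
  curvature error. One radius has to serve all \<open>x\<close> near \<open>p\<close>, because the
  nearest points move and extremality is applied at them, not at \<open>p\<close>.\<close>

lemma extremal_inequality:
  fixes p :: 'a
  assumes ext: "extremal F" and e: "0 < e"
  obtains \<rho> where "0 < \<rho>" "\<And>x q r. x \<in> F \<Longrightarrow> q \<notin> F \<Longrightarrow> (\<forall>y\<in>F. dist q x \<le> dist q y) \<Longrightarrow>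
    dist p x < \<rho> \<Longrightarrow> dist x q < \<rho> \<Longrightarrow> dist x r < \<rho> \<Longrightarrow>
    (dist q r)\<^sup>2 \<le> (dist q x)\<^sup>2 + (dist x r)\<^sup>2 + e * dist x q * dist x r"
proof -
  obtain R where R: "R > 0" "four_point c (ball p R)" using fp by blast
  \<comment> \<open>Half of \<open>e\<close> is spent on the hinge; the other half pays for a cosine
    of at least \<open>- e / 4\<close>, which enters with the factor 2.\<close>
  have e3: "0 < e / 2" "0 < e / 4" using e by auto
  obtain r' where r': "0 < r'" "4 * ((cosh (c * r'))\<^sup>2 - 1) \<le> e / 2" by (rule small_cosh[OF e3(1)])
  define \<rho> where "\<rho> = min (R / 2) r'"
  have \<rho>: "0 < \<rho>" "2 * \<rho> \<le> R" "\<rho> \<le> r'" using R r' by (auto simp: \<rho>_def min_def)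
  show ?thesis
  proof (rule that[OF \<rho>(1)])
    fix x q r assume x: "x \<in> F" and q: "q \<notin> F" and min: "\<forall>y\<in>F. dist q x \<le> dist q y"
      and d: "dist p x < \<rho>" "dist x q < \<rho>" "dist x r < \<rho>"
    show "(dist q r)\<^sup>2 \<le> (dist q x)\<^sup>2 + (dist x r)\<^sup>2 + e * dist x q * dist x r"
    proof (cases "r = x")
      case False
      have qx: "q \<noteq> x" using x q by auto
      let ?A = "{dir_dist \<xi> \<eta> |\<xi> \<eta>. \<xi> \<in> dirs_to x q \<and> \<eta> \<in> dirs_to x r}"
      have "dir_setdist (dirs_to x q) (dirs_to x r) \<le> pi / 2"
        using ext x q min False unfolding extremal_def by blast
      \<comment> \<open>The infimum is only approached, hence the slack \<open>e / 4\<close> in the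
        angle.\<close>
      then have "Inf ?A < pi / 2 + e / 4" using e by (simp add: dir_setdist_def)
      moreover have "?A \<noteq> {}" using geo[of x q] geo[of x r] by (auto simp: dirs_to_def)
      ultimately have "\<exists>y\<in>?A. y < pi / 2 + e / 4" by (intro cInf_lessD)
      then obtain \<xi> \<eta> where "\<xi> \<in> dirs_to x q" "\<eta> \<in> dirs_to x r" "dir_dist \<xi> \<eta> < pi / 2 + e / 4"
        by blast
      then obtain g h where g: "min_geodesic g x q" "min_geodesic h x r" "dir_dist (dir x g) (dir x h) < pi / 2 + e / 4"
        by (auto simp: dirs_to_def)
      have gf: "g \<in> geodesics_from x" "h \<in> geodesics_from x" using geodesics_from_min g qx False by blast+
      have gg: "is_geo g x (dist x q)" "is_geo h x (dist x r)"
        using is_geo_of_min_geodesic g qx False by metis+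
      have ends: "g (dist x q) = q" "h (dist x r) = r" using g by (auto simp: min_geodesic_def)
      let ?\<theta> = "geodesic_angle g h"
      have th: "?\<theta> < pi / 2 + e / 4" using g(3) dir_facts(2)[OF gf] by simp
      have cos: "- (e / 4) \<le> cos ?\<theta>"
      proof (cases "?\<theta> \<le> pi / 2")
        case True
        then have "0 \<le> cos ?\<theta>" using angle_props(1)[OF gf] by (intro cos_ge_zero) auto
        with e show ?thesis by simp
      next
        case False
        have "\<bar>cos ?\<theta> - cos (pi / 2)\<bar> \<le> \<bar>?\<theta> - pi / 2\<bar>" by (rule cos_lipschitz)
        then show ?thesis using th False by simp
      qed
      have im: "g ` {0..dist x q} \<subseteq> ball p R" "h ` {0..dist x r} \<subseteq> ball p R"
      proof -
        have "ball x \<rho> \<subseteq> ball p R"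
        proof
          fix z assume "z \<in> ball x \<rho>"
          then show "z \<in> ball p R" using d(1) \<rho> dist_triangle[of p z x] by simp
        qed
        then show "g ` {0..dist x q} \<subseteq> ball p R" "h ` {0..dist x r} \<subseteq> ball p R"
          using geo_image[OF gg(1) d(2)] geo_image[OF gg(2) d(3)] by auto
      qed
      have "(dist (g (dist x q)) (h (dist x r)))\<^sup>2 \<le> (dist x q)\<^sup>2 + (dist x r)\<^sup>2 - 2 * dist x q * dist x r * cos ?\<theta>
          + e / 2 * dist x q * dist x r"
        using d \<rho> by (intro hinge[OF R(2) c_pos gg im _ _ _ _ _ _ r'(2)]) auto
      moreover have "dist x q * dist x r * (- (e / 4)) \<le> dist x q * dist x r * cos ?\<theta>"
        using cos by (intro mult_left_mono) auto
      ultimately show ?thesis unfolding ends by (simp add: dist_commute algebra_simps)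
    qed simp
  qed
qed

text \<open>This is \<open>extremal_inequality\<close> at scale \<open>l n\<close>, divided by
  \<open>(l n)\<^sup>2\<close>. In the cone it says that the hinge with legs \<open>\<phi>\<close>
  and \<open>w\<close> opens by at most a right angle.\<close>

lemma extremal_limit_inequality:
  fixes p :: 'a
  assumes ext: "extremal F" and g: "\<gamma> \<in> geodesics_from p" "\<sigma> \<in> geodesics_from p"
    and l: "\<And>n. 0 < l n" "l \<longlonglongrightarrow> 0"
    and x: "\<And>n. x n \<in> F" "\<And>n. \<gamma> (l n) \<notin> F" "\<And>n y. y \<in> F \<Longrightarrow> dist (\<gamma> (l n)) (x n) \<le> dist (\<gamma> (l n)) y"
    and a: "(\<lambda>n. dist p (x n) / l n) \<longlonglongrightarrow> a"
    and \<phi>: "(\<lambda>n. dist (\<gamma> (l n)) (x n) / l n) \<longlonglongrightarrow> \<phi>"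
    and w: "(\<lambda>n. dist (x n) (\<sigma> (l n)) / l n) \<longlonglongrightarrow> w"
  shows "2 - 2 * cos (dir_dist (dir p \<gamma>) (dir p \<sigma>)) \<le> \<phi>\<^sup>2 + w\<^sup>2"
proof (rule field_le_epsilon)
  fix e :: real assume e: "0 < e"
  let ?k = "cos (dir_dist (dir p \<gamma>) (dir p \<sigma>))"
  have small: "\<forall>\<^sub>F n in sequentially. f n < \<rho>" if "(\<lambda>n. f n / l n) \<longlonglongrightarrow> u" "0 < \<rho>" for f u \<rho>
  proof -
    have "(\<lambda>n. f n / l n * l n) \<longlonglongrightarrow> u * 0" by (intro tendsto_mult that l)
    moreover have "f n / l n * l n = f n" for n using l(1)[of n] by simp
    ultimately have "f \<longlonglongrightarrow> 0" by simp
    then show ?thesis using that(2) by (rule order_tendstoD(2))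
  qed
  have l0: "0 \<le> l n" for n using l(1)[of n] by simp
  have nn: "0 \<le> \<phi>" "0 \<le> w"
  proof -
    show "0 \<le> \<phi>" by (rule LIMSEQ_le_const[OF \<phi>]) (simp add: l0)
    show "0 \<le> w" by (rule LIMSEQ_le_const[OF w]) (simp add: l0)
  qed
  \<comment> \<open>The summand 1 covers \<open>\<phi> * w = 0\<close>.\<close>
  define d where "d = e / (\<phi> * w + 1)"
  have pos: "0 < \<phi> * w + 1" using nn by (simp add: add_nonneg_pos)
  have d: "0 < d" "d * \<phi> * w \<le> e"
  proof -
    show "0 < d" using e pos by (simp add: d_def)
    have "d * (\<phi> * w) \<le> d * (\<phi> * w + 1)" using \<open>0 < d\<close> by (intro mult_left_mono) auto
    also have "\<dots> = e" using pos by (simp add: d_def)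
    finally show "d * \<phi> * w \<le> e" by (simp add: mult.assoc)
  qed
  obtain \<rho> where \<rho>: "0 < \<rho>" "\<And>x q r. x \<in> F \<Longrightarrow> q \<notin> F \<Longrightarrow> (\<forall>y\<in>F. dist q x \<le> dist q y) \<Longrightarrow>
    dist p x < \<rho> \<Longrightarrow> dist x q < \<rho> \<Longrightarrow> dist x r < \<rho> \<Longrightarrow>
    (dist q r)\<^sup>2 \<le> (dist q x)\<^sup>2 + (dist x r)\<^sup>2 + d * dist x q * dist x r"
    by (rule extremal_inequality[OF ext d(1), of p]) blast
  have ang: "(\<lambda>n. dist (\<gamma> (1 * l n)) (\<sigma> (1 * l n)) / l n) \<longlonglongrightarrow> sqrt (1\<^sup>2 + 1\<^sup>2 - 2 * 1 * 1 * ?k)"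
    unfolding dir_facts(2)[OF g] by (intro geodesic_dist_limit[OF g _ _ l]) auto
  have lhs: "(\<lambda>n. (dist (\<gamma> (l n)) (\<sigma> (l n)) / l n)\<^sup>2) \<longlonglongrightarrow> (sqrt (2 - 2 * ?k))\<^sup>2"
    using tendsto_power[OF ang, of 2] by simp
  have rhs: "(\<lambda>n. (dist (\<gamma> (l n)) (x n) / l n)\<^sup>2 + (dist (x n) (\<sigma> (l n)) / l n)\<^sup>2
      + d * (dist (\<gamma> (l n)) (x n) / l n) * (dist (x n) (\<sigma> (l n)) / l n)) \<longlonglongrightarrow> \<phi>\<^sup>2 + w\<^sup>2 + d * \<phi> * w"
    by (intro tendsto_intros \<phi> w)
  have "\<forall>\<^sub>F n in sequentially. (dist (\<gamma> (l n)) (\<sigma> (l n)) / l n)\<^sup>2 \<le> (dist (\<gamma> (l n)) (x n) / l n)\<^sup>2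
      + (dist (x n) (\<sigma> (l n)) / l n)\<^sup>2 + d * (dist (\<gamma> (l n)) (x n) / l n) * (dist (x n) (\<sigma> (l n)) / l n)"
    using small[OF a \<rho>(1)] small[OF \<phi> \<rho>(1)] small[OF w \<rho>(1)]
  proof eventually_elim
    case (elim n)
    have "(dist (\<gamma> (l n)) (\<sigma> (l n)))\<^sup>2 \<le> (dist (\<gamma> (l n)) (x n))\<^sup>2 + (dist (x n) (\<sigma> (l n)))\<^sup>2
        + d * dist (x n) (\<gamma> (l n)) * dist (x n) (\<sigma> (l n))"
      using elim by (intro \<rho>(2) x(1,2) ballI x(3)) (auto simp: dist_commute)
    then have "(dist (\<gamma> (l n)) (\<sigma> (l n)))\<^sup>2 / (l n)\<^sup>2 \<le> ((dist (\<gamma> (l n)) (x n))\<^sup>2 + (dist (x n) (\<sigma> (l n)))\<^sup>2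
        + d * dist (\<gamma> (l n)) (x n) * dist (x n) (\<sigma> (l n))) / (l n)\<^sup>2"
      by (intro divide_right_mono) (auto simp: dist_commute)
    then show ?case by (simp add: power_divide add_divide_distrib power2_eq_square)
  qed
  then have "(sqrt (2 - 2 * ?k))\<^sup>2 \<le> \<phi>\<^sup>2 + w\<^sup>2 + d * \<phi> * w"
    by (rule tendsto_le[OF sequentially_bot rhs lhs])
  then show "2 - 2 * ?k \<le> \<phi>\<^sup>2 + w\<^sup>2 + e" using d(2) by simp
qed

lemma cos_condition_geodesics:
  fixes p :: 'a
  assumes ext: "extremal F" and p: "p \<in> F" and g: "\<gamma> \<in> geodesics_from p" "\<sigma> \<in> geodesics_from p"
  shows "cos_condition p F (dir p \<gamma>) (dir p \<sigma>)"
proof (cases "dir p \<gamma> \<in> directions_of p F")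
  \<comment> \<open>Here \<open>\<eta>\<close> itself serves as \<open>\<xi>\<close>, since
    \<open>cos 0 = 1\<close>.\<close>
  case True
  have d: "dir p \<gamma> \<in> directions p" "dir p \<sigma> \<in> directions p" using dir_facts(1) g by auto
  show ?thesis
    unfolding cos_condition_def using True dir_facts(7)[OF d(1)] dir_facts(5)[OF d]
    by (auto intro!: bexI[of _ "dir p \<gamma>"])
next
  case False
  have F: "closed F" using ext by (simp add: extremal_def)
  have F0: "F \<noteq> {}" using p by auto
  have \<eta>: "dir p \<gamma> \<in> directions p" by (rule dir_facts(1)[OF g(1)])
  obtain L where L: "is_geo \<gamma> p L" using g(1) geodesics_from_iff by blast
  obtain b0 where b0: "0 < b0" "\<And>t. 0 < t \<Longrightarrow> t < b0 \<Longrightarrow> \<gamma> t \<notin> F" by (rule geodesic_leaves[OF L False]) blast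
  define b where "b = min b0 L"
  have b: "0 < b" "b \<le> b0" "b \<le> L" using b0 L by (auto simp: b_def is_geo_def)
  have "\<exists>x. x \<in> F \<and> (\<forall>y\<in>F. dist z x \<le> dist z y)" for z
    by (rule nearest_point[OF F F0, of z]) blast
  then obtain \<pi> where \<pi>: "\<And>z. \<pi> z \<in> F" "\<And>z y. y \<in> F \<Longrightarrow> dist z (\<pi> z) \<le> dist z y" by metis
  define D where "D t = dist (\<gamma> t) (\<pi> (\<gamma> t))" for t
  have Dt: "0 \<le> D t \<and> D t \<le> t" if "0 < t" "t < b" for t
    using \<pi>(2)[OF p, of "\<gamma> t"] is_geo_dist(2)[OF L, of t] that b by (simp add: D_def)
  obtain \<phi> t where t: "\<And>n. 0 < t n" "\<And>n. t n < b" "t \<longlonglongrightarrow> 0" "(\<lambda>n. D (t n) / t n) \<longlonglongrightarrow> \<phi>" "\<phi> \<le> 1"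
    "\<And>e. 0 < e \<Longrightarrow> \<exists>\<delta>>0. \<forall>s. 0 < s \<longrightarrow> s < \<delta> \<longrightarrow> (\<phi> - e) * s \<le> D s"
    by (rule minimal_scales[of b D, OF Dt b(1)], assumption, assumption, rule that, assumption+)
  \<comment> \<open>As \<open>p\<close> lies in \<open>F\<close>, the nearest point is within
    \<open>t n\<close> of \<open>\<gamma> (t n)\<close>, which bounds the ratio by 2 and yields a
    limit \<open>a\<close> along a subsequence.\<close>
  have bnd: "dist p (\<pi> (\<gamma> (t n))) / t n \<in> {0..2}" for n
  proof -
    have "dist p (\<gamma> (t n)) = t n" using is_geo_dist(1)[OF L, of "t n"] t(1,2)[of n] b by simp
    then have "dist p (\<pi> (\<gamma> (t n))) \<le> 2 * t n"
      using Dt[OF t(1,2), of n] dist_triangle[of p "\<pi> (\<gamma> (t n))" "\<gamma> (t n)"] by (simp add: D_def)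
    then show ?thesis using t(1)[of n] by (simp add: pos_divide_le_eq)
  qed
  obtain a r where a: "a \<in> {0..2::real}" "strict_mono (r :: nat \<Rightarrow> nat)"
    "((\<lambda>n. dist p (\<pi> (\<gamma> (t n))) / t n) \<circ> r) \<longlonglongrightarrow> a"
    by (rule seq_compactE[OF compact_imp_seq_compact[OF compact_Icc] allI[OF bnd]])
  define l where "l n = t (r n)" for n
  define x where "x n = \<pi> (\<gamma> (l n))" for n
  have l: "\<And>n. 0 < l n" "l \<longlonglongrightarrow> 0" "\<And>n. l n < b"
    using t(1,2) LIMSEQ_subseq_LIMSEQ[OF t(3) a(2)] by (auto simp: l_def[abs_def] o_def)
  have xa: "(\<lambda>n. dist p (x n) / l n) \<longlonglongrightarrow> a" using a(3) by (simp add: x_def l_def o_def)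
  have xphi: "(\<lambda>n. dist (\<gamma> (l n)) (x n) / l n) \<longlonglongrightarrow> \<phi>"
    using LIMSEQ_subseq_LIMSEQ[OF t(4) a(2)] by (simp add: x_def l_def o_def D_def)
  have xF: "x n \<in> F" for n by (simp add: x_def \<pi>(1))
  have a0: "0 \<le> a" using a(1) by simp
  \<comment> \<open>The scales are arbitrary here because the case \<open>a = 0\<close> applies this
    to points of \<open>F\<close> unrelated to \<open>x\<close>.\<close>
  have low: "\<forall>\<^sub>F n in sequentially. \<forall>y\<in>F. (\<phi> - e) * (M * l n) \<le> dist (\<gamma> (M * l n)) y"
    if "0 < M" "0 < e" "\<And>n. 0 < l n" "l \<longlonglongrightarrow> 0" for M e and l :: "nat \<Rightarrow> real"
  proof -
    obtain \<delta> where \<delta>: "\<delta> > 0" "\<And>s. 0 < s \<Longrightarrow> s < \<delta> \<Longrightarrow> (\<phi> - e) * s \<le> D s" using t(6)[OF \<open>0 < e\<close>] by blast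
    have "\<forall>\<^sub>F n in sequentially. M * l n < \<delta>"
      using order_tendstoD(2)[OF tendsto_mult_left[OF \<open>l \<longlonglongrightarrow> 0\<close>, of M], of \<delta>] \<delta>(1) by simp
    then show ?thesis
    proof eventually_elim
      case (elim n)
      have "(\<phi> - e) * (M * l n) \<le> D (M * l n)"
        using elim that(1,3) by (intro \<delta>(2)) auto
      then show ?case unfolding D_def using \<pi>(2) order.trans by blast
    qed
  qed
  have x_near: "dist (\<gamma> (l n)) (x n) \<le> dist (\<gamma> (l n)) y" if "y \<in> F" for n y
    unfolding x_def by (rule \<pi>(2)[OF that])
  have out: "\<gamma> (l n) \<notin> F" for n using b0(2)[of "l n"] l(1,3)[of n] b by simp
  have tg: "tangent_along p (dir p \<tau>) 1 k (\<lambda>n. \<tau> (k n))" if "\<tau> \<in> geodesics_from p" "\<And>n. 0 < k n" for \<tau> k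
    using tang_geodesic[OF that, of 1] by simp
  show ?thesis
  proof (cases "a = 0")
    case True
    \<comment> \<open>The nearest points run into the apex faster than the scale, so their rescaled
      distance from every geodesic tends to 1.\<close>
    have tz: "tangent_along p (dir p \<gamma>) 0 l x" by (rule tang_zero[OF \<eta> l(1)]) (use xa True in simp)
    have lim1: "(\<lambda>n. dist (\<tau> (l n)) (x n) / l n) \<longlonglongrightarrow> 1" if "\<tau> \<in> geodesics_from p" for \<tau>
      using tang_dist[OF dir_facts(1)[OF that] \<eta> zero_le_one order_refl l(1,2) tg[OF that l(1)] tz] by simp
    have \<phi>1: "\<phi> = 1" by (rule LIMSEQ_unique[OF xphi lim1[OF g(1)]])
    have acute: "0 \<le> cos (dir_dist (dir p \<gamma>) (dir p \<tau>))" if \<tau>: "\<tau> \<in> geodesics_from p" for \<tau>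
    proof -
      have "(\<lambda>n. dist (x n) (\<tau> (l n)) / l n) \<longlonglongrightarrow> 1" using lim1[OF \<tau>] by (simp add: dist_commute)
      from extremal_limit_inequality[OF ext g(1) \<tau> l(1,2) xF out x_near xa xphi this] \<phi>1
      show ?thesis by simp
    qed
    show ?thesis
    proof (cases "directions_of p F = {}")
      case True
      then show ?thesis using acute[OF g(2)] by (simp add: cos_condition_def)
    next
      case False
      then obtain \<xi> where \<xi>: "\<xi> \<in> directions_of p F" by blast
      have \<xi>d: "\<xi> \<in> directions p" by (rule directions_of_subset[OF \<xi>])
      have le: "dir_dist (dir p \<gamma>) \<xi> \<le> pi / 2"
      proof (rule field_le_epsilon)
        fix e :: real assume e: "0 < e"
        obtain \<tau> where \<tau>: "\<tau> \<in> geodesics_from p" "dir_dist (dir p \<tau>) \<xi> < e" by (rule dir_dense[OF \<xi>d e])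
        have \<tau>d: "dir p \<tau> \<in> directions p" by (rule dir_facts(1)[OF \<tau>(1)])
        have "dir_dist (dir p \<gamma>) (dir p \<tau>) \<le> pi / 2"
          by (rule acute_of_cos_nonneg[OF dir_facts(4)[OF \<eta> \<tau>d] acute[OF \<tau>(1)]])
        then show "dir_dist (dir p \<gamma>) \<xi> \<le> pi / 2 + e" using dir_facts(6)[OF \<eta> \<tau>d \<xi>d] \<tau>(2) by linarith
      qed
      obtain y h where y: "\<And>n. y n \<in> F" "\<And>n. y n \<noteq> p" "\<And>n. min_geodesic (h n) p (y n)" "y \<longlonglongrightarrow> p"
        "(\<lambda>n. dir_dist (dir p (h n)) \<xi>) \<longlonglongrightarrow> 0" by (rule directions_ofE[OF \<xi>]) blast
      define k where "k n = dist p (y n)" for n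
      have k0: "0 < k n" for n using y(2)[of n] by (simp add: k_def)
      have kl: "k \<longlonglongrightarrow> 0" unfolding k_def using tendsto_dist[OF tendsto_const y(4), of p] by simp
      have one: "(\<lambda>n. dist p (y n) / k n) \<longlonglongrightarrow> 1" using k0 by (simp add: k_def)
      \<comment> \<open>\<open>\<phi> = 1\<close> makes \<open>p\<close> almost nearest at all small
        scales, so no direction of \<open>F\<close> is at an acute angle from that of
        \<open>\<gamma>\<close>. With the bound \<open>le\<close> the angle is
        \<open>pi / 2\<close>, and the product of cosines vanishes.\<close>
      have "cos (dir_dist (dir p \<gamma>) \<xi>) \<le> 0"
      proof (rule cos_nonpos_of_minimizing[OF g(1) \<xi>d k0 kl])
        show "tangent_along p \<xi> 1 k y" by (rule tang_of_points[OF \<xi>d k0 kl _ y(2,3,5) one]) simp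
        fix M e :: real assume "0 < M" "0 < e"
        from low[OF this k0 kl] show "\<forall>\<^sub>F n in sequentially. (1 - e) * (M * k n) \<le> dist (\<gamma> (M * k n)) (y n)"
          unfolding \<phi>1 by (rule eventually_mono) (use y(1) in blast)
      qed
      moreover have "0 \<le> cos (dir_dist (dir p \<gamma>) \<xi>)"
        using le dir_facts(3)[OF \<eta> \<xi>d] by (intro cos_ge_zero) auto
      ultimately have "cos (dir_dist (dir p \<gamma>) \<xi>) = 0" by simp
      then show ?thesis
        using False \<xi> le acute[OF g(2)] unfolding cos_condition_def by (auto intro!: bexI[of _ \<xi>])
    qed
  next
    case False
    then have a0: "0 < a" using a(1) by simp
    have \<zeta>: "dir p \<sigma> \<in> directions p" by (rule dir_facts(1)[OF g(2)])
    from order_tendstoD(1)[OF xa a0] obtain N where N: "\<And>n. n \<ge> N \<Longrightarrow> 0 < dist p (x n) / l n"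
      unfolding eventually_sequentially by blast
    have xN: "x (n + N) \<noteq> p" for n using N[of "n + N"] by auto
    have "\<forall>n. \<exists>h. min_geodesic h p (x (n + N))" using geo by blast
    then obtain h where h: "\<And>n. min_geodesic (h n) p (x (n + N))" by metis
    obtain s \<xi> where s: "strict_mono (s :: nat \<Rightarrow> nat)" "\<xi> \<in> directions p" "(\<lambda>n. dir_dist (dir p (h (s n))) \<xi>) \<longlonglongrightarrow> 0"
      by (rule directions_subseq[of h p, OF geodesics_from_min[OF h xN]])
    define u where "u n = s n + N" for n
    have u: "strict_mono u" using s(1) by (simp add: u_def strict_mono_def)
    have l': "\<And>n. 0 < l (u n)" "(\<lambda>n. l (u n)) \<longlonglongrightarrow> 0"
      using l(1) LIMSEQ_subseq_LIMSEQ[OF l(2) u] by (auto simp: o_def)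
    have xa': "(\<lambda>n. dist p (x (u n)) / l (u n)) \<longlonglongrightarrow> a"
      using LIMSEQ_subseq_LIMSEQ[OF xa u] by (simp add: o_def)
    have xphi': "(\<lambda>n. dist (\<gamma> (l (u n))) (x (u n)) / l (u n)) \<longlonglongrightarrow> \<phi>"
      using LIMSEQ_subseq_LIMSEQ[OF xphi u] by (simp add: o_def)
    have h': "\<And>n. min_geodesic (h (s n)) p (x (u n))" using h by (simp add: u_def)
    have x': "\<And>n. x (u n) \<noteq> p" using xN by (simp add: u_def)
    have tx: "tangent_along p \<xi> a (\<lambda>n. l (u n)) (\<lambda>n. x (u n))"
      by (rule tang_of_points[OF s(2) l' _ x' h' s(3) xa']) (use a0 in simp)
    have "(\<lambda>n. dist p (x (u n)) / l (u n) * l (u n)) \<longlonglongrightarrow> a * 0" by (intro tendsto_mult xa' l')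
    moreover have "dist p (x (u n)) / l (u n) * l (u n) = dist (x (u n)) p" for n
      using l'(1)[of n] by (simp add: dist_commute)
    ultimately have "(\<lambda>n. dist (x (u n)) p) \<longlonglongrightarrow> 0" by simp
    then have "(\<lambda>n. x (u n)) \<longlonglongrightarrow> p" by (rule iffD2[OF tendsto_dist_iff])
    then have \<xi>: "\<xi> \<in> directions_of p F"
      by (intro directions_ofI[OF s(2), of "\<lambda>n. x (u n)" F "\<lambda>n. h (s n)"] xF x' h' s(3))
    define k where "k = cos (dir_dist (dir p \<gamma>) \<xi>)"
    define m where "m = cos (dir_dist (dir p \<sigma>) \<xi>)"
    have limM: "(\<lambda>n. dist (\<gamma> (M * l (u n))) (x (u n)) / l (u n)) \<longlonglongrightarrow> sqrt (M\<^sup>2 + a\<^sup>2 - 2 * M * a * k)" if "0 < M" for M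
      unfolding k_def using that a0
      by (intro tang_dist[OF \<eta> s(2) _ _ l' tang_geodesic[OF g(1) l'(1)] tx]) auto
    have sq: "0 \<le> 1 + a\<^sup>2 - 2 * a * cos t" for t
    proof -
      have "1 + a\<^sup>2 - 2 * a * cos t = (a - cos t)\<^sup>2 + (sin t)\<^sup>2"
        by (simp add: sin_squared_eq power2_eq_square algebra_simps)
      then show ?thesis by simp
    qed
    have "\<phi> = sqrt (1\<^sup>2 + a\<^sup>2 - 2 * 1 * a * k)"
      using LIMSEQ_unique[OF xphi'] limM[of 1] by simp
    then have \<phi>k: "\<phi>\<^sup>2 = 1 + a\<^sup>2 - 2 * a * k" "0 \<le> \<phi>" using sq by (simp_all add: k_def)
    \<comment> \<open>In the cone \<open>\<phi> * M\<close> bounds the distance from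
      \<open>M\<eta>\<close> to \<open>a\<xi>\<close> from below for every \<open>M > 0\<close>,
      with equality at \<open>M = 1\<close>.\<close>
    have "a = k"
    proof (rule quadratic_touching[OF _ a0])
      fix M :: real assume M: "0 < M"
      have "\<phi> * M \<le> sqrt (M\<^sup>2 + a\<^sup>2 - 2 * M * a * k)"
      proof (rule field_le_epsilon)
        fix e :: real assume e: "0 < e"
        have "(\<phi> - e / M) * M \<le> sqrt (M\<^sup>2 + a\<^sup>2 - 2 * M * a * k)"
        proof (rule tendsto_lowerbound[OF limM[OF M] _ sequentially_bot])
          have "0 < e / M" using e M by simp
          from low[OF M this l'] show "\<forall>\<^sub>F n in sequentially. (\<phi> - e / M) * M \<le> dist (\<gamma> (M * l (u n))) (x (u n)) / l (u n)"
            by (rule eventually_mono) (use xF l'(1) in \<open>auto simp: pos_le_divide_eq mult.assoc\<close>)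
        qed
        moreover have "(\<phi> - e / M) * M = \<phi> * M - e" using M by (simp add: left_diff_distrib)
        ultimately show "\<phi> * M \<le> sqrt (M\<^sup>2 + a\<^sup>2 - 2 * M * a * k) + e" by simp
      qed
      moreover have "0 \<le> \<phi> * M" using \<phi>k(2) M by simp
      ultimately have "(\<phi> * M)\<^sup>2 \<le> M\<^sup>2 + a\<^sup>2 - 2 * M * a * k"
        by (intro sqrt_ge_absD) simp
      then show "M\<^sup>2 * (1 + a\<^sup>2 - 2 * a * k) \<le> M\<^sup>2 + a\<^sup>2 - 2 * M * a * k"
        unfolding \<phi>k(1)[symmetric] by (simp add: power_mult_distrib mult.commute)
    qed
    have "(\<lambda>n. dist (x (u n)) (\<sigma> (l (u n))) / l (u n)) \<longlonglongrightarrow> sqrt (a\<^sup>2 + 1\<^sup>2 - 2 * a * 1 * cos (dir_dist \<xi> (dir p \<sigma>)))"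
      using a0 by (intro tang_dist[OF s(2) \<zeta> _ _ l' tx tg[OF g(2) l'(1)]]) auto
    then have w: "(\<lambda>n. dist (x (u n)) (\<sigma> (l (u n))) / l (u n)) \<longlonglongrightarrow> sqrt (1 + a\<^sup>2 - 2 * a * m)"
      unfolding dir_facts(5)[OF s(2) \<zeta>] by (simp add: m_def add.commute)
    have "2 - 2 * cos (dir_dist (dir p \<gamma>) (dir p \<sigma>)) \<le> \<phi>\<^sup>2 + (sqrt (1 + a\<^sup>2 - 2 * a * m))\<^sup>2"
      by (rule extremal_limit_inequality[OF ext g l' xF out x_near xa' xphi' w])
    \<comment> \<open>For \<open>a = k\<close> the sum is
      \<open>(1 - k^2) + (1 + k^2 - 2 * k * m)\<close>.\<close>
    also have "\<dots> = 2 - 2 * k * m"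
      using sq[of "dir_dist (dir p \<sigma>) \<xi>"] unfolding \<phi>k(1) \<open>a = k\<close>
      by (simp add: m_def[symmetric] power2_eq_square)
    finally have "k * m \<le> cos (dir_dist (dir p \<gamma>) (dir p \<sigma>))" by simp
    moreover have "dir_dist (dir p \<gamma>) \<xi> \<le> pi / 2"
      using a0 unfolding \<open>a = k\<close> k_def by (intro acute_of_cos_nonneg dir_facts(4)[OF \<eta> s(2)]) simp
    ultimately show ?thesis
      using \<xi> unfolding cos_condition_def k_def m_def by auto
  qed
qed

theorem extremal_iff_cos_condition:
  assumes "closed (F :: 'a set)"
  shows "extremal F \<longleftrightarrow> (\<forall>p\<in>F. \<forall>\<eta>\<in>directions p. \<forall>\<zeta>\<in>directions p. cos_condition p F \<eta> \<zeta>)"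
proof
  assume ext: "extremal F"
  show "\<forall>p\<in>F. \<forall>\<eta>\<in>directions p. \<forall>\<zeta>\<in>directions p. cos_condition p F \<eta> \<zeta>"
  proof (intro ballI)
    fix p \<eta> \<zeta> assume "p \<in> F" "\<eta> \<in> directions p" "\<zeta> \<in> directions p"
    then show "cos_condition p F \<eta> \<zeta>"
      using cos_condition_of_dense[OF cos_condition_geodesics[OF ext]] by simp
  qed
next
  assume "\<forall>p\<in>F. \<forall>\<eta>\<in>directions p. \<forall>\<zeta>\<in>directions p. cos_condition p F \<eta> \<zeta>"
  then show "extremal F" by (intro extremal_of_cos_condition[OF assms]) simp
qed

end

section \<open>Passage from \<open>Alex\<close> to the locale, and the theorem\<close>

lemma alex_of_Alex:
  assumes "Alex k TYPE('a::metric_space)"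
  obtains c where "alexandrov TYPE('a) c"
proof -
  have A: "complete (UNIV :: 'a set)" "length_space TYPE('a)" "curvature_ge k TYPE('a)"
    "hausdorff_dim (UNIV :: 'a set) < \<infinity>"
    using assms by (auto simp: Alex_def)
  obtain c where c: "c > 0" "\<And>x::'a. \<exists>r>0. four_point c (ball x r)"
    by (rule curvature_ge_four_point[OF A(3)]) blast
  have pack: "\<exists>R>0. packed p R" for p :: 'a
    using packing_bound[OF A(1,2,4) _ c(1)] c(2) by blast
  have "\<exists>r>0. compact (cball x r)" for x :: 'a
  proof -
    obtain R where R: "R > 0" "packed x R" using pack by blast
    with locally_compact_of_packing[OF A(1) R] show ?thesis by blast
  qed
  then have proper: "compact (cball x R)" for x :: 'a and R by (rule hopf_rinow[OF A(1,2)])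
  have "alexandrov TYPE('a) c"
    by unfold_locales (fact c pack proper min_geodesic_exists[OF A(2) proper])+
  then show ?thesis by (rule that)
qed

theorem corollaryB:
  fixes k :: real and F :: "'a::metric_space set"
  assumes "Alex k TYPE('a)" and "closed F"
  shows "extremal F \<longleftrightarrow>
    (\<forall>p \<in> F. \<forall>\<eta> \<in> directions p. \<forall>\<zeta> \<in> directions p.
       if directions_of p F = {} then cos (dir_dist \<eta> \<zeta>) \<ge> 0
       else \<exists>\<xi> \<in> directions_of p F. dir_dist \<eta> \<xi> \<le> pi / 2 \<and>
              cos (dir_dist \<eta> \<zeta>) \<ge> cos (dir_dist \<eta> \<xi>) * cos (dir_dist \<zeta> \<xi>))"
proof -
  obtain c where "alexandrov TYPE('a) c" by (rule alex_of_Alex[OF assms(1)])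
  then interpret alexandrov c "TYPE('a)" .
  show ?thesis
    using extremal_iff_cos_condition[OF assms(2)] unfolding cos_condition_def .
qed

end
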